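(* Let $0<s<1$, $p>1$, $q>1$, and let $$t_\pm=\sqrt{\frac{pq(q+1)}{p+1}}\pm\sqrt{\frac{pq(q+1)}{p+1}-\sqrt{\frac{pq(q+1)}{p+1}}}.$$ (1) If $p\ge q>\frac43$ and $$N<2s+\frac{4s(p+1)}{pq-1}\,t_+,$$ then the system $$(-\Delta)^s u=v^p,\qquad (-\Delta)^s v=u^q\qquad\text{in }\mathbb{R}^N$$ has no stable positive solution. (2) If $1<q\le\min(p,\frac43)$, $t_-<\frac q2$, and $N<2s+\frac{4s(p+1)}{pq-1}\,t_+$, then the same system has no stable positive solution.
   Context: $N\ge1$ is an integer. The fractional Laplacian is $$(-\Delta)^s u(x)=c_{N,s}\lim_{\epsilon\to0}\int_{\mathbb{R}^N\setminus B_\epsilon(x)}\frac{u(x)-u(y)}{|x-y|^{N+2s}}\,dy,$$ where $c_{N,s}>0$ is the usual normalization constant. Let $$\mathcal{L}_s(\mathbb{R}^N)=\Big\{u:\mathbb{R}^N\to\mathbb{R}:\ \int_{\mathbb{R}^N}\frac{|u(y)|}{(1+|y|)^{N+2s}}\,dy<\infty\Big\}.$$ Solutions $(u,v)$ of the system are understood pointwise, with $u,v\in C^{2\sigma}(\mathbb{R}^N)\cap\mathcal{L}_s(\mathbb{R}^N)$ for some $\sigma>s$; positive means $u>0$ and $v>0$ in $\mathbb{R}^N$. A positive solution $(u,v)$ is called stable if there are two positive functions $\zeta_1,\zeta_2$ on $\mathbb{R}^N$ (in the same class $C^{2\sigma}(\mathbb{R}^N)\cap\mathcal{L}_s(\mathbb{R}^N)$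 for some $\sigma>s$) satisfying $$(-\Delta)^s\zeta_1=p\,v^{p-1}\zeta_2,\qquad(-\Delta)^s\zeta_2=q\,u^{q-1}\zeta_1\qquad\text{in }\mathbb{R}^N.$$ *)

theory Defs
  imports "HOL-Analysis.Analysis"
begin

text \<open>
  The normalization constant is
  \<open>c_{N,s} = 4^s \<Gamma>(N/2 + s) / (\<pi>^{N/2} |\<Gamma>(-s)|)\<close>, the one for which \<open>(-\<Delta>)\<^sup>s\<close> has Fourier
  symbol \<open>|\<xi>|^{2s}\<close> (for \<open>0 < s < 1\<close>).
\<close>

definition frac_const :: "nat \<Rightarrow> real \<Rightarrow> real" where
  "frac_const N s =
     4 powr s * Gamma (real N / 2 + s) / (pi powr (real N / 2) * \<bar>Gamma (- s)\<bar>)"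

text \<open>
  \<open>has_frac_laplacian s u x L\<close> says that the principal value defining \<open>(-\<Delta>)\<^sup>s u(x)\<close> exists
  and equals \<open>L\<close>. A relation is used because a total function would take an arbitrary value where
  the limit fails to exist.
\<close>

definition has_frac_laplacian ::
    "real \<Rightarrow> ('a::euclidean_space \<Rightarrow> real) \<Rightarrow> 'a \<Rightarrow> real \<Rightarrow> bool" where
  "has_frac_laplacian s u x L \<longleftrightarrow>
     (\<forall>\<epsilon>>0. set_integrable lborel (UNIV - ball x \<epsilon>)
        (\<lambda>y. (u x - u y) / norm (x - y) powr (real DIM('a) + 2 * s))) \<and>
     ((\<lambda>\<epsilon>. frac_const DIM('a) s *
        (LINT y:(UNIV - ball x \<epsilon>)|lborel.
           (u x - u y) / norm (x - y) powr (real DIM('a) + 2 * s)))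
      \<longlongrightarrow> L) (at_right 0)"

definition L_space :: "real \<Rightarrow> ('a::euclidean_space \<Rightarrow> real) set" where
  "L_space s = {u \<in> borel_measurable lborel.
     integrable lborel (\<lambda>y. \<bar>u y\<bar> / (1 + norm y) powr (real DIM('a) + 2 * s))}"

text \<open>
  \<open>Ck_holder k \<alpha>\<close> is the local class \<open>C^{k,\<alpha>}_{loc}\<close>: \<open>k\<close> times continuously differentiable, with
  partial derivatives of order \<open>k\<close> that are Hoelder continuous of exponent \<open>\<alpha>\<close> on compact sets.
  No bound over the whole space is imposed. For \<open>\<alpha> = 0\<close> it is just \<open>C^k\<close>, since continuous
  functions are bounded on compact sets.
\<close>

primrec Ck_holder :: "nat \<Rightarrow> real \<Rightarrow> ('a::euclidean_space \<Rightarrow> real) \<Rightarrow> bool" where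
  "Ck_holder 0 \<alpha> f \<longleftrightarrow>
     continuous_on UNIV f \<and>
     (\<forall>K. compact K \<longrightarrow>
        (\<exists>C. \<forall>x\<in>K. \<forall>y\<in>K. \<bar>f x - f y\<bar> \<le> C * norm (x - y) powr \<alpha>))"
| "Ck_holder (Suc k) \<alpha> f \<longleftrightarrow>
     (\<forall>x. f differentiable (at x)) \<and>
     (\<forall>b\<in>Basis. Ck_holder k \<alpha> (\<lambda>x. frechet_derivative f (at x) b))"

text \<open>The class \<open>C^\<beta>\<close> for real \<open>\<beta> \<ge> 0\<close>.\<close>

definition C_space :: "real \<Rightarrow> ('a::euclidean_space \<Rightarrow> real) set" where
  "C_space \<beta> = {f. Ck_holder (nat \<lfloor>\<beta>\<rfloor>) (frac \<beta>) f}"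

definition positive_solution ::
    "real \<Rightarrow> real \<Rightarrow> real \<Rightarrow> ('a::euclidean_space \<Rightarrow> real) \<Rightarrow> ('a \<Rightarrow> real) \<Rightarrow> bool" where
  "positive_solution s p q u v \<longleftrightarrow>
     (\<exists>\<sigma>>s. u \<in> C_space (2 * \<sigma>) \<inter> L_space s \<and> v \<in> C_space (2 * \<sigma>) \<inter> L_space s) \<and>
     (\<forall>x. u x > 0) \<and> (\<forall>x. v x > 0) \<and>
     (\<forall>x. has_frac_laplacian s u x (v x powr p)) \<and>
     (\<forall>x. has_frac_laplacian s v x (u x powr q))"

definition stable_solution ::
    "real \<Rightarrow> real \<Rightarrow> real \<Rightarrow> ('a::euclidean_space \<Rightarrow> real) \<Rightarrow> ('a \<Rightarrow> real) \<Rightarrow> bool" where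
  "stable_solution s p q u v \<longleftrightarrow>
     (\<exists>\<zeta>1 \<zeta>2.
        (\<exists>\<sigma>>s. \<zeta>1 \<in> C_space (2 * \<sigma>) \<inter> L_space s \<and> \<zeta>2 \<in> C_space (2 * \<sigma>) \<inter> L_space s) \<and>
        (\<forall>x. \<zeta>1 x > 0) \<and> (\<forall>x. \<zeta>2 x > 0) \<and>
        (\<forall>x. has_frac_laplacian s \<zeta>1 x (p * v x powr (p - 1) * \<zeta>2 x)) \<and>
        (\<forall>x. has_frac_laplacian s \<zeta>2 x (q * u x powr (q - 1) * \<zeta>1 x)))"

definition t_plus :: "real \<Rightarrow> real \<Rightarrow> real" where
  "t_plus p q = sqrt (p * q * (q + 1) / (p + 1)) +
     sqrt (p * q * (q + 1) / (p + 1) - sqrt (p * q * (q + 1) / (p + 1)))"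

definition t_minus :: "real \<Rightarrow> real \<Rightarrow> real" where
  "t_minus p q = sqrt (p * q * (q + 1) / (p + 1)) -
     sqrt (p * q * (q + 1) / (p + 1) - sqrt (p * q * (q + 1) / (p + 1)))"

end

theory Submission
  imports Defs
begin

text \<open>
  Every step is an estimate \<open>\<integral> Y \<rho>\<^sub>R \<le> C R^(-2s) \<integral> Z \<rho>\<^sub>R\<close> with the weight \<open>\<rho>\<^sub>R = (1 + |x|/R)^(-N-2s)\<close>. It is obtained by
  testing the equations with \<open>F \<eta>\<^sup>2\<close>, where \<open>\<eta>\<close> is a truncation of \<open>\<rho>\<^sub>R^(1/2)\<close>, and it only needs a pointwise
  inequality for the symmetrized integrand, since \<open>\<integral> (\<eta> x - \<eta> y)\<^sup>2 |x - y|^(-N-2s) dy \<le> C R^(-2s) \<rho>\<^sub>R(x)\<close>. If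
  \<open>Y = X^(r+b)\<close>, \<open>Z = X^r\<close> and \<open>N < 2 s (r + b) / b\<close>, then \<open>R \<rightarrow> \<infinity>\<close> forces \<open>X = 0\<close>.

  With \<open>X = (v - l u\<^sup>a)\<^sub>+\<close>, \<open>a = (q+1)/(p+1)\<close>, this gives the comparison \<open>v \<le> l u\<^sup>a\<close>. For \<open>t\<^sub>- < t < t\<^sub>+\<close> one combines
  the first equation tested with \<open>u^(2t-1)\<close> and Picone's inequality for the test function \<open>u^t\<close> applied to
  \<open>\<zeta>\<^sub>1\<close>, \<open>\<zeta>\<^sub>2\<close> and \<open>v\<close>. Since \<open>u^(2t+q)/v\<close> dominates \<open>u^(2t+b)\<close> with \<open>b = q - a = (pq-1)/(p+1)\<close>, this is the case
  \<open>X = u\<close>, \<open>r = 2t\<close>, and \<open>t \<rightarrow> t\<^sub>+\<close> gives the critical dimension. The required integrability of \<open>u^(2t) \<rho>\<^sub>1\<close> is reached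
  in steps of length \<open>b\<close> from the exponents below \<open>q\<close>, which is why \<open>t\<^sub>- < q/2\<close> is needed.
\<close>

section \<open>The kernel and the weight\<close>

text \<open>The decay N + 2s of the weight is the one that the nonlocal tail forces on the energy
  density of any bump, and it is also the decay in \<open>L_space\<close>. So one family of weights
  serves both purposes. The regularity class is local: the principal value is dominated only on
  compact sets, so the square root of the weight is truncated first and the truncation is removed by
  monotone convergence. In advance only the first powers of the solutions are known to be integrable
  against the weight, so each estimate must also deliver the integrability of its left-hand side.
  The number T = sqrt (pq(q+1)/(p+1)) is what AM-GM and the comparison extract from stability;
  Cauchy-Schwarz for powers contributes the constant (2t-1)/t^2. They balance when t^2 = T(2t-1),
  whose roots are the two numbers t in the statement. Strictly between the roots there is slack,
  which pays for the cut-off and for the term that improves the exponent. The constant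
  \<open>l\<close> is fixed by l^(p+1) = (p+1)/(q+1), so the comparison reads v^(p+1)/(p+1) <=
  u^(q+1)/(q+1).\<close>

definition kern :: "real \<Rightarrow> 'a::euclidean_space \<Rightarrow> real" where
  "kern s z = 1 / norm z powr (real DIM('a) + 2 * s)"

text \<open>At \<open>R = 1\<close> this is the weight of \<open>L_space\<close>; at infinity it
  decays exactly like \<open>kern\<close>.\<close>

definition weight :: "real \<Rightarrow> real \<Rightarrow> 'a::euclidean_space \<Rightarrow> real" where
  "weight s R x = (1 + norm x / R) powr - (real DIM('a) + 2 * s)"

lemma kern_nonneg [simp]: "0 \<le> kern s z"
  by (simp add: kern_def)

lemma kern_minus [simp]: "kern s (- z) = kern s z"
  by (simp add: kern_def)

lemma kern_commute: "kern s (x - y) = kern s (y - x)"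
  by (simp add: kern_def norm_minus_commute)

lemma kern_measurable [measurable]: "kern s \<in> borel_measurable borel"
  unfolding kern_def by measurable

lemma kern_mono: "0 < c \<Longrightarrow> c \<le> norm z \<Longrightarrow> 0 < s \<Longrightarrow> kern s (z::'a::euclidean_space) \<le> c powr - (real DIM('a) + 2 * s)"
  unfolding kern_def powr_minus_divide by (intro divide_left_mono powr_mono2 mult_pos_pos) auto

lemma weight_nonneg [simp]: "0 \<le> weight s R x"
  by (simp add: weight_def)

lemma weight_measurable [measurable]: "weight s R \<in> borel_measurable borel"
  unfolding weight_def by measurable

lemma weight_pos: "0 < R \<Longrightarrow> 0 < weight s R x"
  unfolding weight_def by (smt (verit) divide_nonneg_nonneg norm_ge_zero powr_gt_zero)

text \<open>Layer-cake argument: \<open>|z| powr - M\<close> is the integral of \<open>M * t powr (- M - 1)\<close> over \<open>t \<ge> |z|\<close>.\<close>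

lemma nn_integral_min_kern:
  assumes s: "0 < s" and \<tau>: "2 * s < \<tau>"
  obtains C where "0 \<le> C"
    "\<And>A. 0 < A \<Longrightarrow> (\<integral>\<^sup>+z. ennreal (min (norm z) A powr \<tau> * kern s (z::'a::euclidean_space)) \<partial>lborel)
       \<le> ennreal (C * A powr (\<tau> - 2 * s))"
proof -
  define N where "N = DIM('a)"
  define M where "M = real N + 2 * s"
  have M: "0 < M" using s by (simp add: M_def add_nonneg_pos)
  define D where "D = M * unit_ball_vol (real N)"
  have D: "0 \<le> D" using M by (simp add: D_def)
  define C where "C = D * (1 / (\<tau> - 2 * s) + 1 / (2 * s))"
  show ?thesis
  proof (rule that[of C])
    show "0 \<le> C" using D s \<tau> by (simp add: C_def)
    fix A :: real assume A: "0 < A"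
    let ?g = "\<lambda>t (z::'a). ennreal (min (norm z) A powr \<tau> * (M * t powr (- M - 1))) * indicator {norm z..} t"
    have "(\<integral>\<^sup>+z. ennreal (min (norm z) A powr \<tau> * kern s (z::'a)) \<partial>lborel)
        = (\<integral>\<^sup>+z. \<integral>\<^sup>+t. ?g t z \<partial>lborel \<partial>lborel)"
    proof (rule nn_integral_cong)
      fix z :: 'a
      show "ennreal (min (norm z) A powr \<tau> * kern s z) = (\<integral>\<^sup>+t. ?g t z \<partial>lborel)"
      proof (cases "z = 0")
        case True
        then show ?thesis using A by (simp add: min_def)
      next
        case False
        have "((\<lambda>t. M * t powr (- M - 1)) has_integral M * (- (norm z powr (- M - 1 + 1)) / (- M - 1 + 1))) {norm z..}"
          using M False by (intro has_integral_mult_right has_integral_powr_to_inf) auto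
        then have "(\<integral>\<^sup>+t. ennreal (M * t powr (- M - 1)) * indicator {norm z..} t \<partial>lborel) = ennreal (norm z powr - M)"
          using M by (subst nn_integral_has_integral_lebesgue') auto
        moreover have "kern s z = norm z powr - M"
          unfolding kern_def M_def N_def powr_minus_divide ..
        moreover have "(\<integral>\<^sup>+t. ?g t z \<partial>lborel)
            = (\<integral>\<^sup>+t. ennreal (min (norm z) A powr \<tau>) * (ennreal (M * t powr (- M - 1)) * indicator {norm z..} t) \<partial>lborel)"
          using M by (intro nn_integral_cong) (simp add: ennreal_mult mult.assoc)
        ultimately show ?thesis
          by (simp add: nn_integral_cmult ennreal_mult)
      qed
    qed
    also have "\<dots> = (\<integral>\<^sup>+t. \<integral>\<^sup>+z. ?g t z \<partial>lborel \<partial>lborel)"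
    proof (rule lborel_pair.Fubini')
      have *: "?g t z = ennreal (min (norm z) A powr \<tau> * (M * t powr (- M - 1))) * (if norm z \<le> t then 1 else 0)" for t z
        by (simp add: indicator_def)
      show "(\<lambda>(t, z). ?g t z) \<in> borel_measurable (lborel \<Otimes>\<^sub>M lborel)"
        unfolding * case_prod_beta by measurable
    qed
    \<comment> \<open>Layer \<open>t\<close> sees only the ball of radius \<open>t\<close>, whose
      volume turns the density t^(-M-1) into t^(-2s-1). Below \<open>A\<close> the extra factor
      t^\<tau> gives integrability at 0 because \<tau> > 2s; above \<open>A\<close> it stays at
      A^\<tau> and s > 0 gives integrability at infinity.\<close>
    also have "\<dots> \<le> (\<integral>\<^sup>+t. ennreal D * (ennreal (t powr (\<tau> - 2 * s - 1)) * indicator {0..A} t)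
          + ennreal (D * A powr \<tau>) * (ennreal (t powr (- 2 * s - 1)) * indicator {A..} t) \<partial>lborel)"
    proof (rule nn_integral_mono)
      fix t :: real
      show "(\<integral>\<^sup>+z. ?g t z \<partial>lborel) \<le> ennreal D * (ennreal (t powr (\<tau> - 2 * s - 1)) * indicator {0..A} t)
          + ennreal (D * A powr \<tau>) * (ennreal (t powr (- 2 * s - 1)) * indicator {A..} t)"
      proof (cases "0 < t")
        case False
        then have "?g t z = 0" for z
        proof (cases "z = 0")
          case nz: False
          then have "t \<notin> {norm z..}"
            using False by (smt (verit) atLeast_iff zero_less_norm_iff)
          then show ?thesis by simp
        qed (use A in \<open>simp add: min_def\<close>)
        then have "(\<integral>\<^sup>+z. ?g t z \<partial>lborel) = (\<integral>\<^sup>+(z::'a). 0 \<partial>lborel)"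
          by (intro nn_integral_cong)
        then show ?thesis by simp
      next
        case True
        define c where "c = min t A powr \<tau> * (M * t powr (- M - 1))"
        have "(\<integral>\<^sup>+z. ?g t z \<partial>lborel) \<le> (\<integral>\<^sup>+z. ennreal c * indicator (cball (0::'a) t) z \<partial>lborel)"
        proof (intro nn_integral_mono)
          fix z :: 'a
          show "?g t z \<le> ennreal c * indicator (cball 0 t) z"
          proof (cases "norm z \<le> t")
            case True
            then have "min (norm z) A powr \<tau> * (M * t powr (- M - 1)) \<le> c"
              unfolding c_def using M A s \<tau> by (intro mult_right_mono powr_mono2) auto
            then show ?thesis
              using True by (simp add: ennreal_leI)
          qed simp
        qed
        also have "\<dots> = ennreal c * ennreal (unit_ball_vol (real N) * t ^ N)"
          using True by (simp add: nn_integral_cmult_indicator emeasure_cball N_def)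
        also have "\<dots> = ennreal (D * (min t A powr \<tau> * t powr (- 2 * s - 1)))"
        proof -
          have "t powr (- M - 1) * t ^ N = t powr (- 2 * s - 1)"
            using True by (simp add: M_def flip: powr_realpow powr_add)
          then have "c * (unit_ball_vol (real N) * t ^ N) = D * (min t A powr \<tau> * t powr (- 2 * s - 1))"
            by (simp add: c_def D_def mult_ac)
          moreover have "0 \<le> c" using M by (simp add: c_def)
          ultimately show ?thesis
            using True by (simp flip: ennreal_mult)
        qed
        also have "\<dots> \<le> ennreal D * (ennreal (t powr (\<tau> - 2 * s - 1)) * indicator {0..A} t)
          + ennreal (D * A powr \<tau>) * (ennreal (t powr (- 2 * s - 1)) * indicator {A..} t)"
        proof (cases "t \<le> A")
          case le: True
          have "min t A powr \<tau> * t powr (- 2 * s - 1) = t powr (\<tau> - 2 * s - 1)"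
            using le True by (simp add: min_def algebra_simps flip: powr_add)
          then have "ennreal (D * (min t A powr \<tau> * t powr (- 2 * s - 1)))
              = ennreal D * (ennreal (t powr (\<tau> - 2 * s - 1)) * indicator {0..A} t)"
            using le True D by (simp add: ennreal_mult)
          then show ?thesis by simp
        next
          case False
          then show ?thesis using D by (simp add: min_def ennreal_mult mult_ac)
        qed
        finally show ?thesis .
      qed
    qed
    also have "\<dots> = ennreal D * ennreal (A powr (\<tau> - 2 * s) / (\<tau> - 2 * s))
        + ennreal (D * A powr \<tau>) * ennreal (A powr (- 2 * s) / (2 * s))"
    proof -
      have "((\<lambda>t. t powr (\<tau> - 2 * s - 1)) has_integral (A powr (\<tau> - 2 * s - 1 + 1) / (\<tau> - 2 * s - 1 + 1))) {0..A}"
        using \<tau> A by (intro has_integral_powr_from_0) auto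
      then have 1: "(\<integral>\<^sup>+t. ennreal (t powr (\<tau> - 2 * s - 1)) * indicator {0..A} t \<partial>lborel) = ennreal (A powr (\<tau> - 2 * s) / (\<tau> - 2 * s))"
        by (subst nn_integral_has_integral_lebesgue') auto
      have "((\<lambda>t. t powr (- 2 * s - 1)) has_integral (- (A powr (- 2 * s - 1 + 1)) / (- 2 * s - 1 + 1))) {A..}"
        using s A by (intro has_integral_powr_to_inf) auto
      then have 2: "(\<integral>\<^sup>+t. ennreal (t powr (- 2 * s - 1)) * indicator {A..} t \<partial>lborel) = ennreal (A powr (- 2 * s) / (2 * s))"
        by (subst nn_integral_has_integral_lebesgue') auto
      show ?thesis
        by (subst nn_integral_add) (auto simp: nn_integral_cmult 1 2[simplified])
    qed
    also have "\<dots> = ennreal (C * A powr (\<tau> - 2 * s))"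
    proof -
      have "A powr \<tau> * A powr (- 2 * s) = A powr (\<tau> - 2 * s)"
        by (simp flip: powr_add)
      then have "D * (A powr (\<tau> - 2 * s) / (\<tau> - 2 * s)) + D * A powr \<tau> * (A powr (- 2 * s) / (2 * s)) = C * A powr (\<tau> - 2 * s)"
        by (simp add: C_def algebra_simps)
      then show ?thesis
        using D s \<tau> by (simp flip: ennreal_mult ennreal_plus)
    qed
    finally show "(\<integral>\<^sup>+z. ennreal (min (norm z) A powr \<tau> * kern s (z::'a)) \<partial>lborel) \<le> ennreal (C * A powr (\<tau> - 2 * s))" .
  qed
qed

lemma distr_lborel_reflect: "distr lborel borel (\<lambda>z. x - z) = (lborel :: 'a::euclidean_space measure)"
  using lborel_affine[of "-1" x] by (simp add: density_1)

lemma nn_integral_lborel_reflect: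
  fixes f :: "'a::euclidean_space \<Rightarrow> ennreal"
  assumes [measurable]: "f \<in> borel_measurable borel"
  shows "(\<integral>\<^sup>+y. f (x - y) \<partial>lborel) = (\<integral>\<^sup>+z. f z \<partial>lborel)"
proof -
  have "(\<integral>\<^sup>+z. f z \<partial>lborel) = (\<integral>\<^sup>+z. f z \<partial>distr lborel borel (\<lambda>z. x - z))"
    by (simp add: distr_lborel_reflect)
  also have "\<dots> = (\<integral>\<^sup>+y. f (x - y) \<partial>lborel)"
    by (subst nn_integral_distr) auto
  finally show ?thesis ..
qed

text \<open>Where |z| >= c the factor \<open>min (norm z) c powr \<tau>\<close> is the constant
  c^\<tau>, so the previous bound can be divided by it. Any \<tau> > 2s serves; 2s + 1 is a
  convenient choice.\<close>

lemma nn_integral_kern_far: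
  assumes s: "0 < s"
  obtains C where "0 \<le> C"
    "\<And>c. 0 < c \<Longrightarrow> (\<integral>\<^sup>+z. ennreal (indicator {z. c \<le> norm z} z * kern s (z::'a::euclidean_space)) \<partial>lborel)
       \<le> ennreal (C * c powr (- 2 * s))"
proof -
  define \<tau> where "\<tau> = 2 * s + 1"
  obtain C where C: "0 \<le> C"
    "\<And>A. 0 < A \<Longrightarrow> (\<integral>\<^sup>+z. ennreal (min (norm z) A powr \<tau> * kern s (z::'a)) \<partial>lborel)
       \<le> ennreal (C * A powr (\<tau> - 2 * s))"
    using nn_integral_min_kern[OF s, of \<tau>] unfolding \<tau>_def by auto
  show ?thesis
  proof (rule that[OF C(1)])
    fix c :: real assume c: "0 < c"
    have "(\<integral>\<^sup>+z. ennreal (indicator {z. c \<le> norm z} z * kern s (z::'a)) \<partial>lborel)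
      \<le> (\<integral>\<^sup>+z. ennreal (c powr - \<tau>) * ennreal (min (norm z) c powr \<tau> * kern s (z::'a)) \<partial>lborel)"
    proof (intro nn_integral_mono)
      fix z :: 'a
      show "ennreal (indicator {z. c \<le> norm z} z * kern s z)
        \<le> ennreal (c powr - \<tau>) * ennreal (min (norm z) c powr \<tau> * kern s z)"
      proof (cases "c \<le> norm z")
        case True
        have eq: "c powr - \<tau> * (c powr \<tau> * kern s z) = kern s z"
          using c by (simp add: powr_minus)
        then show ?thesis
          using True by (simp only: min_def ennreal_mult[symmetric] powr_ge_zero kern_nonneg mult_nonneg_nonneg)
            (simp add: eq)
      qed simp
    qed
    also have "\<dots> = ennreal (c powr - \<tau>) * (\<integral>\<^sup>+z. ennreal (min (norm z) c powr \<tau> * kern s (z::'a)) \<partial>lborel)"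
      by (intro nn_integral_cmult) measurable
    also have "\<dots> \<le> ennreal (c powr - \<tau>) * ennreal (C * c powr (\<tau> - 2 * s))"
      using C(2)[OF c] by (intro mult_left_mono) auto
    also have "\<dots> = ennreal (C * c powr (- 2 * s))"
    proof -
      have "c powr - \<tau> * (C * c powr (\<tau> - 2 * s)) = C * (c powr - \<tau> * c powr (\<tau> - 2 * s))"
        by simp
      also have "\<dots> = C * c powr (- 2 * s)"
        by (simp only: powr_add[symmetric]) simp
      finally show ?thesis
        using C(1) by (simp flip: ennreal_mult)
    qed
    finally show "(\<integral>\<^sup>+z. ennreal (indicator {z. c \<le> norm z} z * kern s (z::'a)) \<partial>lborel)
       \<le> ennreal (C * c powr (- 2 * s))" .
  qed
qed

lemma weight_le_1: "0 < R \<Longrightarrow> 0 < s \<Longrightarrow> weight s R (x::'a::euclidean_space) \<le> 1"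
  unfolding weight_def using powr_mono2'[of "- (real DIM('a) + 2 * s)" 1 "1 + norm x / R"] by simp

text \<open>The weight is at most 1 on the ball of radius R and at most R^(N+2s) times the kernel
  outside; both parts have mass of order R^N.\<close>

lemma nn_integral_weight:
  assumes s: "0 < s"
  obtains C where "0 < C"
    "\<And>R. 0 < R \<Longrightarrow> (\<integral>\<^sup>+x. ennreal (weight s R (x::'a::euclidean_space)) \<partial>lborel) \<le> ennreal (C * R ^ DIM('a))"
proof -
  define N where "N = DIM('a)"
  obtain C where C: "0 \<le> C"
    "\<And>c. 0 < c \<Longrightarrow> (\<integral>\<^sup>+z. ennreal (indicator {z. c \<le> norm z} z * kern s (z::'a)) \<partial>lborel)
       \<le> ennreal (C * c powr (- 2 * s))"
    using nn_integral_kern_far[OF s] by blast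
  show ?thesis
  proof (rule that[of "unit_ball_vol (real N) + C"])
    show "0 < unit_ball_vol (real N) + C" using C(1) by (intro add_pos_nonneg) auto
    fix R :: real assume R: "0 < R"
    have "(\<integral>\<^sup>+x. ennreal (weight s R (x::'a)) \<partial>lborel) \<le>
      (\<integral>\<^sup>+x. indicator (cball 0 R) x + ennreal (R powr (real N + 2 * s)) * ennreal (indicator {z. R \<le> norm z} x * kern s (x::'a)) \<partial>lborel)"
    proof (intro nn_integral_mono)
      fix x :: 'a
      show "ennreal (weight s R x) \<le> indicator (cball 0 R) x + ennreal (R powr (real N + 2 * s)) * ennreal (indicator {z. R \<le> norm z} x * kern s x)"
      proof (cases "norm x \<le> R")
        case True
        then have "ennreal (weight s R x) \<le> indicator (cball 0 R) x"
          using weight_le_1[OF R s, of x] by simp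
        then show ?thesis by (simp add: add_increasing2)
      next
        case False
        have "weight s R x \<le> (norm x / R) powr - (real N + 2 * s)"
        proof -
          have "0 < norm x / R" using R False by (intro divide_pos_pos) linarith+
          then show ?thesis
            unfolding weight_def N_def using s by (intro powr_mono2') auto
        qed
        also have "\<dots> = R powr (real N + 2 * s) * kern s x"
          unfolding powr_minus_divide using R by (simp add: powr_divide kern_def N_def)
        finally show ?thesis
          using False by (simp flip: ennreal_mult add: ennreal_leI)
      qed
    qed
    also have "\<dots> = emeasure lborel (cball (0::'a) R)
        + ennreal (R powr (real N + 2 * s)) * (\<integral>\<^sup>+x. ennreal (indicator {z. R \<le> norm z} x * kern s (x::'a)) \<partial>lborel)"
      by (subst nn_integral_add) (auto simp: nn_integral_cmult intro!: borel_measurable_indicator)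
    also have "\<dots> \<le> ennreal (unit_ball_vol (real N) * R ^ N)
        + ennreal (R powr (real N + 2 * s)) * ennreal (C * R powr (- 2 * s))"
      using R C(2)[OF R] by (intro add_mono mult_left_mono) (auto simp: emeasure_cball N_def)
    also have "\<dots> = ennreal ((unit_ball_vol (real N) + C) * R ^ DIM('a))"
    proof -
      have "R powr (real N + 2 * s) * (C * R powr (- 2 * s)) = C * R ^ N"
        using R by (simp add: powr_add powr_minus powr_realpow)
      then show ?thesis
        using R C(1) by (simp add: algebra_simps N_def flip: ennreal_mult ennreal_plus)
    qed
    finally show "(\<integral>\<^sup>+x. ennreal (weight s R (x::'a)) \<partial>lborel) \<le> ennreal ((unit_ball_vol (real N) + C) * R ^ DIM('a))" .
  qed
qed

lemma sqrt_weight: "0 < R \<Longrightarrow> sqrt (weight s R x) = (1 + norm (x::'a::euclidean_space) / R) powr - ((real DIM('a) + 2 * s) / 2)"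
  unfolding weight_def by (subst powr_half_sqrt[symmetric]) (auto simp: powr_powr minus_divide_left)

text \<open>Mean value theorem for the radial profile. At radii within (R + |x|)/2 of |x| the
  quantity 1 + r/R loses at most a factor 2, so the derivative of the profile is controlled by its
  value at |x|, at the cost of \<open>2 powr m\<close>.\<close>

lemma sqrt_weight_near:
  fixes x y :: "'a::euclidean_space"
  assumes s: "0 < s" and R: "0 < R" and m: "m = (real DIM('a) + 2 * s) / 2"
    and near: "norm (x - y) \<le> (R + norm x) / 2"
  shows "(sqrt (weight s R x) - sqrt (weight s R y))\<^sup>2
     \<le> (m * 2 powr m)\<^sup>2 * weight s R x * (norm (x - y))\<^sup>2 / ((R + norm x) / 2)\<^sup>2"
proof -
  define A where "A = (R + norm x) / 2"
  have A: "0 < A" using R by (simp add: A_def add_pos_nonneg)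
  have m0: "0 < m" using s by (simp add: m add_nonneg_pos)
  define g where "g = (\<lambda>r. (1 + r / R) powr - m)"
  define L where "L = m * 2 powr m * g (norm x) / A"
  have "norm (g (norm y) - g (norm x)) \<le> L * norm (norm y - norm x)"
  proof (rule field_differentiable_bound[where S = "{0..} \<inter> {norm x - A..}" and f' = "\<lambda>r. - m * (1 + r / R) powr (- m - 1) / R"])
    show "convex ({0..} \<inter> {norm x - A..})" by (intro convex_Int) auto
    have "norm x \<le> norm y + norm (x - y)"
      by (metis norm_triangle_sub add.commute)
    then show "norm y \<in> {0..} \<inter> {norm x - A..}" using near A_def by auto
    show "norm x \<in> {0..} \<inter> {norm x - A..}" using A by auto
    fix r assume r: "r \<in> {0..} \<inter> {norm x - A..}"
    then have r1: "0 < 1 + r / R" using R by (simp add: add_pos_nonneg)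
    show "(g has_field_derivative - m * (1 + r / R) powr (- m - 1) / R) (at r within {0..} \<inter> {norm x - A..})"
      unfolding g_def using R r1 by (auto intro!: derivative_eq_intros)
    \<comment> \<open>r >= |x| - A is the same as R + r >= A + (R + |x|) - 2A + ... = (R + |x|)/2,
      since A is half of R + |x|.\<close>
    have lower: "(1 + norm x / R) / 2 \<le> 1 + r / R"
    proof -
      have "(R + norm x) / (2 * R) \<le> 2 * (R + r) / (2 * R)"
        using r R unfolding A_def by (intro divide_right_mono) (auto simp: field_simps)
      then show ?thesis
        using R by (simp add: add_divide_distrib)
    qed
    have hx: "0 < 1 + norm x / R" using R by (simp add: add_pos_nonneg)
    have "(1 + r / R) powr (- m - 1) \<le> ((1 + norm x / R) / 2) powr (- m - 1)"
      using lower hx m0 by (intro powr_mono2') auto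
    also have "\<dots> = (1 + norm x / R) powr (- m - 1) * 2 powr (m + 1)"
      using hx by (simp add: powr_divide) (simp add: powr_minus powr_diff powr_add field_simps)
    also have "\<dots> = g (norm x) * 2 powr m * (2 / (1 + norm x / R))"
      using hx by (simp add: g_def powr_diff powr_add)
    also have "2 / (1 + norm x / R) = R / A"
      using R A by (simp add: A_def field_simps)
    finally have "m * (1 + r / R) powr (- m - 1) / R \<le> m * (g (norm x) * 2 powr m * (R / A)) / R"
      using m0 R by (intro divide_right_mono mult_left_mono) auto
    also have "\<dots> = L"
      using R by (simp add: L_def)
    finally show "norm (- m * (1 + r / R) powr (- m - 1) / R) \<le> L"
      using m0 R by simp
  qed
  also have "\<dots> \<le> L * norm (x - y)"
  proof (intro mult_left_mono)
    show "norm (norm y - norm x) \<le> norm (x - y)"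
      using norm_triangle_ineq3[of y x] by (simp add: norm_minus_commute)
    show "0 \<le> L" using m0 A by (simp add: L_def g_def)
  qed
  finally have "\<bar>g (norm y) - g (norm x)\<bar>\<^sup>2 \<le> (L * norm (x - y))\<^sup>2"
    by (intro power_mono) auto
  moreover have g: "sqrt (weight s R z) = g (norm z)" for z :: 'a
    using sqrt_weight[OF R, of s z] by (simp add: g_def m)
  moreover have "weight s R x = (g (norm x))\<^sup>2"
    by (simp flip: g)
  moreover have "0 \<le> g r" for r
    by (simp add: g_def)
  ultimately show ?thesis
    by (simp add: L_def A_def power_mult_distrib power_divide power2_commute mult_ac)
qed

text \<open>Split at |x - y| = A = (R + |x|)/2. Nearby, the Lipschitz bound leaves |x - y|^2 against
  the kernel, integrable since s < 1. Far away the kernel is at most A^(-N-2s), and multiplied by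
  the total mass R^N of the weight this is again R^(-2s) times the weight at x. This last
  coincidence dictates the exponent of the weight.\<close>

lemma nn_integral_sqrt_weight_energy:
  assumes s: "0 < s" "s < 1"
  obtains C where "0 < C"
    "\<And>R x. 0 < R \<Longrightarrow> (\<integral>\<^sup>+y. ennreal ((sqrt (weight s R x) - sqrt (weight s R y))\<^sup>2 * kern s (x - y :: 'a::euclidean_space)) \<partial>lborel)
       \<le> ennreal (C * R powr (- 2 * s) * weight s R x)"
proof -
  define N where "N = DIM('a)"
  define M where "M = real N + 2 * s"
  define m where "m = M / 2"
  obtain C1 where C1: "0 \<le> C1"
    "\<And>A. 0 < A \<Longrightarrow> (\<integral>\<^sup>+z. ennreal (min (norm z) A powr 2 * kern s (z::'a)) \<partial>lborel)
       \<le> ennreal (C1 * A powr (2 - 2 * s))"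
    using nn_integral_min_kern[OF s(1), of 2] s by auto
  obtain C2 where C2: "0 < C2"
    "\<And>R. 0 < R \<Longrightarrow> (\<integral>\<^sup>+x. ennreal (weight s R (x::'a)) \<partial>lborel) \<le> ennreal (C2 * R ^ N)"
    using nn_integral_weight[OF s(1), where 'a = 'a] unfolding N_def by blast
  \<comment> \<open>The \<open>+ 1\<close> gives K >= 1, so that the same term also covers the
    contribution of the weight at \<open>x\<close> in the far region.\<close>
  define K where "K = (m * 2 powr m)\<^sup>2 + 1"
  have K: "0 < K" by (simp add: K_def add_nonneg_pos)
  have Mpos: "0 < M" using s by (simp add: M_def add_nonneg_pos)
  define C where "C = K * C1 * 4 powr s + 2 powr M * C2"
  show ?thesis
  proof (rule that[of C])
    show "0 < C" unfolding C_def using C1 C2 K by (intro add_nonneg_pos) auto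
    fix R :: real and x :: 'a
    assume R: "0 < R"
    define A where "A = (R + norm x) / 2"
    have A: "0 < A" using R by (simp add: A_def add_pos_nonneg)
    let ?w = "weight s R :: 'a \<Rightarrow> real"
    have "(\<integral>\<^sup>+y. ennreal ((sqrt (?w x) - sqrt (?w y))\<^sup>2 * kern s (x - y)) \<partial>lborel)
      \<le> (\<integral>\<^sup>+y. ennreal (K * ?w x / A\<^sup>2) * ennreal (min (norm (x - y)) A powr 2 * kern s (x - y))
           + ennreal (A powr - M) * ennreal (?w y) \<partial>lborel)"
    proof (intro nn_integral_mono)
      fix y :: 'a
      have "(sqrt (?w x) - sqrt (?w y))\<^sup>2 * kern s (x - y)
        \<le> K * ?w x / A\<^sup>2 * (min (norm (x - y)) A powr 2 * kern s (x - y)) + A powr - M * ?w y"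
      proof (cases "norm (x - y) \<le> A")
        case True
        then have "(sqrt (?w x) - sqrt (?w y))\<^sup>2 \<le> (m * 2 powr m)\<^sup>2 * ?w x * (norm (x - y))\<^sup>2 / A\<^sup>2"
          unfolding A_def by (intro sqrt_weight_near s R) (auto simp: m_def M_def N_def)
        also have "\<dots> \<le> K * ?w x * (norm (x - y))\<^sup>2 / A\<^sup>2"
          by (intro divide_right_mono mult_right_mono) (auto simp: K_def)
        finally have "(sqrt (?w x) - sqrt (?w y))\<^sup>2 * kern s (x - y) \<le> K * ?w x * (norm (x - y))\<^sup>2 / A\<^sup>2 * kern s (x - y)"
          by (intro mult_right_mono) auto
        also have "\<dots> = K * ?w x / A\<^sup>2 * (min (norm (x - y)) A powr 2 * kern s (x - y))"
          using True by (simp add: min_def)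
        also have "\<dots> \<le> \<dots> + A powr - M * ?w y" by simp
        finally show ?thesis .
      next
        case False
        have "(sqrt (?w x) - sqrt (?w y))\<^sup>2 = ?w x + ?w y - 2 * sqrt (?w x) * sqrt (?w y)"
          by (simp add: power2_diff)
        also have "\<dots> \<le> ?w x + ?w y" by simp
        finally have "(sqrt (?w x) - sqrt (?w y))\<^sup>2 * kern s (x - y) \<le> (?w x + ?w y) * kern s (x - y)"
          by (intro mult_right_mono) auto
        also have "\<dots> = ?w x * kern s (x - y) + ?w y * kern s (x - y)"
          by (simp add: algebra_simps)
        also have "\<dots> \<le> K * ?w x * kern s (x - y) + A powr - M * ?w y"
        proof (rule add_mono)
          show "?w x * kern s (x - y) \<le> K * ?w x * kern s (x - y)"
            by (intro mult_right_mono mult_right_mono[of 1 K, simplified]) (auto simp: K_def)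
          have "kern s (x - y) \<le> A powr - M"
            using kern_mono[OF A _ s(1), of "x - y"] False by (simp add: M_def N_def)
          then show "?w y * kern s (x - y) \<le> A powr - M * ?w y"
            by (simp add: mult.commute[of _ "?w y"] mult_left_mono)
        qed
        also have "K * ?w x * kern s (x - y) = K * ?w x / A\<^sup>2 * (min (norm (x - y)) A powr 2 * kern s (x - y))"
          using False A by (simp add: min_def)
        finally show ?thesis .
      qed
      then show "ennreal ((sqrt (?w x) - sqrt (?w y))\<^sup>2 * kern s (x - y))
        \<le> ennreal (K * ?w x / A\<^sup>2) * ennreal (min (norm (x - y)) A powr 2 * kern s (x - y))
           + ennreal (A powr - M) * ennreal (?w y)"
        using K by (simp flip: ennreal_mult ennreal_plus add: ennreal_leI)
    qed
    also have "\<dots> = ennreal (K * ?w x / A\<^sup>2) * (\<integral>\<^sup>+y. ennreal (min (norm (x - y)) A powr 2 * kern s (x - y)) \<partial>lborel)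
           + ennreal (A powr - M) * (\<integral>\<^sup>+y. ennreal (?w y) \<partial>lborel)"
      by (subst nn_integral_add) (auto simp: nn_integral_cmult)
    also have "(\<integral>\<^sup>+y. ennreal (min (norm (x - y)) A powr 2 * kern s (x - y)) \<partial>lborel)
        = (\<integral>\<^sup>+z. ennreal (min (norm z) A powr 2 * kern s (z::'a)) \<partial>lborel)"
      by (rule nn_integral_lborel_reflect[of "\<lambda>z. ennreal (min (norm z) A powr 2 * kern s z)"]) measurable
    also have "ennreal (K * ?w x / A\<^sup>2) * \<dots> + ennreal (A powr - M) * (\<integral>\<^sup>+y. ennreal (?w y) \<partial>lborel)
      \<le> ennreal (K * ?w x / A\<^sup>2) * ennreal (C1 * A powr (2 - 2 * s)) + ennreal (A powr - M) * ennreal (C2 * R ^ N)"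
      using C1(2)[OF A] C2(2)[OF R] by (intro add_mono mult_left_mono) auto
    also have "\<dots> = ennreal (K * ?w x / A\<^sup>2 * (C1 * A powr (2 - 2 * s)) + A powr - M * (C2 * R ^ N))"
      using K C1(1) C2(1) R by (simp flip: ennreal_mult ennreal_plus)
    also have "\<dots> \<le> ennreal (C * R powr (- 2 * s) * ?w x)"
    proof (rule ennreal_leI)
      have "A powr (2 - 2 * s) = A\<^sup>2 * A powr (- 2 * s)"
        using A by (simp add: powr_diff powr_minus_divide)
      then have "K * ?w x / A\<^sup>2 * (C1 * A powr (2 - 2 * s)) = K * C1 * ?w x * A powr (- 2 * s)"
        using A by simp
      also have "\<dots> \<le> K * C1 * ?w x * (R / 2) powr (- 2 * s)"
        using K C1(1) R s by (intro mult_left_mono powr_mono2') (auto simp: A_def)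
      also have "(R / 2) powr (- 2 * s) = R powr (- 2 * s) * 4 powr s"
      proof -
        have "(4::real) powr s = 2 powr (2 * s)"
          by (subst powr_powr[symmetric]) simp
        then show ?thesis
          using R by (simp add: powr_divide powr_minus_divide)
      qed
      finally have 1: "K * ?w x / A\<^sup>2 * (C1 * A powr (2 - 2 * s)) \<le> K * C1 * 4 powr s * R powr (- 2 * s) * ?w x"
        by (simp add: mult_ac)
      have "A = (1 + norm x / R) * (R / 2)"
        using R by (simp add: A_def field_simps)
      then have "A powr - M = ((1 + norm x / R) * (R / 2)) powr - M"
        by (rule arg_cong)
      also have "\<dots> = (1 + norm x / R) powr - M * (R powr - M * 2 powr M)"
        using R by (subst powr_mult) (simp_all add: powr_divide powr_minus_divide)
      finally have "A powr - M = (1 + norm x / R) powr - M * (R powr - M * 2 powr M)" .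
      moreover have "(1 + norm x / R) powr - M = ?w x"
        by (simp add: weight_def M_def N_def)
      moreover have "R powr - M * R ^ N = R powr (- 2 * s)"
        using R by (simp add: M_def flip: powr_realpow powr_add)
      ultimately have "A powr - M * (C2 * R ^ N) = 2 powr M * C2 * R powr (- 2 * s) * ?w x"
        by (simp add: mult_ac)
      moreover have "C * R powr (- 2 * s) * ?w x = K * C1 * 4 powr s * R powr (- 2 * s) * ?w x + 2 powr M * C2 * R powr (- 2 * s) * ?w x"
        by (simp add: C_def algebra_simps)
      ultimately show "K * ?w x / A\<^sup>2 * (C1 * A powr (2 - 2 * s)) + A powr - M * (C2 * R ^ N) \<le> C * R powr (- 2 * s) * ?w x"
        using 1 by linarith
    qed
    finally show "(\<integral>\<^sup>+y. ennreal ((sqrt (?w x) - sqrt (?w y))\<^sup>2 * kern s (x - y)) \<partial>lborel)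
       \<le> ennreal (C * R powr (- 2 * s) * ?w x)" .
  qed
qed

section \<open>Truncated fractional Laplacians\<close>

lemma Ck_holder_continuous: "Ck_holder k \<alpha> f \<Longrightarrow> continuous_on UNIV f"
proof (cases k)
  case (Suc j)
  assume "Ck_holder k \<alpha> f"
  then have "f differentiable (at x)" for x
    using Suc by simp
  then show ?thesis
    by (simp add: continuous_at_imp_continuous_on differentiable_imp_continuous_within)
qed simp

lemma Ck_holder_Suc_bounded_derivative:
  fixes f :: "'a::euclidean_space \<Rightarrow> real"
  assumes f: "Ck_holder (Suc k) \<alpha> f"
  obtains C where "0 \<le> C" "\<And>x y. x \<in> cball 0 r \<Longrightarrow> y \<in> cball 0 r \<Longrightarrow> \<bar>f x - f y\<bar> \<le> C * norm (x - y)"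
proof -
  define D where "D = (\<lambda>x. frechet_derivative f (at x))"
  have der: "(f has_derivative D x) (at x)" for x
    using f by (simp add: D_def frechet_derivative_works)
  have "\<exists>M. \<forall>x\<in>cball 0 r. \<bar>D x b\<bar> \<le> M" if "b \<in> Basis" for b
  proof -
    have "continuous_on (cball 0 r) (\<lambda>x. D x b)"
      using f that Ck_holder_continuous continuous_on_subset unfolding D_def by (metis Ck_holder.simps(2) subset_UNIV)
    then have "bounded ((\<lambda>x. D x b) ` cball 0 r)"
      by (intro compact_imp_bounded compact_continuous_image) auto
    then show ?thesis
      by (auto simp: bounded_iff)
  qed
  then obtain M where M: "\<And>b x. b \<in> Basis \<Longrightarrow> x \<in> cball 0 r \<Longrightarrow> \<bar>D x b\<bar> \<le> M b"
    by metis
  define C where "C = (\<Sum>b\<in>(Basis::'a set). \<bar>M b\<bar>)"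
  show ?thesis
  proof (rule that[of C])
    show "0 \<le> C" by (simp add: C_def sum_nonneg)
    fix x y :: 'a assume xy: "x \<in> cball 0 r" "y \<in> cball 0 r"
    have "norm (f x - f y) \<le> C * norm (x - y)"
    proof (rule differentiable_bound[OF convex_cball _ _ xy])
      fix z :: 'a assume z: "z \<in> cball 0 r"
      show "(f has_derivative D z) (at z within cball 0 r)"
        using der has_derivative_at_withinI by blast
      show "onorm (D z) \<le> C"
      proof (rule onorm_bound)
        show "0 \<le> C" by (simp add: C_def sum_nonneg)
        fix h :: 'a
        have lin: "linear (D z)"
          using der has_derivative_linear by blast
        have "D z h = D z (\<Sum>b\<in>Basis. (h \<bullet> b) *\<^sub>R b)"
          by (simp add: euclidean_representation)
        also have "\<dots> = (\<Sum>b\<in>Basis. (h \<bullet> b) * D z b)"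
          by (simp add: linear_sum[OF lin] linear_cmul[OF lin])
        finally have "norm (D z h) \<le> (\<Sum>b\<in>Basis. \<bar>h \<bullet> b\<bar> * \<bar>D z b\<bar>)"
          using sum_abs[of "\<lambda>b. (h \<bullet> b) * D z b" Basis] by (simp add: abs_mult)
        also have "\<dots> \<le> (\<Sum>b\<in>Basis. norm h * \<bar>M b\<bar>)"
        proof (intro sum_mono mult_mono)
          fix b :: 'a assume b: "b \<in> Basis"
          show "\<bar>h \<bullet> b\<bar> \<le> norm h" using b by (simp add: Basis_le_norm)
          show "\<bar>D z b\<bar> \<le> \<bar>M b\<bar>" using M[OF b z] by linarith
        qed auto
        finally show "norm (D z h) \<le> C * norm h"
          by (simp add: C_def sum_distrib_left mult.commute)
      qed
    qed
    then show "\<bar>f x - f y\<bar> \<le> C * norm (x - y)" by simp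
  qed
qed

lemma Ck_holder_local_holder:
  fixes f :: "'a::euclidean_space \<Rightarrow> real"
  assumes f: "Ck_holder k \<alpha> f"
  obtains C where "0 \<le> C" "\<And>x y. x \<in> cball 0 r \<Longrightarrow> y \<in> cball 0 r \<Longrightarrow>
      \<bar>f x - f y\<bar> \<le> C * norm (x - y) powr (if k = 0 then \<alpha> else 1)"
proof (cases k)
  case 0
  then have "\<And>K. compact K \<Longrightarrow> \<exists>C. \<forall>x\<in>K. \<forall>y\<in>K. \<bar>f x - f y\<bar> \<le> C * norm (x - y) powr \<alpha>"
    using f by simp
  from this[OF compact_cball[of 0 r]]
  obtain C where C: "\<And>x y. x \<in> cball 0 r \<Longrightarrow> y \<in> cball 0 r \<Longrightarrow> \<bar>f x - f y\<bar> \<le> C * norm (x - y) powr \<alpha>"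
    by blast
  have "\<bar>f x - f y\<bar> \<le> \<bar>C\<bar> * norm (x - y) powr (if k = 0 then \<alpha> else 1)"
    if "x \<in> cball 0 r" "y \<in> cball 0 r" for x y
    using C[OF that] mult_right_mono[OF abs_ge_self[of C], of "norm (x - y) powr \<alpha>"] 0 by simp
  then show ?thesis
    using that[of "\<bar>C\<bar>"] by simp
next
  case (Suc j)
  with f have "Ck_holder (Suc j) \<alpha> f" by simp
  then obtain C where "0 \<le> C" "\<And>x y. x \<in> cball 0 r \<Longrightarrow> y \<in> cball 0 r \<Longrightarrow> \<bar>f x - f y\<bar> \<le> C * norm (x - y)"
    by (rule Ck_holder_Suc_bounded_derivative[where r = r]) blast
  then show ?thesis
    using that[of C] Suc by simp
qed

text \<open>The mean value theorem is applied to the even function f(x + \<theta>z) + f(x -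
  \<theta>z), whose derivative is a difference of first derivatives at two points at distance at
  most 2|z|. Their Hoelder continuity supplies the extra exponent \<open>\<beta>\<close>. The radius
  r + 1 accommodates the shifted points.\<close>

lemma Ck_holder_second_difference:
  fixes f :: "'a::euclidean_space \<Rightarrow> real"
  assumes f: "Ck_holder (Suc k) \<alpha> f" and \<alpha>: "0 \<le> \<alpha>" and \<beta>: "\<beta> = (if k = 0 then \<alpha> else 1)"
  obtains C where "0 \<le> C" "\<And>x z. x \<in> cball 0 r \<Longrightarrow> z \<in> cball 0 1 \<Longrightarrow>
      \<bar>2 * f x - f (x + z) - f (x - z)\<bar> \<le> C * norm z powr (1 + \<beta>)"
proof -
  define D where "D = (\<lambda>x. frechet_derivative f (at x))"
  have \<beta>0: "0 \<le> \<beta>" using \<alpha> \<beta> by simp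
  have der: "(f has_derivative D x) (at x)" for x
    using f by (simp add: D_def frechet_derivative_works)
  have "\<exists>M\<ge>0. \<forall>x\<in>cball 0 (r + 1). \<forall>y\<in>cball 0 (r + 1). \<bar>D x b - D y b\<bar> \<le> M * norm (x - y) powr \<beta>"
    if "b \<in> Basis" for b
  proof -
    have "Ck_holder k \<alpha> (\<lambda>x. D x b)"
      using f that by (simp add: D_def)
    then obtain M where "0 \<le> M" "\<And>x y. x \<in> cball 0 (r + 1) \<Longrightarrow> y \<in> cball 0 (r + 1) \<Longrightarrow>
      \<bar>D x b - D y b\<bar> \<le> M * norm (x - y) powr \<beta>"
      unfolding \<beta> by (rule Ck_holder_local_holder[where r = "r + 1"]) blast
    then show ?thesis by blast
  qed
  then obtain M where M0: "\<And>b. b \<in> Basis \<Longrightarrow> 0 \<le> M b" and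
    M: "\<And>b x y. b \<in> Basis \<Longrightarrow> x \<in> cball 0 (r + 1) \<Longrightarrow> y \<in> cball 0 (r + 1) \<Longrightarrow> \<bar>D x b - D y b\<bar> \<le> M b * norm (x - y) powr \<beta>"
    by metis
  define C where "C = (\<Sum>b\<in>(Basis::'a set). M b) * 2 powr \<beta>"
  show ?thesis
  proof (rule that[of C])
    show "0 \<le> C" by (simp add: C_def sum_nonneg M0)
    fix x z :: 'a assume x: "x \<in> cball 0 r" and z: "z \<in> cball 0 1"
    have "\<exists>\<xi>\<in>{0<..<1}. (f (x + 1 *\<^sub>R z) + f (x - 1 *\<^sub>R z)) - (f (x + 0 *\<^sub>R z) + f (x - 0 *\<^sub>R z))
        = (\<lambda>h. D (x + \<xi> *\<^sub>R z) (h *\<^sub>R z) + D (x - \<xi> *\<^sub>R z) (- (h *\<^sub>R z))) (1 - 0)"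
    proof (rule mvt_simple)
      fix \<theta> :: real
      have 1: "((\<lambda>\<theta>. f (x + \<theta> *\<^sub>R z)) has_derivative (\<lambda>h. D (x + \<theta> *\<^sub>R z) (h *\<^sub>R z))) (at \<theta> within {0..1})"
        by (rule has_derivative_compose[OF _ der]) (auto intro!: derivative_eq_intros)
      have 2: "((\<lambda>\<theta>. f (x - \<theta> *\<^sub>R z)) has_derivative (\<lambda>h. D (x - \<theta> *\<^sub>R z) (- (h *\<^sub>R z)))) (at \<theta> within {0..1})"
        by (rule has_derivative_compose[OF _ der]) (auto intro!: derivative_eq_intros)
      show "((\<lambda>\<theta>. f (x + \<theta> *\<^sub>R z) + f (x - \<theta> *\<^sub>R z)) has_derivative
         (\<lambda>h. D (x + \<theta> *\<^sub>R z) (h *\<^sub>R z) + D (x - \<theta> *\<^sub>R z) (- (h *\<^sub>R z)))) (at \<theta> within {0..1})"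
        by (intro has_derivative_add 1 2)
    qed simp
    then obtain \<xi> where \<xi>: "0 < \<xi>" "\<xi> < 1" and
      eq: "f (x + z) + f (x - z) - 2 * f x = D (x + \<xi> *\<^sub>R z) z + D (x - \<xi> *\<^sub>R z) (- z)"
      by auto
    have lin: "linear (D y)" for y
      using der has_derivative_linear by blast
    have rep: "D y z = (\<Sum>b\<in>Basis. (z \<bullet> b) * D y b)" for y
    proof -
      have "D y z = D y (\<Sum>b\<in>Basis. (z \<bullet> b) *\<^sub>R b)"
        by (simp add: euclidean_representation)
      also have "\<dots> = (\<Sum>b\<in>Basis. (z \<bullet> b) * D y b)"
        by (simp add: linear_sum[OF lin] linear_cmul[OF lin])
      finally show ?thesis .
    qed
    have nxi: "norm (\<xi> *\<^sub>R z) \<le> norm z"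
      using \<xi> by (simp add: mult_left_le_one_le)
    have in_ball: "x + \<xi> *\<^sub>R z \<in> cball 0 (r + 1)" "x - \<xi> *\<^sub>R z \<in> cball 0 (r + 1)"
      using x z nxi norm_triangle_ineq[of x "\<xi> *\<^sub>R z"] norm_triangle_ineq4[of x "\<xi> *\<^sub>R z"] by auto
    have "f (x + z) + f (x - z) - 2 * f x = (\<Sum>b\<in>Basis. (z \<bullet> b) * (D (x + \<xi> *\<^sub>R z) b - D (x - \<xi> *\<^sub>R z) b))"
      unfolding eq by (simp add: linear_neg[OF lin] rep sum_subtractf algebra_simps)
    then have "\<bar>2 * f x - f (x + z) - f (x - z)\<bar> = \<bar>\<Sum>b\<in>Basis. (z \<bullet> b) * (D (x + \<xi> *\<^sub>R z) b - D (x - \<xi> *\<^sub>R z) b)\<bar>"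
      by linarith
    also have "\<dots> \<le> (\<Sum>b\<in>Basis. \<bar>z \<bullet> b\<bar> * \<bar>D (x + \<xi> *\<^sub>R z) b - D (x - \<xi> *\<^sub>R z) b\<bar>)"
      by (rule order_trans[OF sum_abs]) (simp add: abs_mult)
    also have "\<dots> \<le> (\<Sum>b\<in>(Basis::'a set). norm z * (M b * (2 * norm z) powr \<beta>))"
    proof (intro sum_mono mult_mono)
      fix b :: 'a assume b: "b \<in> Basis"
      show "\<bar>z \<bullet> b\<bar> \<le> norm z" using b by (simp add: Basis_le_norm)
      have "x + \<xi> *\<^sub>R z - (x - \<xi> *\<^sub>R z) = \<xi> *\<^sub>R z + \<xi> *\<^sub>R z"
        by simp
      then have "norm (x + \<xi> *\<^sub>R z - (x - \<xi> *\<^sub>R z)) \<le> 2 * norm z"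
        using nxi norm_triangle_ineq[of "\<xi> *\<^sub>R z" "\<xi> *\<^sub>R z"] by (simp del: norm_scaleR)
      then have "norm (x + \<xi> *\<^sub>R z - (x - \<xi> *\<^sub>R z)) powr \<beta> \<le> (2 * norm z) powr \<beta>"
        using \<beta>0 by (intro powr_mono2) auto
      then show "\<bar>D (x + \<xi> *\<^sub>R z) b - D (x - \<xi> *\<^sub>R z) b\<bar> \<le> M b * (2 * norm z) powr \<beta>"
        using M[OF b in_ball] M0[OF b] by (meson mult_left_mono order_trans)
    qed auto
    also have "\<dots> = C * norm z powr (1 + \<beta>)"
      by (cases "z = 0") (simp_all add: C_def powr_mult powr_add sum_distrib_left sum_distrib_right mult_ac)
    finally show "\<bar>2 * f x - f (x + z) - f (x - z)\<bar> \<le> C * norm z powr (1 + \<beta>)" .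
  qed
qed

lemma C_space_continuous: "f \<in> C_space \<beta> \<Longrightarrow> continuous_on UNIV f"
  by (auto simp: C_space_def intro: Ck_holder_continuous)

text \<open>Any exponent above 2s makes the second difference integrable against the kernel. If
  2\<sigma> < 1, or 1 <= 2\<sigma> < 2, the class itself gives the exponent 2\<sigma>; for larger
  \<sigma> the exponent 2 is enough because s < 1.\<close>

lemma C_space_second_difference:
  fixes f :: "'a::euclidean_space \<Rightarrow> real"
  assumes f: "f \<in> C_space (2 * \<sigma>)" and s: "0 < s" "s < 1" "s < \<sigma>"
  obtains C \<tau> where "0 \<le> C" "2 * s < \<tau>" "\<And>x z. x \<in> cball 0 r \<Longrightarrow> z \<in> cball 0 1 \<Longrightarrow>
      \<bar>2 * f x - f (x + z) - f (x - z)\<bar> \<le> C * norm z powr \<tau>"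
proof -
  define k where "k = nat \<lfloor>2 * \<sigma>\<rfloor>"
  have Ck: "Ck_holder k (frac (2 * \<sigma>)) f"
    using f by (simp add: C_space_def k_def)
  have kr: "real k + frac (2 * \<sigma>) = 2 * \<sigma>"
    using s by (simp add: k_def frac_def)
  show ?thesis
  proof (cases k)
    case 0
    obtain C where C: "0 \<le> C" "\<And>x y. x \<in> cball 0 (r + 1) \<Longrightarrow> y \<in> cball 0 (r + 1) \<Longrightarrow>
      \<bar>f x - f y\<bar> \<le> C * norm (x - y) powr frac (2 * \<sigma>)"
      using Ck_holder_local_holder[OF Ck, of "r + 1"] 0 by auto
    show ?thesis
    proof (rule that[of "2 * C" "2 * \<sigma>"])
      fix x z :: 'a assume x: "x \<in> cball 0 r" and z: "z \<in> cball 0 1"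
      have "x \<in> cball 0 (r + 1)" "x + z \<in> cball 0 (r + 1)" "x - z \<in> cball 0 (r + 1)"
        using x z norm_triangle_ineq[of x z] norm_triangle_ineq4[of x z] by auto
      then have "\<bar>f x - f (x + z)\<bar> \<le> C * norm z powr (2 * \<sigma>)" "\<bar>f x - f (x - z)\<bar> \<le> C * norm z powr (2 * \<sigma>)"
        using C(2)[of x "x + z"] C(2)[of x "x - z"] kr 0 by auto
      then show "\<bar>2 * f x - f (x + z) - f (x - z)\<bar> \<le> 2 * C * norm z powr (2 * \<sigma>)"
        by linarith
    qed (use C s in auto)
  next
    case (Suc j)
    define \<beta> where "\<beta> = (if j = 0 then frac (2 * \<sigma>) else 1)"
    obtain C where C: "0 \<le> C" "\<And>x z. x \<in> cball 0 r \<Longrightarrow> z \<in> cball 0 1 \<Longrightarrow>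
      \<bar>2 * f x - f (x + z) - f (x - z)\<bar> \<le> C * norm z powr (1 + \<beta>)"
      using Ck_holder_second_difference[OF Ck[unfolded Suc] frac_ge_0 \<beta>_def, where r = r] by blast
    have "2 * s < 1 + \<beta>"
      using kr Suc s by (auto simp: \<beta>_def)
    then show ?thesis
      using that C by blast
  qed
qed

section \<open>Integrability away from the diagonal and uniform bounds for the truncated
  operator\<close>

lemma L_spaceD:
  assumes "u \<in> L_space s"
  shows "u \<in> borel_measurable borel" "integrable lborel (\<lambda>y. \<bar>u y\<bar> * weight s 1 (y :: 'a::euclidean_space))"
  using assms unfolding L_space_def weight_def powr_minus divide_inverse by auto

text \<open>For |x| <= r one has 1 + |y| <= 1 + r + |x - y|, and off the diagonal the constant 1 + r
  is at most (1 + r)/\<epsilon> times |x - y|. Thus membership in \<open>L_space\<close> controls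
  the tail uniformly for x in a ball.\<close>

lemma kern_le_weight:
  fixes x y :: "'a::euclidean_space"
  assumes s: "0 < s" and e: "0 < \<epsilon>" "\<epsilon> \<le> norm (x - y)" and x: "norm x \<le> r"
  shows "kern s (x - y) \<le> ((1 + r) / \<epsilon> + 1) powr (real DIM('a) + 2 * s) * weight s 1 y"
proof -
  define M where "M = real DIM('a) + 2 * s"
  define c where "c = (1 + r) / \<epsilon> + 1"
  have r: "0 \<le> r" using x norm_ge_zero order_trans by blast
  have c: "0 < c" using r e by (simp add: c_def add_nonneg_pos)
  have M: "0 < M" using s by (simp add: M_def add_nonneg_pos)
  have "1 + norm y \<le> 1 + r + norm (x - y)"
    using x norm_triangle_ineq4[of x "x - y"] by simp
  also have "\<dots> \<le> (1 + r) / \<epsilon> * norm (x - y) + norm (x - y)"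
    using mult_left_mono[OF e(2), of "(1 + r) / \<epsilon>"] e(1) r by simp
  finally have "1 + norm y \<le> c * norm (x - y)"
    by (simp add: c_def algebra_simps)
  then have "(c * norm (x - y)) powr - M \<le> (1 + norm y) powr - M"
    using M by (intro powr_mono2') (auto simp: add_pos_nonneg)
  then have "c powr M * (c * norm (x - y)) powr - M \<le> c powr M * (1 + norm y) powr - M"
    by (intro mult_left_mono) auto
  moreover have "c powr M * (c * norm (x - y)) powr - M = kern s (x - y)"
    using c unfolding kern_def powr_minus_divide M_def by (subst powr_mult) auto
  ultimately show ?thesis
    by (simp add: weight_def c_def M_def)
qed

lemma continuous_bounded_cball:
  fixes u :: "'a::euclidean_space \<Rightarrow> real"
  assumes "continuous_on UNIV u"
  obtains B where "0 \<le> B" "\<And>x. x \<in> cball 0 r \<Longrightarrow> \<bar>u x\<bar> \<le> B"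
proof -
  have "bounded (u ` cball 0 r)"
    using assms by (intro compact_imp_bounded compact_continuous_image) (auto intro: continuous_on_subset)
  then obtain B where "\<And>x. x \<in> cball 0 r \<Longrightarrow> \<bar>u x\<bar> \<le> B"
    unfolding bounded_iff by (metis imageI real_norm_def)
  then show ?thesis
    using that[of "\<bar>B\<bar>"] by (meson abs_ge_self abs_ge_zero order_trans)
qed

text \<open>A 0-1 factor in place of a domain of integration: it is symmetric in \<open>x\<close>
  and \<open>y\<close>, which the symmetrization needs. The closed condition matches the complement
  of the open ball in \<open>has_frac_laplacian\<close>.\<close>

definition far :: "real \<Rightarrow> 'a::euclidean_space \<Rightarrow> 'a \<Rightarrow> real" where
  "far \<epsilon> x y = indicator {d. \<epsilon> \<le> d} (norm (x - y))"

lemma far_commute: "far \<epsilon> x y = far \<epsilon> y x"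
  by (simp add: far_def norm_minus_commute)

lemma far_nonneg [simp]: "0 \<le> far \<epsilon> x y"
  by (simp add: far_def)

lemma far_le_1 [simp]: "far \<epsilon> x y \<le> 1"
  by (simp add: far_def indicator_def)

lemma far_measurable [measurable]:
  assumes [measurable]: "f \<in> borel_measurable M" "g \<in> borel_measurable M"
  shows "(\<lambda>z. far \<epsilon> (f z) (g z)) \<in> borel_measurable M"
  unfolding far_def by measurable

definition trunc_lap :: "real \<Rightarrow> real \<Rightarrow> ('a::euclidean_space \<Rightarrow> real) \<Rightarrow> 'a \<Rightarrow> real" where
  "trunc_lap s \<epsilon> u x = (\<integral>y. far \<epsilon> x y * ((u x - u y) * kern s (x - y)) \<partial>lborel)"

lemma has_frac_laplacian_trunc_lap:
  fixes u :: "'a::euclidean_space \<Rightarrow> real"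
  assumes "has_frac_laplacian s u x L"
  shows "((\<lambda>\<epsilon>. frac_const DIM('a) s * trunc_lap s \<epsilon> u x) \<longlongrightarrow> L) (at_right 0)"
proof -
  have "trunc_lap s \<epsilon> u x = (LINT y:(UNIV - ball x \<epsilon>)|lborel. (u x - u y) / norm (x - y) powr (real DIM('a) + 2 * s))" for \<epsilon>
    unfolding trunc_lap_def set_lebesgue_integral_def far_def
    by (intro Bochner_Integration.integral_cong) (auto simp: indicator_def kern_def dist_norm)
  then show ?thesis
    using assms by (simp add: has_frac_laplacian_def)
qed

text \<open>Uniformity over balls of centres is what Fubini needs later; for a single centre the
  bound is just absolute convergence of the truncated integral.\<close>

lemma nn_integral_far_bound:
  fixes u :: "'a::euclidean_space \<Rightarrow> real"
  assumes s: "0 < s" and e: "0 < \<epsilon>" and u: "u \<in> L_space s" "continuous_on UNIV u"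
  obtains C where "0 \<le> C" "\<And>x. x \<in> cball 0 r \<Longrightarrow>
    (\<integral>\<^sup>+y. ennreal (far \<epsilon> x y * (\<bar>u x - u y\<bar> * kern s (x - y))) \<partial>lborel) \<le> ennreal C"
proof -
  note [measurable] = L_spaceD(1)[OF u(1)]
  obtain B where B: "0 \<le> B" "\<And>x. x \<in> cball 0 r \<Longrightarrow> \<bar>u x\<bar> \<le> B"
    using continuous_bounded_cball[OF u(2)] by blast
  obtain W where W: "0 < W" "\<And>R. 0 < R \<Longrightarrow> (\<integral>\<^sup>+x. ennreal (weight s R (x::'a)) \<partial>lborel) \<le> ennreal (W * R ^ DIM('a))"
    using nn_integral_weight[OF s] by blast
  define c where "c = ((1 + r) / \<epsilon> + 1) powr (real DIM('a) + 2 * s)"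
  define U where "U = (\<integral>y. \<bar>u y\<bar> * weight s 1 y \<partial>lborel)"
  have U: "0 \<le> U" by (simp add: U_def)
  have c: "0 \<le> c" by (simp add: c_def)
  show ?thesis
  proof (rule that[of "c * B * W + c * U"])
    show "0 \<le> c * B * W + c * U" using U B W c by simp
    fix x :: 'a assume x: "x \<in> cball 0 r"
    have "(\<integral>\<^sup>+y. ennreal (far \<epsilon> x y * (\<bar>u x - u y\<bar> * kern s (x - y))) \<partial>lborel)
      \<le> (\<integral>\<^sup>+y. ennreal (c * B) * ennreal (weight s 1 y) + ennreal c * ennreal (\<bar>u y\<bar> * weight s 1 y) \<partial>lborel)"
    proof (rule nn_integral_mono)
      fix y :: 'a
      have "far \<epsilon> x y * (\<bar>u x - u y\<bar> * kern s (x - y)) \<le> c * B * weight s 1 y + c * (\<bar>u y\<bar> * weight s 1 y)"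
      proof (cases "\<epsilon> \<le> norm (x - y)")
        case True
        have "\<bar>u x - u y\<bar> * kern s (x - y) \<le> (B + \<bar>u y\<bar>) * (c * weight s 1 y)"
          using kern_le_weight[OF s e True, of r] x B(2)[OF x] B(1) by (intro mult_mono) (auto simp: c_def)
        then show ?thesis
          using True by (simp add: far_def algebra_simps)
      next
        case False
        then show ?thesis using c B by (simp add: far_def)
      qed
      then show "ennreal (far \<epsilon> x y * (\<bar>u x - u y\<bar> * kern s (x - y)))
        \<le> ennreal (c * B) * ennreal (weight s 1 y) + ennreal c * ennreal (\<bar>u y\<bar> * weight s 1 y)"
        using c B by (simp flip: ennreal_mult ennreal_plus add: ennreal_leI)
    qed
    also have "\<dots> = ennreal (c * B) * (\<integral>\<^sup>+y. ennreal (weight s 1 (y::'a)) \<partial>lborel) + ennreal c * ennreal U"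
      using L_spaceD(2)[OF u(1)] by (subst nn_integral_add) (auto simp: nn_integral_cmult nn_integral_eq_integral U_def)
    also have "\<dots> \<le> ennreal (c * B) * ennreal (W * 1 ^ DIM('a)) + ennreal c * ennreal U"
      using W(2)[of 1] by (intro add_mono mult_left_mono) auto
    also have "\<dots> = ennreal (c * B * W + c * U)"
      using c B W U by (simp flip: ennreal_mult ennreal_plus)
    finally show "(\<integral>\<^sup>+y. ennreal (far \<epsilon> x y * (\<bar>u x - u y\<bar> * kern s (x - y))) \<partial>lborel) \<le> ennreal (c * B * W + c * U)" .
  qed
qed

lemma integrable_far:
  fixes u :: "'a::euclidean_space \<Rightarrow> real"
  assumes s: "0 < s" and e: "0 < \<epsilon>" and u: "u \<in> L_space s" "continuous_on UNIV u"
  shows "integrable lborel (\<lambda>y. far \<epsilon> x y * ((u x - u y) * kern s (x - y)))"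
proof (rule integrableI_bounded)
  note [measurable] = L_spaceD(1)[OF u(1)]
  show "(\<lambda>y. far \<epsilon> x y * ((u x - u y) * kern s (x - y))) \<in> borel_measurable lborel"
    by measurable
  obtain C where "(\<integral>\<^sup>+y. ennreal (far \<epsilon> x y * (\<bar>u x - u y\<bar> * kern s (x - y))) \<partial>lborel) \<le> ennreal C"
    using nn_integral_far_bound[OF assms, of "norm x"] mem_cball_0[of x "norm x"] by blast
  then show "(\<integral>\<^sup>+y. ennreal (norm (far \<epsilon> x y * ((u x - u y) * kern s (x - y)))) \<partial>lborel) < \<infinity>"
    by (simp add: abs_mult order_le_less_trans)
qed

text \<open>Averaging over the reflection of z cancels the first-order part of the increment. For s
  >= 1/2 this cancellation is what keeps the integrals bounded as the truncation is removed.\<close>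

lemma trunc_lap_second_difference:
  fixes u :: "'a::euclidean_space \<Rightarrow> real"
  assumes s: "0 < s" and e: "0 < \<epsilon>" and u: "u \<in> L_space s" "continuous_on UNIV u"
  shows "integrable lborel (\<lambda>z. far \<epsilon> z 0 * ((2 * u x - u (x + z) - u (x - z)) * kern s z))"
    and "2 * trunc_lap s \<epsilon> u x = (\<integral>z. far \<epsilon> z 0 * ((2 * u x - u (x + z) - u (x - z)) * kern s z) \<partial>lborel)"
proof -
  note [measurable] = L_spaceD(1)[OF u(1)]
  define F where "F = (\<lambda>z. far \<epsilon> z 0 * ((u x - u (x - z)) * kern s z))"
  have [measurable]: "F \<in> borel_measurable borel"
    unfolding F_def by measurable
  have Fxy: "F (x - y) = far \<epsilon> x y * ((u x - u y) * kern s (x - y))" for y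
    by (simp add: F_def far_def)
  have iF: "integrable lborel F"
  proof -
    have "integrable (distr lborel borel (\<lambda>y. x - y)) F"
      by (subst integrable_distr_eq) (auto simp: Fxy integrable_far[OF assms])
    then show ?thesis by (simp add: distr_lborel_reflect)
  qed
  have iF': "integrable lborel (\<lambda>z. F (- z))"
  proof -
    have "integrable (distr lborel borel (\<lambda>y. 0 - y)) F"
      using iF by (simp only: distr_lborel_reflect)
    then show ?thesis by (subst (asm) integrable_distr_eq) auto
  qed
  have t1: "trunc_lap s \<epsilon> u x = (\<integral>z. F z \<partial>lborel)"
  proof -
    have "(\<integral>z. F z \<partial>lborel) = (\<integral>z. F z \<partial>distr lborel borel (\<lambda>y. x - y))"
      by (simp only: distr_lborel_reflect)
    also have "\<dots> = (\<integral>y. F (x - y) \<partial>lborel)"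
      by (subst integral_distr) auto
    finally show ?thesis by (simp add: Fxy trunc_lap_def)
  qed
  have t2: "(\<integral>z. F (- z) \<partial>lborel) = (\<integral>z. F z \<partial>lborel)"
  proof -
    have "(\<integral>z. F z \<partial>lborel) = (\<integral>z. F z \<partial>distr lborel borel (\<lambda>y. 0 - y))"
      by (simp only: distr_lborel_reflect)
    also have "\<dots> = (\<integral>y. F (- y) \<partial>lborel)"
      by (subst integral_distr) auto
    finally show ?thesis ..
  qed
  have sum: "F z + F (- z) = far \<epsilon> z 0 * ((2 * u x - u (x + z) - u (x - z)) * kern s z)" for z
    by (simp add: F_def far_def algebra_simps)
  show "integrable lborel (\<lambda>z. far \<epsilon> z 0 * ((2 * u x - u (x + z) - u (x - z)) * kern s z))"
    using Bochner_Integration.integrable_add[OF iF iF'] by (simp add: sum)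
  show "2 * trunc_lap s \<epsilon> u x = (\<integral>z. far \<epsilon> z 0 * ((2 * u x - u (x + z) - u (x - z)) * kern s z) \<partial>lborel)"
    using Bochner_Integration.integral_add[OF iF iF'] by (simp add: sum t1 t2)
qed

text \<open>The bound is uniform in \<epsilon>, so it can serve as a dominating constant in the
  limit. Inside the unit ball the second difference beats the kernel because its exponent exceeds
  2s; outside, the two tails are controlled by \<open>L_space\<close>.\<close>

lemma trunc_lap_bounded:
  fixes u :: "'a::euclidean_space \<Rightarrow> real"
  assumes s: "0 < s" "s < 1" "s < \<sigma>" and u: "u \<in> L_space s" "u \<in> C_space (2 * \<sigma>)"
  obtains C where "\<And>x \<epsilon>. x \<in> cball 0 r \<Longrightarrow> 0 < \<epsilon> \<Longrightarrow> \<bar>trunc_lap s \<epsilon> u x\<bar> \<le> C"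
proof -
  have cont: "continuous_on UNIV u"
    using u(2) by (rule C_space_continuous)
  note [measurable] = L_spaceD(1)[OF u(1)]
  obtain C1 \<tau> where C1: "0 \<le> C1" "2 * s < \<tau>" "\<And>x z. x \<in> cball 0 r \<Longrightarrow> z \<in> cball 0 1 \<Longrightarrow>
      \<bar>2 * u x - u (x + z) - u (x - z)\<bar> \<le> C1 * norm z powr \<tau>"
    using C_space_second_difference[OF u(2) s] by blast
  obtain C2 where C2: "0 \<le> C2"
    "\<And>A. 0 < A \<Longrightarrow> (\<integral>\<^sup>+z. ennreal (min (norm z) A powr \<tau> * kern s (z::'a)) \<partial>lborel) \<le> ennreal (C2 * A powr (\<tau> - 2 * s))"
    using nn_integral_min_kern[OF s(1) C1(2)] by blast
  obtain C3 where C3: "0 \<le> C3" "\<And>x. x \<in> cball 0 r \<Longrightarrow>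
    (\<integral>\<^sup>+y. ennreal (far 1 x y * (\<bar>u x - u y\<bar> * kern s (x - y))) \<partial>lborel) \<le> ennreal C3"
    using nn_integral_far_bound[OF s(1) zero_less_one u(1) cont] by blast
  show ?thesis
  proof (rule that[of "C1 * C2 + 2 * C3"])
    fix x :: 'a and \<epsilon> :: real assume x: "x \<in> cball 0 r" and e: "0 < \<epsilon>"
    let ?F = "\<lambda>z. far \<epsilon> z 0 * ((2 * u x - u (x + z) - u (x - z)) * kern s z)"
    define G where "G = (\<lambda>z. ennreal (far 1 z 0 * (\<bar>u x - u (x - z)\<bar> * kern s z)))"
    have [measurable]: "G \<in> borel_measurable borel"
      unfolding G_def by measurable
    have "(\<integral>\<^sup>+z. G z \<partial>lborel) = (\<integral>\<^sup>+y. G (x - y) \<partial>lborel)"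
      by (rule nn_integral_lborel_reflect[symmetric]) measurable
    also have "\<dots> \<le> ennreal C3"
      using C3(2)[OF x] by (simp add: G_def far_def)
    finally have G: "(\<integral>\<^sup>+z. G z \<partial>lborel) \<le> ennreal C3" .
    have G': "(\<integral>\<^sup>+z. G (0 - z) \<partial>lborel) \<le> ennreal C3"
      using G by (subst nn_integral_lborel_reflect) auto
    have "ennreal (norm (\<integral>z. ?F z \<partial>lborel)) \<le> (\<integral>\<^sup>+z. norm (?F z) \<partial>lborel)"
      by (intro integral_norm_bound_ennreal trunc_lap_second_difference(1) s e u cont)
    also have "\<dots> \<le> (\<integral>\<^sup>+z. ennreal C1 * ennreal (min (norm z) 1 powr \<tau> * kern s z) + (G z + G (0 - z)) \<partial>lborel)"
    proof (rule nn_integral_mono)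
      fix z :: 'a
      show "ennreal (norm (?F z)) \<le> ennreal C1 * ennreal (min (norm z) 1 powr \<tau> * kern s z) + (G z + G (0 - z))"
      proof (cases "norm z \<le> 1")
        case True
        then have "\<bar>2 * u x - u (x + z) - u (x - z)\<bar> * kern s z \<le> C1 * norm z powr \<tau> * kern s z"
          using C1(3)[OF x] by (intro mult_right_mono) auto
        then have "norm (?F z) \<le> C1 * (min (norm z) 1 powr \<tau> * kern s z)"
          using True mult_mono[OF far_le_1[of \<epsilon> z 0]] by (fastforce simp: abs_mult min_def mult.assoc)
        then have "ennreal (norm (?F z)) \<le> ennreal C1 * ennreal (min (norm z) 1 powr \<tau> * kern s z)"
          using C1(1) by (simp flip: ennreal_mult add: ennreal_leI)
        then show ?thesis by (simp add: add_increasing2)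
      next
        case False
        have "\<bar>2 * u x - u (x + z) - u (x - z)\<bar> * kern s z \<le> (\<bar>u x - u (x - z)\<bar> + \<bar>u x - u (x + z)\<bar>) * kern s z"
          by (intro mult_right_mono) auto
        then have "norm (?F z) \<le> (\<bar>u x - u (x - z)\<bar> + \<bar>u x - u (x + z)\<bar>) * kern s z"
          using mult_mono[OF far_le_1[of \<epsilon> z 0]] by (fastforce simp: abs_mult)
        also have "\<dots> = far 1 z 0 * (\<bar>u x - u (x - z)\<bar> * kern s z) + far 1 (- z) 0 * (\<bar>u x - u (x + z)\<bar> * kern s z)"
          using False by (simp add: far_def algebra_simps)
        finally have "ennreal (norm (?F z)) \<le> G z + G (0 - z)"
          by (simp add: G_def ennreal_leI flip: ennreal_plus)
        then show ?thesis by (simp add: add_increasing)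
      qed
    qed
    also have "\<dots> = ennreal C1 * (\<integral>\<^sup>+z. ennreal (min (norm z) 1 powr \<tau> * kern s (z::'a)) \<partial>lborel)
        + ((\<integral>\<^sup>+z. G z \<partial>lborel) + (\<integral>\<^sup>+z. G (0 - z) \<partial>lborel))"
      by (simp add: nn_integral_add nn_integral_cmult)
    also have "\<dots> \<le> ennreal C1 * ennreal (C2 * 1 powr (\<tau> - 2 * s)) + (ennreal C3 + ennreal C3)"
      using C2(2)[of 1] by (intro add_mono mult_left_mono G G') auto
    also have "\<dots> = ennreal (C1 * C2 + 2 * C3)"
      using C1(1) C2(1) C3(1) by (simp flip: ennreal_mult ennreal_plus)
    finally have "norm (\<integral>z. ?F z \<partial>lborel) \<le> C1 * C2 + 2 * C3"
      using C1(1) C2(1) C3(1) by (subst (asm) ennreal_le_iff) auto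
    then have "\<bar>2 * trunc_lap s \<epsilon> u x\<bar> \<le> C1 * C2 + 2 * C3"
      unfolding trunc_lap_second_difference(2)[OF s(1) e u(1) cont] by simp
    then show "\<bar>trunc_lap s \<epsilon> u x\<bar> \<le> C1 * C2 + 2 * C3"
      by simp
  qed
qed

section \<open>Weighted estimates\<close>

text \<open>Continuity of the right-hand side is included so that its product with a compactly
  supported continuous test function is integrable.\<close>

definition frac_sol :: "real \<Rightarrow> ('a::euclidean_space \<Rightarrow> real) \<Rightarrow> ('a \<Rightarrow> real) \<Rightarrow> bool" where
  "frac_sol s u g \<longleftrightarrow> (\<exists>\<sigma>>s. u \<in> C_space (2 * \<sigma>)) \<and> u \<in> L_space s \<and> continuous_on UNIV g \<and>
     (\<forall>x. has_frac_laplacian s u x (g x))"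

lemma frac_sol_continuous: "frac_sol s u g \<Longrightarrow> continuous_on UNIV u"
  unfolding frac_sol_def using C_space_continuous by blast

lemma trunc_lap_measurable [measurable]:
  assumes [measurable]: "u \<in> borel_measurable borel"
  shows "trunc_lap s \<epsilon> u \<in> borel_measurable borel"
  unfolding trunc_lap_def by measurable

lemma frac_const_nonneg: "0 < s \<Longrightarrow> 0 \<le> frac_const N s"
  unfolding frac_const_def by (intro divide_nonneg_nonneg mult_nonneg_nonneg) (auto intro!: less_imp_le Gamma_real_pos add_nonneg_pos)

text \<open>Dominated convergence along \<epsilon> = 1/(n+1). The support of \<open>f\<close> must
  be bounded because \<open>trunc_lap_bounded\<close> is uniform only on balls.\<close>

lemma frac_sol_tendsto:
  fixes u g f :: "'a::euclidean_space \<Rightarrow> real"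
  assumes s: "0 < s" "s < 1" and u: "frac_sol s u g" and f: "continuous_on UNIV f" "\<And>x. x \<notin> cball 0 r \<Longrightarrow> f x = 0"
  shows "(\<lambda>n. \<integral>x. f x * (frac_const DIM('a) s * trunc_lap s (inverse (real (Suc n))) u x) \<partial>lborel)
     \<longlonglongrightarrow> (\<integral>x. f x * g x \<partial>lborel)"
proof -
  have [measurable]: "u \<in> borel_measurable borel" "g \<in> borel_measurable borel" "f \<in> borel_measurable borel"
    using u f L_spaceD(1) by (auto simp: frac_sol_def intro: borel_measurable_continuous_onI)
  define c where "c = frac_const DIM('a) s"
  have c: "0 \<le> c" using s by (simp add: c_def frac_const_nonneg)
  obtain \<sigma> where \<sigma>: "s < \<sigma>" "u \<in> C_space (2 * \<sigma>)" and uL: "u \<in> L_space s"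
    using u by (auto simp: frac_sol_def)
  obtain C where C: "\<And>x \<epsilon>. x \<in> cball 0 r \<Longrightarrow> 0 < \<epsilon> \<Longrightarrow> \<bar>trunc_lap s \<epsilon> u x\<bar> \<le> C"
    using trunc_lap_bounded[OF s \<sigma>(1) uL \<sigma>(2)] by blast
  obtain B where B: "0 \<le> B" "\<And>x. x \<in> cball 0 r \<Longrightarrow> \<bar>f x\<bar> \<le> B"
    using continuous_bounded_cball[OF f(1)] by blast
  show ?thesis
    unfolding c_def[symmetric]
  proof (rule integral_dominated_convergence[where w = "\<lambda>x. B * (c * C) * indicator (cball 0 r) x"])
    show "integrable lborel (\<lambda>x. B * (c * C) * indicator (cball (0::'a) r) x)"
      by (intro integrable_mult_right integrable_real_indicator) (auto intro: emeasure_bounded_finite[simplified])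
    show "AE x in lborel. (\<lambda>n. f x * (c * trunc_lap s (inverse (real (Suc n))) u x)) \<longlonglongrightarrow> f x * g x"
    proof (rule AE_I2)
      fix x
      have "((\<lambda>\<epsilon>. c * trunc_lap s \<epsilon> u x) \<longlongrightarrow> g x) (at_right 0)"
        unfolding c_def using u by (intro has_frac_laplacian_trunc_lap) (auto simp: frac_sol_def)
      moreover have "filterlim (\<lambda>n. inverse (real (Suc n))) (at_right 0) sequentially"
        unfolding filterlim_at using LIMSEQ_inverse_real_of_nat by auto
      ultimately have "(\<lambda>n. c * trunc_lap s (inverse (real (Suc n))) u x) \<longlonglongrightarrow> g x"
        by (rule filterlim_compose)
      then show "(\<lambda>n. f x * (c * trunc_lap s (inverse (real (Suc n))) u x)) \<longlonglongrightarrow> f x * g x"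
        by (intro tendsto_intros)
    qed
    fix n
    show "AE x in lborel. norm (f x * (c * trunc_lap s (inverse (real (Suc n))) u x)) \<le> B * (c * C) * indicator (cball 0 r) x"
    proof (rule AE_I2)
      fix x
      show "norm (f x * (c * trunc_lap s (inverse (real (Suc n))) u x)) \<le> B * (c * C) * indicator (cball 0 r) x"
      proof (cases "x \<in> cball 0 r")
        case True
        have "\<bar>f x\<bar> * (c * \<bar>trunc_lap s (inverse (real (Suc n))) u x\<bar>) \<le> B * (c * C)"
          using B C[OF True] c True by (intro mult_mono) auto
        then show ?thesis using True c by (simp add: abs_mult)
      next
        case False
        then show ?thesis using f(2) by simp
      qed
    qed
  qed measurable
qed

text \<open>Fubini on the region \<open>|x - y| \<ge> \<epsilon>\<close>, where the kernel is bounded, followed by symmetrization in \<open>(x, y)\<close>.\<close>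

lemma trunc_lap_symmetrize:
  fixes u f :: "'a::euclidean_space \<Rightarrow> real"
  assumes s: "0 < s" and e: "0 < \<epsilon>" and u: "u \<in> L_space s" "continuous_on UNIV u"
    and f: "continuous_on UNIV f" "\<And>x. x \<notin> cball 0 r \<Longrightarrow> f x = 0"
  shows "integrable (lborel \<Otimes>\<^sub>M lborel) (\<lambda>(x, y). far \<epsilon> x y * kern s (x - y) * ((u x - u y) * (f x - f y)))"
    and "2 * (\<integral>x. f x * trunc_lap s \<epsilon> u x \<partial>lborel)
      = (\<integral>(x, y). far \<epsilon> x y * kern s (x - y) * ((u x - u y) * (f x - f y)) \<partial>(lborel \<Otimes>\<^sub>M lborel))"
proof -
  have [measurable]: "u \<in> borel_measurable borel" "f \<in> borel_measurable borel"
    using u f L_spaceD(1) by (auto intro: borel_measurable_continuous_onI)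
  obtain C where C: "0 \<le> C" "\<And>x. x \<in> cball 0 r \<Longrightarrow>
    (\<integral>\<^sup>+y. ennreal (far \<epsilon> x y * (\<bar>u x - u y\<bar> * kern s (x - y))) \<partial>lborel) \<le> ennreal C"
    using nn_integral_far_bound[OF s e u] by blast
  obtain B where B: "0 \<le> B" "\<And>x. x \<in> cball 0 r \<Longrightarrow> \<bar>f x\<bar> \<le> B"
    using continuous_bounded_cball[OF f(1)] by blast
  define P where "P = (\<lambda>(x, y). f x * (far \<epsilon> x y * ((u x - u y) * kern s (x - y))))"
  have [measurable]: "P \<in> borel_measurable (lborel \<Otimes>\<^sub>M lborel)"
    unfolding P_def by measurable
  have iP: "integrable (lborel \<Otimes>\<^sub>M lborel) P"
  proof (rule integrableI_bounded)
    have "(\<integral>\<^sup>+z. ennreal (norm (P z)) \<partial>(lborel \<Otimes>\<^sub>M lborel)) = (\<integral>\<^sup>+x. \<integral>\<^sup>+y. ennreal (norm (P (x, y))) \<partial>lborel \<partial>lborel)"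
      by (rule lborel.nn_integral_fst[symmetric]) measurable
    also have "\<dots> \<le> (\<integral>\<^sup>+x. ennreal (B * C) * indicator (cball (0::'a) r) x \<partial>lborel)"
    proof (rule nn_integral_mono)
      fix x :: 'a
      show "(\<integral>\<^sup>+y. ennreal (norm (P (x, y))) \<partial>lborel) \<le> ennreal (B * C) * indicator (cball 0 r) x"
      proof (cases "x \<in> cball 0 r")
        case True
        have "(\<integral>\<^sup>+y. ennreal (norm (P (x, y))) \<partial>lborel)
          = (\<integral>\<^sup>+y. ennreal \<bar>f x\<bar> * ennreal (far \<epsilon> x y * (\<bar>u x - u y\<bar> * kern s (x - y))) \<partial>lborel)"
          by (intro nn_integral_cong) (simp add: P_def abs_mult flip: ennreal_mult)
        also have "\<dots> = ennreal \<bar>f x\<bar> * (\<integral>\<^sup>+y. ennreal (far \<epsilon> x y * (\<bar>u x - u y\<bar> * kern s (x - y))) \<partial>lborel)"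
          by (rule nn_integral_cmult) measurable
        also have "\<dots> \<le> ennreal B * ennreal C"
          using B(2)[OF True] C(2)[OF True] by (intro mult_mono) (auto simp: ennreal_leI)
        finally show ?thesis using True B C by (simp add: ennreal_mult)
      next
        case False
        then show ?thesis using f(2) by (simp add: P_def)
      qed
    qed
    also have "\<dots> = ennreal (B * C) * emeasure lborel (cball (0::'a) r)"
      by (simp add: nn_integral_cmult_indicator)
    also have "\<dots> < \<infinity>"
      using emeasure_bounded_finite[OF bounded_cball, of "0::'a" r] by (simp add: ennreal_mult_less_top)
    finally show "(\<integral>\<^sup>+z. ennreal (norm (P z)) \<partial>(lborel \<Otimes>\<^sub>M lborel)) < \<infinity>" .
  qed measurable
  have iP': "integrable (lborel \<Otimes>\<^sub>M lborel) (\<lambda>(x, y). P (y, x))"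
    using iP by (rule lborel_pair.integrable_product_swap)
  have sum: "(\<lambda>z. P z + (\<lambda>(x, y). P (y, x)) z) = (\<lambda>(x, y). far \<epsilon> x y * kern s (x - y) * ((u x - u y) * (f x - f y)))"
    by (auto simp: P_def fun_eq_iff far_commute[of \<epsilon>] kern_commute[of s] algebra_simps)
  show "integrable (lborel \<Otimes>\<^sub>M lborel) (\<lambda>(x, y). far \<epsilon> x y * kern s (x - y) * ((u x - u y) * (f x - f y)))"
    using Bochner_Integration.integrable_add[OF iP iP'] unfolding sum .
  have "(\<integral>x. f x * trunc_lap s \<epsilon> u x \<partial>lborel) = (\<integral>x. \<integral>y. P (x, y) \<partial>lborel \<partial>lborel)"
    by (simp add: P_def trunc_lap_def)
  also have "\<dots> = integral\<^sup>L (lborel \<Otimes>\<^sub>M lborel) P"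
    by (rule lborel_pair.integral_fst'[OF iP])
  finally have 1: "(\<integral>x. f x * trunc_lap s \<epsilon> u x \<partial>lborel) = integral\<^sup>L (lborel \<Otimes>\<^sub>M lborel) P" .
  moreover have "(\<integral>(x, y). P (y, x) \<partial>(lborel \<Otimes>\<^sub>M lborel)) = integral\<^sup>L (lborel \<Otimes>\<^sub>M lborel) P"
    by (rule lborel_pair.integral_product_swap) measurable
  ultimately show "2 * (\<integral>x. f x * trunc_lap s \<epsilon> u x \<partial>lborel)
      = (\<integral>(x, y). far \<epsilon> x y * kern s (x - y) * ((u x - u y) * (f x - f y)) \<partial>(lborel \<Otimes>\<^sub>M lborel))"
    using Bochner_Integration.integral_add[OF iP iP'] unfolding sum by simp
qed

text \<open>The equations are tested together because only the sum of their symmetrized integrands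
  has a usable upper bound. On the right, the terms with \<open>Z x\<close> and \<open>Z y\<close>
  contribute equally by symmetry, and the resulting factor 2 cancels the one from the
  symmetrization.\<close>

lemma frac_sol_test_compact:
  fixes u g F :: "nat \<Rightarrow> 'a::euclidean_space \<Rightarrow> real" and \<eta> Z \<rho> :: "'a \<Rightarrow> real"
  assumes s: "0 < s" "s < 1" and I: "finite I"
    and sol: "\<And>i. i \<in> I \<Longrightarrow> frac_sol s (u i) (g i)" and F: "\<And>i. i \<in> I \<Longrightarrow> continuous_on UNIV (F i)"
    and \<eta>: "continuous_on UNIV \<eta>" "\<And>x. x \<notin> cball 0 r \<Longrightarrow> \<eta> x = 0"
    and energy: "\<And>x. (\<integral>\<^sup>+y. ennreal ((\<eta> x - \<eta> y)\<^sup>2 * kern s (x - y)) \<partial>lborel) \<le> ennreal (K * \<rho> x)"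
    and K: "0 \<le> K" and \<rho>: "\<And>x. 0 \<le> \<rho> x"
    and Z: "Z \<in> borel_measurable borel" "\<And>x. 0 \<le> Z x" "integrable lborel (\<lambda>x. Z x * \<rho> x)"
    and le: "\<And>x y. (\<Sum>i\<in>I. (u i x - u i y) * (F i x * (\<eta> x)\<^sup>2 - F i y * (\<eta> y)\<^sup>2)) \<le> (Z x + Z y) * (\<eta> x - \<eta> y)\<^sup>2"
  shows "(\<integral>x. (\<Sum>i\<in>I. F i x * g i x) * (\<eta> x)\<^sup>2 \<partial>lborel) \<le> frac_const DIM('a) s * K * (\<integral>x. Z x * \<rho> x \<partial>lborel)"
proof -
  define c where "c = frac_const DIM('a) s"
  have c: "0 \<le> c" using s by (simp add: c_def frac_const_nonneg)
  note [measurable] = Z(1)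
  have [measurable]: "\<eta> \<in> borel_measurable borel"
    using \<eta>(1) by (rule borel_measurable_continuous_onI)
  define f where "f = (\<lambda>i x. F i x * (\<eta> x)\<^sup>2)"
  have f: "continuous_on UNIV (f i)" "\<And>x. x \<notin> cball 0 r \<Longrightarrow> f i x = 0" if "i \<in> I" for i
    using F[OF that] \<eta> by (auto simp: f_def intro!: continuous_intros)
  have u: "u i \<in> L_space s" "continuous_on UNIV (u i)" if "i \<in> I" for i
    using sol[OF that] frac_sol_continuous by (auto simp: frac_sol_def)
  define S where "S = (\<lambda>(x, y). Z x * ((\<eta> x - \<eta> y)\<^sup>2 * kern s (x - y)))"
  have [measurable]: "S \<in> borel_measurable (lborel \<Otimes>\<^sub>M lborel)"
    unfolding S_def by measurable
  have S0: "0 \<le> S z" for z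
    using Z(2) by (auto simp: S_def split: prod.split)
  define J where "J = (\<integral>x. Z x * \<rho> x \<partial>lborel)"
  have J: "0 \<le> J" using Z \<rho> by (simp add: J_def)
  have nnS: "(\<integral>\<^sup>+z. ennreal (S z) \<partial>(lborel \<Otimes>\<^sub>M lborel)) \<le> ennreal (K * J)"
  proof -
    have "(\<integral>\<^sup>+z. ennreal (S z) \<partial>(lborel \<Otimes>\<^sub>M lborel)) = (\<integral>\<^sup>+x. \<integral>\<^sup>+y. ennreal (S (x, y)) \<partial>lborel \<partial>lborel)"
      by (rule lborel.nn_integral_fst[symmetric]) measurable
    also have "\<dots> \<le> (\<integral>\<^sup>+x. ennreal (K * (Z x * \<rho> x)) \<partial>lborel)"
    proof (rule nn_integral_mono)
      fix x
      have "(\<integral>\<^sup>+y. ennreal (S (x, y)) \<partial>lborel) = (\<integral>\<^sup>+y. ennreal (Z x) * ennreal ((\<eta> x - \<eta> y)\<^sup>2 * kern s (x - y)) \<partial>lborel)"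
        using Z(2) by (intro nn_integral_cong) (simp add: S_def flip: ennreal_mult)
      also have "\<dots> = ennreal (Z x) * (\<integral>\<^sup>+y. ennreal ((\<eta> x - \<eta> y)\<^sup>2 * kern s (x - y)) \<partial>lborel)"
        by (rule nn_integral_cmult) measurable
      also have "\<dots> \<le> ennreal (Z x) * ennreal (K * \<rho> x)"
        by (intro mult_left_mono energy) auto
      also have "\<dots> = ennreal (K * (Z x * \<rho> x))"
        using Z(2) K \<rho> by (simp add: mult_ac flip: ennreal_mult)
      finally show "(\<integral>\<^sup>+y. ennreal (S (x, y)) \<partial>lborel) \<le> ennreal (K * (Z x * \<rho> x))" .
    qed
    also have "\<dots> = ennreal (\<integral>x. K * (Z x * \<rho> x) \<partial>lborel)"
      using Z \<rho> K by (intro nn_integral_eq_integral) auto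
    finally show ?thesis by (simp add: J_def)
  qed
  have iS: "integrable (lborel \<Otimes>\<^sub>M lborel) S"
    using nnS S0 by (intro integrableI_bounded) (auto simp: order_le_less_trans)
  have iS': "integrable (lborel \<Otimes>\<^sub>M lborel) (\<lambda>(x, y). S (y, x))"
    using iS by (rule lborel_pair.integrable_product_swap)
  have intS: "integral\<^sup>L (lborel \<Otimes>\<^sub>M lborel) S \<le> K * J"
  proof -
    have "ennreal (integral\<^sup>L (lborel \<Otimes>\<^sub>M lborel) S) \<le> ennreal (K * J)"
      using nnS S0 by (subst nn_integral_eq_integral[symmetric]) (auto simp: iS)
    then show ?thesis using K J by (subst (asm) ennreal_le_iff) auto
  qed
  have intS': "(\<integral>(x, y). S (y, x) \<partial>(lborel \<Otimes>\<^sub>M lborel)) \<le> K * J"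
    using intS by (subst lborel_pair.integral_product_swap) measurable
  have trunc: "(\<Sum>i\<in>I. \<integral>x. f i x * (c * trunc_lap s \<epsilon> (u i) x) \<partial>lborel) \<le> c * K * J" if e: "0 < \<epsilon>" for \<epsilon>
  proof -
    let ?Q = "\<lambda>i (x, y). far \<epsilon> x y * kern s (x - y) * ((u i x - u i y) * (f i x - f i y))"
    have "2 * (\<Sum>i\<in>I. \<integral>x. f i x * trunc_lap s \<epsilon> (u i) x \<partial>lborel)
      = (\<Sum>i\<in>I. integral\<^sup>L (lborel \<Otimes>\<^sub>M lborel) (?Q i))"
      unfolding sum_distrib_left using trunc_lap_symmetrize(2)[OF s(1) e u f] by (intro sum.cong) auto
    also have "\<dots> = (\<integral>z. (\<Sum>i\<in>I. ?Q i z) \<partial>(lborel \<Otimes>\<^sub>M lborel))"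
      using trunc_lap_symmetrize(1)[OF s(1) e u f] by (intro Bochner_Integration.integral_sum[symmetric]) auto
    also have "\<dots> \<le> (\<integral>z. S z + (\<lambda>(x, y). S (y, x)) z \<partial>(lborel \<Otimes>\<^sub>M lborel))"
    proof (intro integral_mono)
      show "integrable (lborel \<Otimes>\<^sub>M lborel) (\<lambda>z. \<Sum>i\<in>I. ?Q i z)"
        using trunc_lap_symmetrize(1)[OF s(1) e u f] by (intro Bochner_Integration.integrable_sum) auto
      show "integrable (lborel \<Otimes>\<^sub>M lborel) (\<lambda>z. S z + (\<lambda>(x, y). S (y, x)) z)"
        by (intro Bochner_Integration.integrable_add iS iS')
      fix z :: "'a \<times> 'a"
      obtain x y where z: "z = (x, y)" by fastforce
      have "(\<Sum>i\<in>I. ?Q i z) = far \<epsilon> x y * kern s (x - y) * (\<Sum>i\<in>I. (u i x - u i y) * (F i x * (\<eta> x)\<^sup>2 - F i y * (\<eta> y)\<^sup>2))"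
        by (simp add: z sum_distrib_left f_def)
      also have "\<dots> \<le> far \<epsilon> x y * kern s (x - y) * ((Z x + Z y) * (\<eta> x - \<eta> y)\<^sup>2)"
        by (intro mult_left_mono le) auto
      \<comment> \<open>The cut-off is dropped only after the pointwise inequality has produced a
        nonnegative integrand, which makes the bound independent of \<epsilon>.\<close>
      also have "\<dots> \<le> 1 * kern s (x - y) * ((Z x + Z y) * (\<eta> x - \<eta> y)\<^sup>2)"
        using Z(2) by (intro mult_right_mono) auto
      also have "\<dots> = S z + (\<lambda>(x, y). S (y, x)) z"
        by (simp add: z S_def kern_commute[of s y x] power2_commute[of "\<eta> y"] algebra_simps)
      finally show "(\<Sum>i\<in>I. ?Q i z) \<le> S z + (\<lambda>(x, y). S (y, x)) z" .
    qed
    also have "\<dots> \<le> 2 * (K * J)"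
      using intS intS' by (subst Bochner_Integration.integral_add[OF iS iS']) auto
    finally have "(\<Sum>i\<in>I. \<integral>x. f i x * trunc_lap s \<epsilon> (u i) x \<partial>lborel) \<le> K * J"
      by simp
    then have "c * (\<Sum>i\<in>I. \<integral>x. f i x * trunc_lap s \<epsilon> (u i) x \<partial>lborel) \<le> c * (K * J)"
      using c by (rule mult_left_mono)
    then show ?thesis
      by (simp add: sum_distrib_left mult.left_commute[of _ c] mult.assoc)
  qed
  have lim: "(\<lambda>n. \<Sum>i\<in>I. \<integral>x. f i x * (c * trunc_lap s (inverse (real (Suc n))) (u i) x) \<partial>lborel)
      \<longlonglongrightarrow> (\<Sum>i\<in>I. \<integral>x. f i x * g i x \<partial>lborel)"
    unfolding c_def using frac_sol_tendsto[OF s sol f] by (intro tendsto_sum) auto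
  have "(\<Sum>i\<in>I. \<integral>x. f i x * g i x \<partial>lborel) \<le> c * K * J"
    using trunc by (intro LIMSEQ_le_const2[OF lim]) auto
  moreover have "(\<Sum>i\<in>I. \<integral>x. f i x * g i x \<partial>lborel) = (\<integral>x. (\<Sum>i\<in>I. F i x * g i x) * (\<eta> x)\<^sup>2 \<partial>lborel)"
  proof -
    have "integrable lborel (\<lambda>x. f i x * g i x)" if i: "i \<in> I" for i
    proof -
      have "continuous_on UNIV (\<lambda>x. f i x * g i x)"
        using f(1)[OF i] sol[OF i] by (auto simp: frac_sol_def intro!: continuous_intros)
      then have "integrable lborel (\<lambda>x. indicator (cball 0 r) x *\<^sub>R (f i x * g i x))"
        by (intro borel_integrable_compact) (auto intro: continuous_on_subset)
      moreover have "(\<lambda>x. indicator (cball 0 r) x *\<^sub>R (f i x * g i x)) = (\<lambda>x. f i x * g i x)"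
        using f(2)[OF i] by (auto simp: fun_eq_iff indicator_def)
      ultimately show ?thesis by simp
    qed
    then have "(\<Sum>i\<in>I. \<integral>x. f i x * g i x \<partial>lborel) = (\<integral>x. (\<Sum>i\<in>I. f i x * g i x) \<partial>lborel)"
      by (intro Bochner_Integration.integral_sum[symmetric]) auto
    then show ?thesis
      by (simp add: f_def sum_distrib_left sum_distrib_right mult_ac)
  qed
  ultimately show ?thesis
    by (simp add: c_def J_def)
qed

lemma weight_continuous: "0 < R \<Longrightarrow> continuous_on UNIV (weight s R)"
  unfolding weight_def by (intro continuous_intros) (auto simp: add_nonneg_eq_0_iff)

lemma sqrt_weight_small:
  assumes s: "0 < s" and R: "0 < R" and \<delta>: "0 < \<delta>"
  obtains r where "\<And>x::'a::euclidean_space. x \<notin> cball 0 r \<Longrightarrow> sqrt (weight s R x) \<le> \<delta>"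
proof -
  define m where "m = (real DIM('a) + 2 * s) / 2"
  have m: "0 < m" using s by (simp add: m_def add_nonneg_pos)
  show ?thesis
  proof (rule that[of "R * \<delta> powr (- 1 / m)"])
    fix x :: 'a assume "x \<notin> cball 0 (R * \<delta> powr (- 1 / m))"
    then have "\<delta> powr (- 1 / m) \<le> norm x / R"
      using R by (simp add: field_simps)
    also have "\<dots> \<le> 1 + norm x / R" by simp
    finally have "(1 + norm x / R) powr - m \<le> (\<delta> powr (- 1 / m)) powr - m"
      using m \<delta> by (intro powr_mono2') auto
    also have "\<dots> = \<delta>"
      using m \<delta> by (simp add: powr_powr)
    finally show "sqrt (weight s R x) \<le> \<delta>"
      using sqrt_weight[OF R, of s x] by (simp add: m_def)
  qed
qed

lemma weight_mono_R:
  fixes x :: "'a::euclidean_space"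
  assumes "0 < s" "0 < r" "r \<le> R"
  shows "weight s r x \<le> weight s R x"
  unfolding weight_def using assms
  by (intro powr_mono2') (auto simp: add_pos_nonneg intro!: divide_left_mono)

lemma weight_le_weight_1:
  fixes x :: "'a::euclidean_space"
  assumes "0 < s" "1 \<le> R"
  shows "weight s R x \<le> R powr (real DIM('a) + 2 * s) * weight s 1 x"
proof -
  define M where "M = real DIM('a) + 2 * s"
  have "weight s R x \<le> ((1 + norm x) / R) powr - M"
    unfolding weight_def M_def[symmetric] using assms
    by (intro powr_mono2') (auto simp: M_def add_divide_distrib add_pos_nonneg)
  also have "\<dots> = R powr M * weight s 1 x"
    unfolding weight_def M_def[symmetric] powr_minus_divide using assms by (simp add: powr_divide)
  finally show ?thesis by (simp add: M_def)
qed

lemma integrable_weight_R: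
  fixes Z :: "'a::euclidean_space \<Rightarrow> real"
  assumes s: "0 < s" and R: "1 \<le> R" and Z: "Z \<in> borel_measurable borel" "integrable lborel (\<lambda>x. Z x * weight s 1 x)"
  shows "integrable lborel (\<lambda>x. Z x * weight s R x)"
proof (rule Bochner_Integration.integrable_bound)
  show "integrable lborel (\<lambda>x. R powr (real DIM('a) + 2 * s) * (Z x * weight s 1 x))"
    using Z(2) by simp
  show "AE x in lborel. norm (Z x * weight s R x) \<le> norm (R powr (real DIM('a) + 2 * s) * (Z x * weight s 1 x))"
  proof (rule AE_I2)
    fix x
    have "\<bar>Z x\<bar> * weight s R x \<le> \<bar>Z x\<bar> * (R powr (real DIM('a) + 2 * s) * weight s 1 x)"
      using weight_le_weight_1[OF s R] by (intro mult_left_mono) auto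
    then show "norm (Z x * weight s R x) \<le> norm (R powr (real DIM('a) + 2 * s) * (Z x * weight s 1 x))"
      by (simp add: abs_mult mult_ac)
  qed
qed (use Z(1) in simp)

text \<open>Integrability of the left side is part of the notion: a nonintegrable function has
  Bochner integral 0, so the inequality alone would say nothing. It is also what raises the exponent
  in the iterations. The constant must not depend on \<open>R\<close>.\<close>

definition weighted_bound :: "real \<Rightarrow> ('a::euclidean_space \<Rightarrow> real) \<Rightarrow> ('a \<Rightarrow> real) \<Rightarrow> bool" where
  "weighted_bound s Y Z \<longleftrightarrow> (\<exists>C>0. \<forall>R\<ge>1. integrable lborel (\<lambda>x. Y x * weight s R x) \<and>
     (\<integral>x. Y x * weight s R x \<partial>lborel) \<le> C * R powr (- 2 * s) * (\<integral>x. Z x * weight s R x \<partial>lborel))"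

text \<open>The truncation max (sqrt w - \<delta>) 0 has bounded support, is a contraction of sqrt w
  and hence has no larger energy, and increases to sqrt w as \<delta> decreases to 0. Monotone
  convergence then gives finiteness along with the bound. The hypothesis \<open>le\<close> ranges
  over all values A, B of the test function at x and y, so it is purely algebraic and independent of
  \<open>R\<close>.\<close>

lemma frac_sol_weighted_bound_indexed:
  fixes u g F :: "nat \<Rightarrow> 'a::euclidean_space \<Rightarrow> real" and Y Z :: "'a \<Rightarrow> real"
  assumes s: "0 < s" "s < 1" and I: "finite I" and sol: "\<And>i. i \<in> I \<Longrightarrow> frac_sol s (u i) (g i)"
    and F: "\<And>i. i \<in> I \<Longrightarrow> continuous_on UNIV (F i)"
    and [measurable]: "Y \<in> borel_measurable borel" "Z \<in> borel_measurable borel"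
    and Y0: "\<And>x. 0 \<le> Y x" and Z0: "\<And>x. 0 \<le> Z x" and Zint: "integrable lborel (\<lambda>x. Z x * weight s 1 x)"
    and YF: "\<And>x. Y x \<le> (\<Sum>i\<in>I. F i x * g i x)"
    and le: "\<And>x y A B. 0 \<le> A \<Longrightarrow> 0 \<le> B \<Longrightarrow>
      (\<Sum>i\<in>I. (u i x - u i y) * (F i x * A\<^sup>2 - F i y * B\<^sup>2)) \<le> (Z x + Z y) * (A - B)\<^sup>2"
  shows "weighted_bound s Y Z"
proof -
  obtain E where E: "0 < E"
    "\<And>R x. 0 < R \<Longrightarrow> (\<integral>\<^sup>+y. ennreal ((sqrt (weight s R x) - sqrt (weight s R y))\<^sup>2 * kern s (x - y :: 'a)) \<partial>lborel)
       \<le> ennreal (E * R powr (- 2 * s) * weight s R x)"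
    using nn_integral_sqrt_weight_energy[OF s] by blast
  define c where "c = frac_const DIM('a) s"
  have c: "0 \<le> c" using s by (simp add: c_def frac_const_nonneg)
  show ?thesis
    unfolding weighted_bound_def
  \<comment> \<open>\<open>c + 1\<close> replaces \<open>c\<close> because only c >= 0 has been
    shown, while a positive constant is required.\<close>
  proof (intro exI[of _ "(c + 1) * E"] conjI allI impI)
    show "0 < (c + 1) * E" using c E by simp
    fix R :: real assume R1: "1 \<le> R"
    then have R: "0 < R" by simp
    let ?w = "weight s R :: 'a \<Rightarrow> real"
    have ZR: "integrable lborel (\<lambda>x. Z x * ?w x)"
      using integrable_weight_R[OF s(1) R1 _ Zint] by simp
    define J where "J = (\<integral>x. Z x * ?w x \<partial>lborel)"
    have J: "0 \<le> J" using Z0 by (simp add: J_def)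
    define T where "T = c * (E * R powr (- 2 * s)) * J"
    define \<delta> where "\<delta> = (\<lambda>n. inverse (real (Suc n)))"
    define \<eta> where "\<eta> = (\<lambda>n x. max (sqrt (?w x) - \<delta> n) 0)"
    have \<delta>: "0 < \<delta> n" for n by (simp add: \<delta>_def)
    have \<eta>cont: "continuous_on UNIV (\<eta> n)" for n
      unfolding \<eta>_def using weight_continuous[OF R] by (intro continuous_intros) auto
    have [measurable]: "\<eta> n \<in> borel_measurable borel" for n
      using \<eta>cont by (rule borel_measurable_continuous_onI)
    have bound: "(\<integral>\<^sup>+x. ennreal (Y x * (\<eta> n x)\<^sup>2) \<partial>lborel) \<le> ennreal T" for n
    proof -
      obtain r where r: "\<And>x::'a. x \<notin> cball 0 r \<Longrightarrow> sqrt (?w x) \<le> \<delta> n"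
        using sqrt_weight_small[OF s(1) R \<delta>] by blast
      have \<eta>0: "\<eta> n x = 0" if "x \<notin> cball 0 r" for x
        using r[OF that] by (simp add: \<eta>_def max_def)
      have energy: "(\<integral>\<^sup>+y. ennreal ((\<eta> n x - \<eta> n y)\<^sup>2 * kern s (x - y)) \<partial>lborel)
          \<le> ennreal ((E * R powr (- 2 * s)) * ?w x)" for x
      proof -
        have "\<bar>max (a - d) 0 - max (b - d) 0\<bar> \<le> \<bar>a - b\<bar>" for a b d :: real
          by (auto simp: max_def abs_if)
        then have "(\<eta> n x - \<eta> n y)\<^sup>2 \<le> (sqrt (?w x) - sqrt (?w y))\<^sup>2" for y
          unfolding abs_le_square_iff[symmetric] \<eta>_def by blast
        then have "(\<integral>\<^sup>+y. ennreal ((\<eta> n x - \<eta> n y)\<^sup>2 * kern s (x - y)) \<partial>lborel)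
           \<le> (\<integral>\<^sup>+y. ennreal ((sqrt (?w x) - sqrt (?w y))\<^sup>2 * kern s (x - y)) \<partial>lborel)"
          by (intro nn_integral_mono ennreal_leI mult_right_mono) auto
        also have "\<dots> \<le> ennreal (E * R powr (- 2 * s) * ?w x)"
          by (rule E(2)[OF R])
        finally show ?thesis .
      qed
      have gcont: "continuous_on UNIV (g i)" if "i \<in> I" for i
        using sol[OF that] by (simp add: frac_sol_def)
      have Hcont: "continuous_on UNIV (\<lambda>x. (\<Sum>i\<in>I. F i x * g i x) * (\<eta> n x)\<^sup>2)"
        using F gcont \<eta>cont by (intro continuous_intros) auto
      have Hint: "integrable lborel (\<lambda>x. (\<Sum>i\<in>I. F i x * g i x) * (\<eta> n x)\<^sup>2)"
      proof -
        have "integrable lborel (\<lambda>x. indicator (cball 0 r) x *\<^sub>R ((\<Sum>i\<in>I. F i x * g i x) * (\<eta> n x)\<^sup>2))"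
          using Hcont by (intro borel_integrable_compact) (auto intro: continuous_on_subset)
        moreover have "(\<lambda>x. indicator (cball 0 r) x *\<^sub>R ((\<Sum>i\<in>I. F i x * g i x) * (\<eta> n x)\<^sup>2))
            = (\<lambda>x. (\<Sum>i\<in>I. F i x * g i x) * (\<eta> n x)\<^sup>2)"
          using \<eta>0 by (auto simp: fun_eq_iff indicator_def)
        ultimately show ?thesis by simp
      qed
      have pos: "0 \<le> (\<Sum>i\<in>I. F i x * g i x)" for x
        using Y0 YF order_trans by blast
      have "(\<integral>\<^sup>+x. ennreal (Y x * (\<eta> n x)\<^sup>2) \<partial>lborel) \<le> (\<integral>\<^sup>+x. ennreal ((\<Sum>i\<in>I. F i x * g i x) * (\<eta> n x)\<^sup>2) \<partial>lborel)"
        using YF by (intro nn_integral_mono ennreal_leI mult_right_mono) auto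
      also have "\<dots> = ennreal (\<integral>x. (\<Sum>i\<in>I. F i x * g i x) * (\<eta> n x)\<^sup>2 \<partial>lborel)"
        using Hint pos by (intro nn_integral_eq_integral) auto
      also have "\<dots> \<le> ennreal T"
      proof (rule ennreal_leI)
        show "(\<integral>x. (\<Sum>i\<in>I. F i x * g i x) * (\<eta> n x)\<^sup>2 \<partial>lborel) \<le> T"
          unfolding T_def c_def J_def
        proof (rule frac_sol_test_compact[OF s I sol F \<eta>cont \<eta>0 energy])
          fix x y
          show "(\<Sum>i\<in>I. (u i x - u i y) * (F i x * (\<eta> n x)\<^sup>2 - F i y * (\<eta> n y)\<^sup>2)) \<le> (Z x + Z y) * (\<eta> n x - \<eta> n y)\<^sup>2"
            by (rule le) (auto simp: \<eta>_def)
        qed (use E Z0 ZR in auto)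
      qed
      finally show ?thesis .
    qed
    have lim: "(\<lambda>n. \<integral>\<^sup>+x. ennreal (Y x * (\<eta> n x)\<^sup>2) \<partial>lborel) \<longlonglongrightarrow> (\<integral>\<^sup>+x. ennreal (Y x * ?w x) \<partial>lborel)"
    proof (rule nn_integral_LIMSEQ)
      show "incseq (\<lambda>n x. ennreal (Y x * (\<eta> n x)\<^sup>2))"
      proof (intro incseq_SucI le_funI ennreal_leI mult_left_mono power_mono Y0)
        fix n x
        have "\<delta> (Suc n) \<le> \<delta> n" by (simp add: \<delta>_def field_simps)
        then show "\<eta> n x \<le> \<eta> (Suc n) x" by (simp add: \<eta>_def)
        show "0 \<le> \<eta> n x" by (simp add: \<eta>_def)
      qed
      fix x
      have "(\<lambda>n. Y x * (max (sqrt (?w x) - \<delta> n) 0)\<^sup>2) \<longlonglongrightarrow> Y x * (max (sqrt (?w x) - 0) 0)\<^sup>2"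
        unfolding \<delta>_def by (intro tendsto_intros LIMSEQ_inverse_real_of_nat)
      then show "(\<lambda>n. ennreal (Y x * (\<eta> n x)\<^sup>2)) \<longlonglongrightarrow> ennreal (Y x * ?w x)"
        unfolding \<eta>_def by (intro tendsto_ennrealI) (simp add: max_absorb1)
    qed measurable
    have nn: "(\<integral>\<^sup>+x. ennreal (Y x * ?w x) \<partial>lborel) \<le> ennreal T"
      using bound by (intro LIMSEQ_le_const2[OF lim]) auto
    have int: "integrable lborel (\<lambda>x. Y x * ?w x)"
      using nn Y0 by (intro integrableI_bounded) (auto simp: abs_mult order_le_less_trans)
    have T0: "0 \<le> T" using c E J by (simp add: T_def)
    have "ennreal (\<integral>x. Y x * ?w x \<partial>lborel) \<le> ennreal T"
      using nn Y0 by (subst nn_integral_eq_integral[symmetric]) (auto simp: int)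
    then have "(\<integral>x. Y x * ?w x \<partial>lborel) \<le> T"
      using T0 by (subst (asm) ennreal_le_iff) auto
    also have "T \<le> (c + 1) * E * R powr (- 2 * s) * J"
      using c E J by (simp add: T_def algebra_simps)
    finally show "(\<integral>x. Y x * ?w x \<partial>lborel) \<le> (c + 1) * E * R powr (- 2 * s) * (\<integral>x. Z x * ?w x \<partial>lborel)"
      by (simp add: J_def)
    show "integrable lborel (\<lambda>x. Y x * ?w x)" by (rule int)
  qed
qed

text \<open>With a list, an application can write its equations and multipliers as literal triples
  (solution, right-hand side, multiplier).\<close>

lemma frac_sol_weighted_bound:
  fixes L :: "(('a::euclidean_space \<Rightarrow> real) \<times> ('a \<Rightarrow> real) \<times> ('a \<Rightarrow> real)) list" and Y Z :: "'a \<Rightarrow> real"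
  assumes s: "0 < s" "s < 1"
    and L: "\<And>u g F. (u, g, F) \<in> set L \<Longrightarrow> frac_sol s u g \<and> continuous_on UNIV F"
    and YZ: "Y \<in> borel_measurable borel" "Z \<in> borel_measurable borel"
      "\<And>x. 0 \<le> Y x" "\<And>x. 0 \<le> Z x" "integrable lborel (\<lambda>x. Z x * weight s 1 x)"
    and le: "\<And>x. Y x \<le> (\<Sum>(u, g, F)\<leftarrow>L. F x * g x)"
      "\<And>x y A B. 0 \<le> A \<Longrightarrow> 0 \<le> B \<Longrightarrow>
        (\<Sum>(u, g, F)\<leftarrow>L. (u x - u y) * (F x * A\<^sup>2 - F y * B\<^sup>2)) \<le> (Z x + Z y) * (A - B)\<^sup>2"
  shows "weighted_bound s Y Z"
proof -
  have nth: "frac_sol s (fst (L ! i)) (fst (snd (L ! i))) \<and> continuous_on UNIV (snd (snd (L ! i)))"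
    if "i \<in> {..<length L}" for i
    using that by (intro L) simp
  show ?thesis
    using le nth
    by (intro frac_sol_weighted_bound_indexed[OF s, of "{..<length L}" "\<lambda>i. fst (L ! i)" "\<lambda>i. fst (snd (L ! i))"
          "\<lambda>i. snd (snd (L ! i))"] YZ)
      (auto simp: sum_list_sum_nth atLeast0LessThan case_prod_beta)
qed

section \<open>From a weighted bound to vanishing\<close>

text \<open>Either X^b >= 2\<mu>, and the lower power is absorbed with factor 1/2, or X is small and
  the lower power is bounded by a constant.\<close>

lemma powr_Young:
  fixes X :: real
  assumes "0 \<le> X" "0 < \<mu>" "0 < r" "0 < b"
  shows "\<mu> * X powr r \<le> X powr (r + b) / 2 + \<mu> * (2 * \<mu>) powr (r / b)"
proof (cases "2 * \<mu> \<le> X powr b")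
  case True
  have "2 * \<mu> * X powr r \<le> X powr b * X powr r"
    using True by (intro mult_right_mono) auto
  then have "2 * (\<mu> * X powr r) \<le> X powr (r + b)"
    by (simp add: powr_add mult_ac)
  moreover have "0 \<le> \<mu> * (2 * \<mu>) powr (r / b)"
    using assms by simp
  ultimately show ?thesis
    by linarith
next
  case False
  have "X powr r = (X powr b) powr (r / b)"
    using assms by (simp add: powr_powr)
  also have "\<dots> \<le> (2 * \<mu>) powr (r / b)"
    using False assms by (intro powr_mono2) auto
  finally have "\<mu> * X powr r \<le> \<mu> * (2 * \<mu>) powr (r / b)"
    using assms by (intro mult_left_mono) auto
  then show ?thesis
    by (smt (verit) divide_nonneg_pos powr_ge_zero)
qed

lemma powr_le_1_plus_powr: "0 \<le> X \<Longrightarrow> 0 \<le> r \<Longrightarrow> r \<le> r' \<Longrightarrow> X powr r \<le> 1 + X powr (r' :: real)" for X :: real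
proof (cases "X \<le> 1")
  case True
  assume "0 \<le> X" "0 \<le> r"
  with True have "X powr r \<le> 1" by (simp add: powr_le1)
  then show ?thesis by (simp add: add_increasing2)
next
  case False
  assume "r \<le> r'"
  with False have "X powr r \<le> X powr r'" by (simp add: powr_mono)
  then show ?thesis by simp
qed

lemma integrable_weight:
  assumes s: "0 < s" and R: "0 < R"
  shows "integrable lborel (weight s R :: 'a::euclidean_space \<Rightarrow> real)"
proof (rule integrableI_bounded)
  obtain C where "\<And>R. 0 < R \<Longrightarrow> (\<integral>\<^sup>+x. ennreal (weight s R (x::'a)) \<partial>lborel) \<le> ennreal (C * R ^ DIM('a))"
    using nn_integral_weight[OF s] by blast
  from this[OF R] show "(\<integral>\<^sup>+x. ennreal (norm (weight s R (x::'a))) \<partial>lborel) < \<infinity>"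
    by (simp add: order_le_less_trans)
qed measurable

lemma integrable_weight_mono:
  fixes Y Z :: "'a::euclidean_space \<Rightarrow> real"
  assumes "integrable lborel (\<lambda>x. Z x * weight s R x)" "Y \<in> borel_measurable borel"
    "\<And>x. 0 \<le> Y x" "\<And>x. Y x \<le> Z x"
  shows "integrable lborel (\<lambda>x. Y x * weight s R x)"
proof (rule Bochner_Integration.integrable_bound[OF assms(1)])
  show "AE x in lborel. norm (Y x * weight s R x) \<le> norm (Z x * weight s R x)"
    using assms(3,4) order_trans[OF assms(3,4)] by (intro AE_I2) (simp add: abs_mult mult_right_mono)
qed (use assms(2) in simp)

lemma integrable_weight_powr_mono:
  fixes X :: "'a::euclidean_space \<Rightarrow> real"
  assumes s: "0 < s" and X: "X \<in> borel_measurable borel" "\<And>x. 0 \<le> X x"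
    and int: "integrable lborel (\<lambda>x. X x powr r' * weight s 1 x)" and r: "0 \<le> r" "r \<le> r'"
  shows "integrable lborel (\<lambda>x. X x powr r * weight s 1 x)"
proof (rule integrable_weight_mono)
  show "integrable lborel (\<lambda>x. (1 + X x powr r') * weight s 1 x)"
    using Bochner_Integration.integrable_add[OF integrable_weight[OF s zero_less_one] int] by (simp add: algebra_simps)
  show "(\<lambda>x. X x powr r) \<in> borel_measurable borel"
    using X(1) by measurable
qed (use X r powr_le_1_plus_powr in auto)

lemma weighted_bound_mono:
  fixes Y Z :: "'a::euclidean_space \<Rightarrow> real"
  assumes s: "0 < s" and bound: "weighted_bound s Y Z"
    and Y': "Y' \<in> borel_measurable borel" "0 < c" "\<And>x. 0 \<le> Y' x" "\<And>x. Y' x \<le> c * Y x"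
    and Z': "Z' \<in> borel_measurable borel" "0 < d" "\<And>x. Z x \<le> d * Z' x"
      "integrable lborel (\<lambda>x. Z' x * weight s 1 x)"
    and Z: "Z \<in> borel_measurable borel" "\<And>x. 0 \<le> Z x"
  shows "weighted_bound s Y' Z'"
proof -
  obtain C where C: "0 < C" and bd: "\<And>R. 1 \<le> R \<Longrightarrow> integrable lborel (\<lambda>x. Y x * weight s R x) \<and>
     (\<integral>x. Y x * weight s R x \<partial>lborel) \<le> C * R powr (- 2 * s) * (\<integral>x. Z x * weight s R x \<partial>lborel)"
    using bound by (auto simp: weighted_bound_def)
  show ?thesis
    unfolding weighted_bound_def
  proof (intro exI[of _ "c * C * d"] conjI allI impI)
    show "0 < c * C * d" using C Y' Z' by simp
    fix R :: real assume R: "1 \<le> R"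
    have cY: "integrable lborel (\<lambda>x. (c * Y x) * weight s R x)"
      using bd[OF R] by (simp add: mult.assoc)
    show iY': "integrable lborel (\<lambda>x. Y' x * weight s R x)"
      by (rule integrable_weight_mono[OF cY Y'(1,3,4)])
    have dZ: "integrable lborel (\<lambda>x. (d * Z' x) * weight s R x)"
      using integrable_weight_R[OF s R Z'(1,4)] by (simp add: mult.assoc)
    have iZ: "integrable lborel (\<lambda>x. Z x * weight s R x)"
      by (rule integrable_weight_mono[OF dZ Z Z'(3)])
    have "(\<integral>x. Y' x * weight s R x \<partial>lborel) \<le> (\<integral>x. (c * Y x) * weight s R x \<partial>lborel)"
      using Y' by (intro integral_mono iY' cY mult_right_mono) auto
    also have "\<dots> = c * (\<integral>x. Y x * weight s R x \<partial>lborel)"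
      by (simp add: mult.assoc)
    also have "\<dots> \<le> c * (C * R powr (- 2 * s) * (\<integral>x. Z x * weight s R x \<partial>lborel))"
      using bd[OF R] Y' by (intro mult_left_mono) auto
    also have "\<dots> \<le> c * (C * R powr (- 2 * s) * (\<integral>x. (d * Z' x) * weight s R x \<partial>lborel))"
      using Y' Z' C by (intro mult_left_mono integral_mono iZ dZ mult_right_mono) auto
    also have "\<dots> = c * C * d * R powr (- 2 * s) * (\<integral>x. Z' x * weight s R x \<partial>lborel)"
      by (simp add: mult_ac)
    finally show "(\<integral>x. Y' x * weight s R x \<partial>lborel) \<le> c * C * d * R powr (- 2 * s) * (\<integral>x. Z' x * weight s R x \<partial>lborel)" .
  qed
qed

lemma weighted_bound_integrable: "weighted_bound s Y Z \<Longrightarrow> integrable lborel (\<lambda>x. Y x * weight s 1 x)"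
  by (auto simp: weighted_bound_def)

lemma AE_zero_continuous:
  fixes h :: "'a::euclidean_space \<Rightarrow> real"
  assumes h: "continuous_on UNIV h" "AE x in lborel. h x = 0"
  shows "h x = 0"
proof (rule ccontr)
  assume "h x \<noteq> 0"
  have "open {y. h y \<noteq> 0}"
    using h(1) by (intro open_Collect_neq continuous_on_const)
  then obtain e where e: "0 < e" "ball x e \<subseteq> {y. h y \<noteq> 0}"
    using \<open>h x \<noteq> 0\<close> by (auto simp: open_contains_ball)
  have "AE y in lborel. y \<notin> ball x e"
    using h(2) by eventually_elim (use e in auto)
  then have "emeasure lborel (ball x e) = 0"
    using emeasure_eq_0_AE[of "\<lambda>y. y \<in> ball x e" lborel] by (simp del: mem_ball)
  then show False
    using e unit_ball_vol_pos[of "real DIM('a)"] by (simp add: emeasure_ball)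
qed

text \<open>Young's inequality with \<mu> = C R^(-2s) absorbs half of the left side. What remains is
  \<mu>^((r+b)/b) times the mass R^N of the weight, up to a constant, and the dimension condition
  says exactly that this power of R is negative.\<close>

lemma weighted_bound_imp_zero:
  fixes X :: "'a::euclidean_space \<Rightarrow> real"
  assumes s: "0 < s" and X: "continuous_on UNIV X" "\<And>x. 0 \<le> X x" and r: "0 < r" "0 < b"
    and bound: "weighted_bound s (\<lambda>x. X x powr (r + b)) (\<lambda>x. X x powr r)"
    and int: "integrable lborel (\<lambda>x. X x powr r * weight s 1 x)"
    and dim: "real DIM('a) < 2 * s * (r + b) / b"
  shows "X x = 0"
proof -
  have [measurable]: "X \<in> borel_measurable borel"
    using X(1) by (rule borel_measurable_continuous_onI)
  obtain C where C: "0 < C" and bd: "\<And>R. 1 \<le> R \<Longrightarrow> integrable lborel (\<lambda>x. X x powr (r + b) * weight s R x) \<and>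
     (\<integral>x. X x powr (r + b) * weight s R x \<partial>lborel) \<le> C * R powr (- 2 * s) * (\<integral>x. X x powr r * weight s R x \<partial>lborel)"
    using bound by (auto simp: weighted_bound_def)
  obtain W where W: "0 < W" "\<And>R. 0 < R \<Longrightarrow> (\<integral>\<^sup>+x. ennreal (weight s R (x::'a)) \<partial>lborel) \<le> ennreal (W * R ^ DIM('a))"
    using nn_integral_weight[OF s] by blast
  define G where "G = (\<lambda>R. \<integral>x. X x powr (r + b) * weight s R x \<partial>lborel)"
  define e where "e = 2 * s * (r + b) / b - real DIM('a)"
  have e: "0 < e" using dim by (simp add: e_def)
  define K where "K = (2 * C) powr ((r + b) / b) * W"
  have upper: "G 1 \<le> K * R powr - e" if R: "1 \<le> R" for R
  proof -
    define \<mu> where "\<mu> = C * R powr (- 2 * s)"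
    have \<mu>: "0 < \<mu>" using C R by (simp add: \<mu>_def)
    define V where "V = (\<integral>x. weight s R (x::'a) \<partial>lborel)"
    have iw: "integrable lborel (weight s R :: 'a \<Rightarrow> real)"
      by (intro integrable_weight s) (use R in simp)
    have "ennreal V \<le> ennreal (W * R ^ DIM('a))"
      using W(2)[of R] R unfolding V_def by (subst nn_integral_eq_integral[symmetric]) (auto simp: iw)
    then have V: "V \<le> W * R ^ DIM('a)"
      using W R by (subst (asm) ennreal_le_iff) auto
    have iG: "integrable lborel (\<lambda>x. X x powr (r + b) * weight s R x)"
      using bd[OF R] by blast
    have "G R \<le> \<mu> * (\<integral>x. X x powr r * weight s R x \<partial>lborel)"
      using bd[OF R] by (simp add: G_def \<mu>_def)
    also have "\<dots> = (\<integral>x. (\<mu> * X x powr r) * weight s R x \<partial>lborel)"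
      by (simp add: mult.assoc)
    also have "\<dots> \<le> (\<integral>x. 1 / 2 * (X x powr (r + b) * weight s R x) + (\<mu> * (2 * \<mu>) powr (r / b)) * weight s R x \<partial>lborel)"
    proof (rule integral_mono)
      show "integrable lborel (\<lambda>x. (\<mu> * X x powr r) * weight s R x)"
        using integrable_weight_R[OF s R _ int] by (simp add: mult.assoc)
      show "integrable lborel (\<lambda>x. 1 / 2 * (X x powr (r + b) * weight s R x) + (\<mu> * (2 * \<mu>) powr (r / b)) * weight s R x)"
        by (intro Bochner_Integration.integrable_add integrable_mult_right iG iw)
      fix x
      have "\<mu> * X x powr r * weight s R x \<le> (X x powr (r + b) / 2 + \<mu> * (2 * \<mu>) powr (r / b)) * weight s R x"
        using X(2) \<mu> r by (intro mult_right_mono powr_Young) auto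
      then show "\<mu> * X x powr r * weight s R x \<le> 1 / 2 * (X x powr (r + b) * weight s R x) + (\<mu> * (2 * \<mu>) powr (r / b)) * weight s R x"
        by (simp add: algebra_simps)
    qed
    also have "\<dots> = 1 / 2 * G R + \<mu> * (2 * \<mu>) powr (r / b) * V"
      unfolding G_def V_def
      by (subst Bochner_Integration.integral_add) (auto intro!: integrable_mult_right iG iw)
    finally have "G R \<le> 2 * \<mu> * (2 * \<mu>) powr (r / b) * V"
      by simp
    also have "2 * \<mu> * (2 * \<mu>) powr (r / b) = (2 * \<mu>) powr ((r + b) / b)"
      using \<mu> r by (simp add: add_divide_distrib powr_add)
    also have "(2 * \<mu>) powr ((r + b) / b) * V \<le> (2 * \<mu>) powr ((r + b) / b) * (W * R ^ DIM('a))"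
      using V by (intro mult_left_mono) auto
    also have "\<dots> = K * R powr - e"
    proof -
      have "(2 * \<mu>) powr ((r + b) / b) = (2 * C) powr ((r + b) / b) * R powr (- 2 * s * ((r + b) / b))"
        unfolding \<mu>_def mult.assoc[symmetric] using C R by (subst powr_mult) (auto simp: powr_powr)
      moreover have "R powr (- 2 * s * ((r + b) / b)) * R ^ DIM('a) = R powr - e"
        using R by (simp add: e_def flip: powr_realpow powr_add)
      ultimately show ?thesis
        by (simp add: K_def)
    qed
    finally have "G R \<le> K * R powr - e" .
    \<comment> \<open>The weights increase with R, so a bound on \<open>G R\<close> that tends to 0
      controls the fixed number \<open>G 1\<close>.\<close>
    moreover have "G 1 \<le> G R"
      unfolding G_def using bd[of 1] iG weight_mono_R[OF s zero_less_one R]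
      by (intro integral_mono mult_left_mono) auto
    ultimately show ?thesis by simp
  qed
  have "((\<lambda>R. K * R powr - e) \<longlongrightarrow> K * 0) at_top"
    using e by (intro tendsto_intros tendsto_neg_powr filterlim_ident) auto
  then have "G 1 \<le> K * 0"
    by (rule tendsto_lowerbound) (auto intro!: eventually_mono[OF eventually_ge_at_top[of 1]] upper)
  moreover have "0 \<le> G 1"
    by (simp add: G_def)
  ultimately have "G 1 = 0" by simp
  then have "AE x in lborel. X x powr (r + b) * weight s 1 x = 0"
    unfolding G_def using bd[of 1] by (subst (asm) integral_nonneg_eq_0_iff_AE) auto
  then have "AE x in lborel. X x = 0"
    by eventually_elim (metis less_irrefl mult_eq_0_iff powr_eq_0_iff weight_pos zero_less_one)
  then show ?thesis
    using AE_zero_continuous[OF X(1)] by blast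
qed

section \<open>Pointwise inequalities\<close>

text \<open>For k >= 1 one factor b^(k-1) is raised to a^(k-1); for k < 1 the derivative is
  decreasing, so its smallest value on the interval is the one at \<open>a\<close>.\<close>

lemma powr_diff_ge:
  fixes a b k :: real
  assumes "0 < k" "0 \<le> b" "b \<le> a" "0 < a"
  shows "min 1 k * a powr (k - 1) * (a - b) \<le> a powr k - b powr k"
proof (cases "k \<ge> 1")
  case True
  have "b powr k = b powr (k - 1) * b"
    using assms by (cases "b = 0") (auto simp: powr_diff)
  also have "\<dots> \<le> a powr (k - 1) * b"
    using assms True by (intro mult_right_mono powr_mono2) auto
  finally have "b powr k \<le> a powr (k - 1) * b" .
  moreover have "a powr k = a powr (k - 1) * a"
    using assms by (simp add: powr_diff)
  ultimately show ?thesis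
    using True by (simp add: algebra_simps min_def)
next
  case False
  have ak: "a powr k = a powr (k - 1) * a"
    using assms by (simp add: powr_diff)
  consider "b = 0" | "b = a" | "0 < b" "b < a"
    using assms by fastforce
  then show ?thesis
  proof cases
    case 1
    then show ?thesis
      using False assms ak by (simp add: min_def mult_left_le_one_le algebra_simps)
  next
    case 3
    have "\<exists>z. b < z \<and> z < a \<and> a powr k - b powr k = (a - b) * (k * z powr (k - 1))"
      using 3 by (intro MVT2) (auto intro!: derivative_eq_intros simp: powr_diff field_simps)
    then obtain z where z: "b < z" "z < a" "a powr k - b powr k = (a - b) * (k * z powr (k - 1))"
      by blast
    have "a powr (k - 1) \<le> z powr (k - 1)"
      using z 3 False by (intro powr_mono2') auto
    then have "(a - b) * (k * a powr (k - 1)) \<le> (a - b) * (k * z powr (k - 1))"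
      using 3 assms by (intro mult_left_mono) auto
    then show ?thesis
      using z False by (simp add: min_def algebra_simps)
  qed auto
qed

text \<open>Multiplying by q - p and adding the square of pA - qB gives exactly pq(A - B)^2. This
  shows how two unequal weights in the wrong order still leave only the variation of the
  cut-off.\<close>

lemma quadratic_gap:
  fixes p q A B :: real
  assumes "0 < p" "p < q"
  shows "p * A\<^sup>2 - q * B\<^sup>2 \<le> p * q / (q - p) * (A - B)\<^sup>2"
proof -
  have "(p * A\<^sup>2 - q * B\<^sup>2) * (q - p) + (p * A - q * B)\<^sup>2 = p * q * (A - B)\<^sup>2"
    by (simp add: power2_eq_square algebra_simps)
  then have "(p * A\<^sup>2 - q * B\<^sup>2) * (q - p) \<le> p * q * (A - B)\<^sup>2"
    by (smt (verit) zero_le_power2)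
  then show ?thesis
    using assms by (simp add: field_simps)
qed

text \<open>Discrete Picone inequality: the two sides differ by the square of b\<alpha> - a\<beta>
  divided by ab.\<close>

lemma picone_pointwise:
  fixes a b \<alpha> \<beta> :: real
  assumes "0 < a" "0 < b"
  shows "(a - b) * (\<alpha>\<^sup>2 / a - \<beta>\<^sup>2 / b) \<le> (\<alpha> - \<beta>)\<^sup>2"
proof -
  have "(\<alpha> - \<beta>)\<^sup>2 - (a - b) * (\<alpha>\<^sup>2 / a - \<beta>\<^sup>2 / b) = (b * \<alpha> - a * \<beta>)\<^sup>2 / (a * b)"
    using assms by (simp add: field_simps power2_eq_square)
  moreover have "\<dots> \<ge> 0"
    using assms by simp
  ultimately show ?thesis
    by linarith
qed

text \<open>For A = B the left side is already nonpositive. In general \<open>quadratic_gap\<close>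
  for the two negative powers leaves (a - b)/(a^g - b^g), which \<open>powr_diff_ge\<close> bounds
  by a^(1-g)/g when b < a. The exponent 1 - g lies below 1, where \<open>L_space\<close> gives
  integrability.\<close>

lemma neg_power_test_pointwise:
  fixes a b g A B :: real
  assumes "0 < a" "0 < b" "0 < g" "g < 1"
  shows "(a - b) * (a powr - g * A\<^sup>2 - b powr - g * B\<^sup>2)
     \<le> 1 / g * (a powr (1 - g) + b powr (1 - g)) * (A - B)\<^sup>2"
proof -
  have *: "(a - b) * (a powr - g * A\<^sup>2 - b powr - g * B\<^sup>2)
     \<le> 1 / g * (a powr (1 - g) + b powr (1 - g)) * (A - B)\<^sup>2"
    if "0 < b" "b < a" for a b A B :: real
  proof -
    have lt: "a powr - g < b powr - g"
      using that assms by (simp add: powr_less_mono2_neg)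
    have pos: "0 < a powr g - b powr g"
      using that assms by (simp add: powr_less_mono2)
    have "g * a powr (g - 1) * (a - b) \<le> a powr g - b powr g"
      using powr_diff_ge[of g b a] that assms by (simp add: min_def)
    then have "a powr (1 - g) * (g * a powr (g - 1) * (a - b)) \<le> a powr (1 - g) * (a powr g - b powr g)"
      by (intro mult_left_mono) auto
    moreover have "a powr (1 - g) * a powr (g - 1) = 1"
      using that by (simp flip: powr_add)
    moreover have "a powr (1 - g) * (g * a powr (g - 1) * (a - b))
        = a powr (1 - g) * a powr (g - 1) * (g * (a - b))"
      by (simp only: mult_ac)
    ultimately have "g * (a - b) \<le> a powr (1 - g) * (a powr g - b powr g)"
      by simp
    then have gap: "(a - b) / (a powr g - b powr g) \<le> a powr (1 - g) / g"
      using pos assms by (simp add: field_simps)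
    have "a powr - g * b powr - g / (b powr - g - a powr - g) = 1 / (a powr g - b powr g)"
      using that pos by (simp add: powr_minus field_simps)
    then have "a powr - g * A\<^sup>2 - b powr - g * B\<^sup>2 \<le> 1 / (a powr g - b powr g) * (A - B)\<^sup>2"
      using quadratic_gap[OF _ lt, of A B] that by simp
    then have "(a - b) * (a powr - g * A\<^sup>2 - b powr - g * B\<^sup>2)
        \<le> (a - b) * (1 / (a powr g - b powr g) * (A - B)\<^sup>2)"
      using that by (intro mult_left_mono) auto
    also have "\<dots> = (a - b) / (a powr g - b powr g) * (A - B)\<^sup>2"
      by simp
    also have "\<dots> \<le> a powr (1 - g) / g * (A - B)\<^sup>2"
      using gap by (intro mult_right_mono) auto
    also have "\<dots> \<le> 1 / g * (a powr (1 - g) + b powr (1 - g)) * (A - B)\<^sup>2"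
      using assms by (intro mult_right_mono) (auto simp: field_simps)
    finally show ?thesis .
  qed
  consider "b < a" | "a < b" | "a = b" by linarith
  then show ?thesis
  proof cases
    case 2
    then show ?thesis
      using *[of a b B A] assms by (simp add: algebra_simps power2_commute)
  next
    case 3
    then show ?thesis
      using assms by simp
  qed (use * assms in auto)
qed

text \<open>If the smaller value is nonpositive the sign alone decides. Otherwise both are positive
  and \<open>quadratic_gap\<close> applies to their k-th powers. It is the integrand for testing -w
  with the k-th power of its positive part.\<close>

lemma pos_part_test_pointwise:
  fixes w w' k A B :: real
  assumes k: "0 < k"
  shows "- ((w - w') * (max w 0 powr k * A\<^sup>2 - max w' 0 powr k * B\<^sup>2))
     \<le> 1 / min 1 k * (max w 0 powr (k + 1) + max w' 0 powr (k + 1)) * (A - B)\<^sup>2"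
proof -
  have *: "- ((w - w') * (max w 0 powr k * A\<^sup>2 - max w' 0 powr k * B\<^sup>2))
     \<le> 1 / min 1 k * (max w 0 powr (k + 1) + max w' 0 powr (k + 1)) * (A - B)\<^sup>2"
    if ww: "w' < w" for w w' A B :: real
  proof -
    have rhs: "0 \<le> 1 / min 1 k * (max w 0 powr (k + 1) + max w' 0 powr (k + 1)) * (A - B)\<^sup>2"
      using k by (intro mult_nonneg_nonneg) auto
    show ?thesis
    proof (cases "0 < w'")
      case False
      then have "0 \<le> (w - w') * (max w 0 powr k * A\<^sup>2 - max w' 0 powr k * B\<^sup>2)"
        using k ww by (simp add: max_def)
      then show ?thesis
        using rhs by linarith
    next
      case True
      then have w: "max w 0 = w" "max w' 0 = w'"
        using ww by auto
      have lt: "w' powr k < w powr k"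
        using True ww k by (simp add: powr_less_mono2)
      have "min 1 k * w powr (k - 1) * (w - w') * w \<le> (w powr k - w' powr k) * w"
        using powr_diff_ge[of k w' w] True ww k by (intro mult_right_mono) auto
      moreover have "w powr k = w powr (k - 1) * w"
        using True ww by (simp add: powr_diff)
      ultimately have "min 1 k * ((w - w') * w powr k) \<le> (w powr k - w' powr k) * w"
        by (simp add: mult_ac)
      then have gap: "(w - w') * w powr k / (w powr k - w' powr k) \<le> w / min 1 k"
        using lt k by (simp add: field_simps)
      have "- ((w - w') * (w powr k * A\<^sup>2 - w' powr k * B\<^sup>2))
        = (w - w') * (w' powr k * B\<^sup>2 - w powr k * A\<^sup>2)"
        by (simp add: algebra_simps)
      also have "\<dots> \<le> (w - w') * (w' powr k * w powr k / (w powr k - w' powr k) * (B - A)\<^sup>2)"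
        using quadratic_gap[OF _ lt, of B A] True ww by (intro mult_left_mono) auto
      also have "\<dots> = (w - w') * w powr k / (w powr k - w' powr k) * (w' powr k * (A - B)\<^sup>2)"
        by (simp add: power2_commute)
      also have "\<dots> \<le> w / min 1 k * (w' powr k * (A - B)\<^sup>2)"
        using gap by (intro mult_right_mono) auto
      also have "\<dots> \<le> w / min 1 k * (w powr k * (A - B)\<^sup>2)"
        using lt k True ww by (intro mult_left_mono mult_right_mono) auto
      also have "\<dots> = 1 / min 1 k * w powr (k + 1) * (A - B)\<^sup>2"
        using True ww by (simp add: powr_add)
      also have "\<dots> \<le> 1 / min 1 k * (w powr (k + 1) + w' powr (k + 1)) * (A - B)\<^sup>2"
        using k by (intro mult_right_mono mult_left_mono) auto
      finally show ?thesis
        unfolding w .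
    qed
  qed
  consider "w' < w" | "w < w'" | "w = w'" by linarith
  then show ?thesis
  proof cases
    case 2
    then show ?thesis
      using *[of w w' B A] by (simp add: algebra_simps power2_commute)
  next
    case 3
    then show ?thesis
      using k by simp
  qed (use * in auto)
qed

text \<open>Cauchy-Schwarz for the integral of z^(t-1) over [b, a]. The integral is avoided:
  \<open>\<phi>\<close> is an antiderivative of (l - z^(t-1))^2 with \<open>l\<close> the mean value
  of z^(t-1), and it is nondecreasing.\<close>

lemma powr_Cauchy_Schwarz:
  fixes a b t :: real
  assumes t: "1 / 2 < t" and ab: "0 < b" "b \<le> a"
  shows "(2 * t - 1) / t\<^sup>2 * (a powr t - b powr t)\<^sup>2 \<le> (a - b) * (a powr (2 * t - 1) - b powr (2 * t - 1))"
proof (cases "a = b")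
  case False
  then have lt: "b < a" using ab by simp
  define X where "X = (a powr t - b powr t) / t"
  define Y where "Y = (a powr (2 * t - 1) - b powr (2 * t - 1)) / (2 * t - 1)"
  define l where "l = X / (a - b)"
  define \<phi> where "\<phi> = (\<lambda>z. l\<^sup>2 * z - 2 * l * (z powr t / t) + z powr (2 * t - 1) / (2 * t - 1))"
  have "\<phi> b \<le> \<phi> a"
  proof (rule DERIV_nonneg_imp_nondecreasing[OF ab(2)])
    fix x assume x: "b \<le> x" "x \<le> a"
    have "(\<phi> has_real_derivative (l\<^sup>2 - 2 * l * x powr (t - 1) + x powr (2 * t - 2))) (at x)"
    proof -
      have d: "((\<lambda>z. z powr r / r) has_real_derivative x powr (r - 1)) (at x)" if "r \<noteq> 0" for r
        using DERIV_cdivide[OF has_real_derivative_powr[of x r], of r] x ab that by simp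
      show ?thesis
        unfolding \<phi>_def using d[of t] d[of "2 * t - 1"] t x ab
        by (auto intro!: derivative_eq_intros)
    qed
    moreover have "x powr (2 * t - 2) = (x powr (t - 1))\<^sup>2"
      using x ab by (simp add: power2_eq_square algebra_simps flip: powr_add)
    then have "l\<^sup>2 - 2 * l * x powr (t - 1) + x powr (2 * t - 2) = (l - x powr (t - 1))\<^sup>2"
      by (simp add: power2_eq_square algebra_simps)
    ultimately show "\<exists>y. (\<phi> has_real_derivative y) (at x) \<and> 0 \<le> y"
      by auto
  qed
  then have "0 \<le> l\<^sup>2 * (a - b) - 2 * l * X + Y"
    by (simp add: \<phi>_def X_def Y_def algebra_simps diff_divide_distrib)
  moreover have X: "X = l * (a - b)"
    using lt by (simp add: l_def)
  ultimately have "l\<^sup>2 * (a - b) \<le> Y"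
    by (simp add: power2_eq_square algebra_simps)
  then have "(a - b) * (l\<^sup>2 * (a - b)) \<le> (a - b) * Y"
    using lt by (intro mult_left_mono) auto
  then have "X\<^sup>2 \<le> (a - b) * Y"
    by (simp add: X power2_eq_square mult_ac)
  then have "(2 * t - 1) * X\<^sup>2 \<le> (2 * t - 1) * ((a - b) * Y)"
    using t by (intro mult_left_mono) auto
  then show ?thesis
    using t by (simp add: X_def Y_def power_divide)
qed auto

text \<open>By homogeneity a = 1 and b = \<tau> <= 1. For A = B this is
  \<open>powr_Cauchy_Schwarz\<close>; when A and B differ, the strict gap between \<kappa> and
  (2t-1)/t^2 absorbs the cross terms into a multiple of (A - B)^2.\<close>

lemma power_test_pointwise:
  fixes t \<kappa> :: real
  assumes t: "1 / 2 < t" and \<kappa>: "0 < \<kappa>" "\<kappa> < (2 * t - 1) / t\<^sup>2"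
  obtains C where "0 < C" "\<And>a b A B :: real. 0 < a \<Longrightarrow> 0 < b \<Longrightarrow>
     \<kappa> * (a powr t * A - b powr t * B)\<^sup>2
       - (a - b) * (a powr (2 * t - 1) * A\<^sup>2 - b powr (2 * t - 1) * B\<^sup>2)
     \<le> C * (a powr (2 * t) + b powr (2 * t)) * (A - B)\<^sup>2"
proof -
  define \<kappa>0 where "\<kappa>0 = (2 * t - 1) / t\<^sup>2"
  define m where "m = 1 / min 1 t"
  \<comment> \<open>The value comes from completing the square in \<open>D\<close>: (\<kappa>0 -
    \<kappa>) D^2 has to absorb 2(m + \<kappa>) D|e|, and \<kappa> e^2 remains.\<close>
  define C where "C = \<kappa> + (m + \<kappa>)\<^sup>2 / (\<kappa>0 - \<kappa>)"
  have gap: "0 < \<kappa>0 - \<kappa>"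
    using \<kappa> by (simp add: \<kappa>0_def)
  have m: "0 < m"
    using t by (simp add: m_def)
  have C: "0 < C"
    unfolding C_def using \<kappa> gap by (intro add_pos_nonneg) auto
  have unit: "\<kappa> * (A - \<tau> powr t * B)\<^sup>2 - (1 - \<tau>) * (A\<^sup>2 - \<tau> powr (2 * t - 1) * B\<^sup>2) \<le> C * (A - B)\<^sup>2"
    if \<tau>: "0 < \<tau>" "\<tau> \<le> 1" for \<tau> A B :: real
  proof -
    define e where "e = A - B"
    define E where "E = 1 - \<tau> powr t"
    define D where "D = E * \<bar>B\<bar>"
    have E0: "0 \<le> E"
      using \<tau> t by (simp add: E_def powr_le1)
    have A: "A = B + e"
      by (simp add: e_def)
    have cs: "\<kappa>0 * E\<^sup>2 \<le> (1 - \<tau>) * (1 - \<tau> powr (2 * t - 1))"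
      using powr_Cauchy_Schwarz[OF t \<tau>] by (simp add: \<kappa>0_def E_def)
    have "min 1 t * (1 - \<tau>) \<le> E"
      using powr_diff_ge[of t \<tau> 1] \<tau> t by (simp add: E_def)
    then have mE: "1 - \<tau> \<le> m * E"
      using t by (simp add: m_def field_simps)
    have "(1 - \<tau>) * (A\<^sup>2 - \<tau> powr (2 * t - 1) * B\<^sup>2)
      = (1 - \<tau>) * (1 - \<tau> powr (2 * t - 1)) * B\<^sup>2 + 2 * (1 - \<tau>) * (B * e) + (1 - \<tau>) * e\<^sup>2"
      by (simp add: A power2_eq_square algebra_simps)
    moreover have "\<kappa>0 * E\<^sup>2 * B\<^sup>2 \<le> (1 - \<tau>) * (1 - \<tau> powr (2 * t - 1)) * B\<^sup>2"
      using cs by (intro mult_right_mono) auto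
    moreover have "\<kappa>0 * E\<^sup>2 * B\<^sup>2 = \<kappa>0 * D\<^sup>2"
      by (simp add: D_def power_mult_distrib)
    moreover have "- (2 * (1 - \<tau>) * (B * e)) \<le> 2 * m * D * \<bar>e\<bar>"
    proof -
      have "- (2 * (1 - \<tau>) * (B * e)) = (1 - \<tau>) * (2 * - (B * e))"
        by (simp add: algebra_simps)
      also have "\<dots> \<le> (1 - \<tau>) * (2 * (\<bar>B\<bar> * \<bar>e\<bar>))"
        using \<tau> by (intro mult_left_mono) (auto simp flip: abs_mult)
      also have "\<dots> \<le> m * E * (2 * (\<bar>B\<bar> * \<bar>e\<bar>))"
        using mE by (intro mult_right_mono) auto
      finally show ?thesis
        by (simp add: D_def mult_ac)
    qed
    moreover have "0 \<le> (1 - \<tau>) * e\<^sup>2"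
      using \<tau> by simp
    ultimately have lower: "\<kappa>0 * D\<^sup>2 - 2 * m * D * \<bar>e\<bar> \<le> (1 - \<tau>) * (A\<^sup>2 - \<tau> powr (2 * t - 1) * B\<^sup>2)"
      by linarith
    have "(A - \<tau> powr t * B)\<^sup>2 = (E * B + e)\<^sup>2"
      by (simp add: A E_def algebra_simps)
    also have "\<dots> = \<bar>E * B + e\<bar>\<^sup>2"
      by simp
    also have "\<dots> \<le> (D + \<bar>e\<bar>)\<^sup>2"
      using abs_triangle_ineq[of "E * B" e] E0 by (intro power_mono) (auto simp: D_def abs_mult)
    finally have upper: "\<kappa> * (A - \<tau> powr t * B)\<^sup>2 \<le> \<kappa> * (D + \<bar>e\<bar>)\<^sup>2"
      using \<kappa> by (intro mult_left_mono) auto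
    have "0 \<le> ((\<kappa>0 - \<kappa>) * D - (m + \<kappa>) * \<bar>e\<bar>)\<^sup>2 / (\<kappa>0 - \<kappa>)"
      using gap by simp
    also have "\<dots> = (\<kappa>0 - \<kappa>) * D\<^sup>2 - 2 * (m + \<kappa>) * D * \<bar>e\<bar> + (m + \<kappa>)\<^sup>2 / (\<kappa>0 - \<kappa>) * \<bar>e\<bar>\<^sup>2"
      using gap by (simp add: field_simps power2_eq_square)
    finally have "\<kappa> * (D + \<bar>e\<bar>)\<^sup>2 - (\<kappa>0 * D\<^sup>2 - 2 * m * D * \<bar>e\<bar>) \<le> C * \<bar>e\<bar>\<^sup>2"
      by (simp add: C_def power2_eq_square algebra_simps)
    then show ?thesis
      using lower upper by (simp add: e_def)
  qed
  have ordered: "\<kappa> * (a powr t * A - b powr t * B)\<^sup>2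
       - (a - b) * (a powr (2 * t - 1) * A\<^sup>2 - b powr (2 * t - 1) * B\<^sup>2)
     \<le> C * (a powr (2 * t) + b powr (2 * t)) * (A - B)\<^sup>2"
    if "0 < b" "b \<le> a" for a b A B :: real
  proof -
    define \<tau> where "\<tau> = b / a"
    have \<tau>: "0 < \<tau>" "\<tau> \<le> 1" and b: "b = a * \<tau>"
      using that by (auto simp: \<tau>_def)
    have a: "0 < a" using that by simp
    have e1: "a powr (2 * t) = (a powr t)\<^sup>2"
      by (simp add: power2_eq_square flip: powr_add)
    have e2: "a powr (2 * t) = a * a powr (2 * t - 1)"
      using a by (simp add: powr_diff)
    have "\<kappa> * (a powr t * A - b powr t * B)\<^sup>2
        - (a - b) * (a powr (2 * t - 1) * A\<^sup>2 - b powr (2 * t - 1) * B\<^sup>2)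
      = a powr (2 * t) * (\<kappa> * (A - \<tau> powr t * B)\<^sup>2)
        - (a * a powr (2 * t - 1)) * ((1 - \<tau>) * (A\<^sup>2 - \<tau> powr (2 * t - 1) * B\<^sup>2))"
      unfolding e1 b using a \<tau> by (simp add: powr_mult power2_eq_square algebra_simps)
    also have "\<dots> = a powr (2 * t) * (\<kappa> * (A - \<tau> powr t * B)\<^sup>2 - (1 - \<tau>) * (A\<^sup>2 - \<tau> powr (2 * t - 1) * B\<^sup>2))"
      unfolding e2 by (simp add: algebra_simps)
    also have "\<dots> \<le> a powr (2 * t) * (C * (A - B)\<^sup>2)"
      using unit[OF \<tau>] by (intro mult_left_mono) auto
    also have "\<dots> \<le> C * (a powr (2 * t) + b powr (2 * t)) * (A - B)\<^sup>2"
      using C by (simp add: algebra_simps)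
    finally show ?thesis .
  qed
  show ?thesis
  proof (rule that[OF C])
    fix a b A B :: real
    assume "0 < a" "0 < b"
    then show "\<kappa> * (a powr t * A - b powr t * B)\<^sup>2
       - (a - b) * (a powr (2 * t - 1) * A\<^sup>2 - b powr (2 * t - 1) * B\<^sup>2)
     \<le> C * (a powr (2 * t) + b powr (2 * t)) * (A - B)\<^sup>2"
      using ordered[of b a A B] ordered[of a b B A]
      by (cases "b \<le> a") (simp_all add: algebra_simps power2_commute)
  qed
qed

section \<open>Stable solutions of the system\<close>

text \<open>This is the entry point of all integrability arguments: a negative power as multiplier
  needs only the first power of \<open>z\<close> against the weight and yields information on the
  right-hand side \<open>g\<close>.\<close>

lemma neg_power_weighted_bound:
  fixes z g :: "'a::euclidean_space \<Rightarrow> real"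
  assumes s: "0 < s" "s < 1" and z: "frac_sol s z g" "\<And>x. 0 < z x" "\<And>x. 0 \<le> g x"
    and \<gamma>: "0 < \<gamma>" "\<gamma> < 1"
  shows "weighted_bound s (\<lambda>x. g x * z x powr - \<gamma>) (\<lambda>x. 1 / \<gamma> * z x powr (1 - \<gamma>))"
proof (rule frac_sol_weighted_bound[OF s, where L = "[(z, g, \<lambda>x. z x powr - \<gamma>)]"])
  have zc: "continuous_on UNIV z" and gc: "continuous_on UNIV g"
    using z(1) frac_sol_continuous by (auto simp: frac_sol_def)
  have nz: "z x \<noteq> 0" and z0: "0 \<le> z x" for x using z(2)[of x] by simp_all
  have [measurable]: "z \<in> borel_measurable borel" "g \<in> borel_measurable borel"
    using zc gc by (auto intro: borel_measurable_continuous_onI)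
  show "(\<lambda>x. g x * z x powr - \<gamma>) \<in> borel_measurable borel" "(\<lambda>x. 1 / \<gamma> * z x powr (1 - \<gamma>)) \<in> borel_measurable borel"
    by measurable
  have "integrable lborel (\<lambda>x. z x powr 1 * weight s 1 x)"
    using L_spaceD(2)[of z s] z(1) z0 by (simp add: frac_sol_def)
  then have "integrable lborel (\<lambda>x. z x powr (1 - \<gamma>) * weight s 1 x)"
    by (rule integrable_weight_powr_mono[OF s(1), rotated 2]) (use z0 \<gamma> in simp_all)
  then show "integrable lborel (\<lambda>x. 1 / \<gamma> * z x powr (1 - \<gamma>) * weight s 1 x)"
    by (simp add: mult.assoc)
  fix u g' F assume "(u, g', F) \<in> set [(z, g, \<lambda>x. z x powr - \<gamma>)]"
  then show "frac_sol s u g' \<and> continuous_on UNIV F"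
    using z(1) zc nz by (auto intro!: continuous_intros)
next
  fix x y :: 'a and A B :: real
  show "(\<Sum>(u, g, F)\<leftarrow>[(z, g, \<lambda>x. z x powr - \<gamma>)]. (u x - u y) * (F x * A\<^sup>2 - F y * B\<^sup>2))
      \<le> (1 / \<gamma> * z x powr (1 - \<gamma>) + 1 / \<gamma> * z y powr (1 - \<gamma>)) * (A - B)\<^sup>2"
    using neg_power_test_pointwise[OF z(2) z(2) \<gamma>, of x y A B] by (simp add: algebra_simps)
qed (use z(3) \<gamma> in simp_all)

text \<open>Tangent line of a concave power. Integrated against the kernel it would say that the
  fractional Laplacian of u^a is at least a u^(a-1) times that of u.\<close>

lemma concave_powr_tangent:
  fixes a x y :: real
  assumes a: "0 < a" "a \<le> 1" and xy: "0 < x" "0 < y"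
  shows "a * x powr (a - 1) * (x - y) \<le> x powr a - y powr a"
proof -
  define \<phi> where "\<phi> = (\<lambda>z. a * x powr (a - 1) * z - z powr a)"
  have der: "(\<phi> has_real_derivative a * (x powr (a - 1) - z powr (a - 1))) (at z)" if "0 < z" for z
  proof -
    have "(\<phi> has_real_derivative a * x powr (a - 1) * 1 - a * z powr (a - 1)) (at z)"
      unfolding \<phi>_def by (intro DERIV_diff DERIV_cmult DERIV_ident has_real_derivative_powr that)
    then show ?thesis by (simp add: algebra_simps)
  qed
  have "\<phi> x \<le> \<phi> y"
  proof (cases "y \<le> x")
    case True
    show ?thesis
    proof (rule DERIV_nonpos_imp_nonincreasing[OF True])
      fix z assume z: "y \<le> z" "z \<le> x"
      then have "x powr (a - 1) \<le> z powr (a - 1)"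
        using a xy by (intro powr_mono2') auto
      then have "a * (x powr (a - 1) - z powr (a - 1)) \<le> 0"
        using a by (simp add: mult_le_0_iff)
      then show "\<exists>d. (\<phi> has_real_derivative d) (at z) \<and> d \<le> 0"
        using der[of z] z xy by auto
    qed
  next
    case False
    then have "x \<le> y" by simp
    then show ?thesis
    proof (rule DERIV_nonneg_imp_nondecreasing)
      fix z assume z: "x \<le> z" "z \<le> y"
      then have "z powr (a - 1) \<le> x powr (a - 1)"
        using a xy by (intro powr_mono2') auto
      then have "0 \<le> a * (x powr (a - 1) - z powr (a - 1))"
        using a by simp
      then show "\<exists>d. (\<phi> has_real_derivative d) (at z) \<and> 0 \<le> d"
        using der[of z] z xy by auto
    qed
  qed
  then show ?thesis
    by (simp add: \<phi>_def algebra_simps)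
qed

lemma powr_diff_le_tangent:
  fixes p v z :: real
  assumes p: "1 \<le> p" and "0 \<le> z" "z \<le> v" "0 < v"
  shows "v powr (p - 1) * (v - z) \<le> v powr p - z powr p"
  using powr_diff_ge[of p z v] assms by (simp add: min_def)

section \<open>The system with q <= p: scaling exponents and the comparison of v with u\<close>

locale lane_emden =
  fixes s p q :: real and u v :: "'a::euclidean_space \<Rightarrow> real"
  assumes s: "0 < s" "s < 1" and pq: "q \<le> p" "1 < q"
    and u: "frac_sol s u (\<lambda>x. v x powr p)" "\<And>x. 0 < u x"
    and v: "frac_sol s v (\<lambda>x. u x powr q)" "\<And>x. 0 < v x"
begin

text \<open>Under the scaling of the system u has homogeneity 2s(p+1)/(pq-1) and v has
  2s(q+1)/(pq-1), so v scales like u^a. The ordering q <= p makes this power concave.\<close>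

definition a where "a = (q + 1) / (p + 1)"
text \<open>Normalized by a l^(p+1) = 1, which makes the two nonlinear terms cancel exactly where v
  = l u^a.\<close>

definition l where "l = a powr (- 1 / (p + 1))"
text \<open>The gain of exponent for powers of \<open>u\<close>: it equals q - a, and 2s/b is the
  scaling exponent of \<open>u\<close>.\<close>

definition b where "b = (p * q - 1) / (p + 1)"

lemma p: "1 < p" using pq by simp

lemma a: "0 < a" "a \<le> 1"
  using pq by (auto simp: a_def)

lemma l: "0 < l" "a * l powr (p + 1) = 1"
proof -
  show "0 < l" using a by (simp add: l_def)
  have "l powr (p + 1) = a powr - 1"
    unfolding l_def powr_powr using p by simp
  then show "a * l powr (p + 1) = 1"
    using a by (simp add: powr_minus_divide)
qed

lemma q_minus_a: "q - a = b"
  using p by (simp add: a_def b_def field_simps)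

lemma pq_gt_1: "1 < p * q"
  using p pq by (simp add: less_1_mult)

lemma b: "0 < b"
  using pq_gt_1 p by (simp add: b_def)

lemma cont [continuous_intros]: "continuous_on UNIV u" "continuous_on UNIV v"
  using u v frac_sol_continuous by auto

lemma nonzero [simp]: "u x \<noteq> 0" "v x \<noteq> 0" "0 \<le> u x" "0 \<le> v x"
  using u(2)[of x] v(2)[of x] by auto

lemma meas [measurable]: "u \<in> borel_measurable borel" "v \<in> borel_measurable borel"
  using cont by (auto intro: borel_measurable_continuous_onI)

lemma integrable_base: "integrable lborel (\<lambda>x. u x powr 1 * weight s 1 x)" "integrable lborel (\<lambda>x. v x powr 1 * weight s 1 x)"
  using L_spaceD(2)[of u s] L_spaceD(2)[of v s] u v by (simp_all add: frac_sol_def)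

text \<open>The test of the comparison function with h^k, k > 0, needs an exponent k + 1 above 1,
  whereas \<open>L_space\<close> gives only 1. The gap is closed by interpolating between v^p
  u^(-\<gamma>), obtained from the first equation, and u.\<close>

lemma integrable_v_above_1:
  obtains r where "1 < r" "integrable lborel (\<lambda>x. v x powr r * weight s 1 x)"
proof -
  define \<gamma> where "\<gamma> = min (1 / 2) ((p - 1) / 2)"
  have "\<gamma> \<le> (p - 1) / 2" unfolding \<gamma>_def by (rule min.cobounded2)
  then have \<gamma>: "0 < \<gamma>" "\<gamma> < 1" "1 + \<gamma> < p"
    using p by (auto simp: \<gamma>_def)
  \<comment> \<open>The choice makes \<gamma>\<theta> = 1 - \<theta>, so that u disappears from the
    geometric mean; 1 + \<gamma> < p then says that the remaining exponent p\<theta> of v exceeds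
    1.\<close>
  define \<theta> where "\<theta> = 1 / (1 + \<gamma>)"
  have \<theta>: "0 < \<theta>" "\<theta> < 1" "\<gamma> * \<theta> = 1 - \<theta>"
    using \<gamma> by (auto simp: \<theta>_def field_simps)
  have int: "integrable lborel (\<lambda>x. v x powr p * u x powr - \<gamma> * weight s 1 x)"
    using weighted_bound_integrable[OF neg_power_weighted_bound[OF s u _ \<gamma>(1,2)]] by simp
  have "integrable lborel (\<lambda>x. (v x powr p * u x powr - \<gamma> + u x) * weight s 1 x)"
    using Bochner_Integration.integrable_add[OF int integrable_base(1)] by (simp add: algebra_simps)
  then have "integrable lborel (\<lambda>x. v x powr (p * \<theta>) * weight s 1 x)"
  proof (rule integrable_weight_mono)
    fix x
    define X where "X = v x powr p * u x powr - \<gamma>"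
    have X: "0 < X" using u(2)[of x] v(2)[of x] by (simp add: X_def)
    have "X powr \<theta> * u x powr (1 - \<theta>) = v x powr (p * \<theta>) * (u x powr (- \<gamma> * \<theta>) * u x powr (1 - \<theta>))"
      using u(2)[of x] v(2)[of x] by (simp add: X_def powr_mult powr_powr)
    also have "u x powr (- \<gamma> * \<theta>) * u x powr (1 - \<theta>) = 1"
      using \<theta>(3) u(2)[of x] by (simp flip: powr_add)
    finally have "v x powr (p * \<theta>) = X powr \<theta> * u x powr (1 - \<theta>)" by simp
    also have "\<dots> \<le> max X (u x) powr \<theta> * max X (u x) powr (1 - \<theta>)"
      using X u(2)[of x] \<theta> by (intro mult_mono powr_mono2) auto
    also have "\<dots> = max X (u x)"
      using X by (simp add: max_def flip: powr_add)
    also have "\<dots> \<le> X + u x"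
      using X u(2)[of x] by simp
    finally show "v x powr (p * \<theta>) \<le> v x powr p * u x powr - \<gamma> + u x"
      by (simp add: X_def)
  qed auto
  moreover have "1 < p * \<theta>"
    using \<gamma> by (simp add: \<theta>_def)
  ultimately show ?thesis
    using that by blast
qed

definition h where "h x = max (v x - l * u x powr a) 0"

lemma h_cont [continuous_intros]: "continuous_on UNIV h"
  unfolding h_def by (intro continuous_intros) simp

lemma h_nonneg [simp]: "0 \<le> h x"
  by (simp add: h_def)

lemma h_meas [measurable]: "h \<in> borel_measurable borel"
  using h_cont by (rule borel_measurable_continuous_onI)

lemma h_le: "h x \<le> v x"
  using l by (simp add: h_def)

text \<open>Counterpart of \<open>b\<close> for the second unknown: 2s/e is the scaling exponent of
  \<open>v\<close>. It also equals (a - 1)/a + (p - 1), the form in which it arises in the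
  absorption estimate.\<close>

definition e where "e = (p * q - 1) / (q + 1)"

lemma e: "0 < e" using pq_gt_1 pq by (simp add: e_def)

text \<open>On \<open>{h > 0}\<close> the function \<open>v - l u\<^sup>a\<close> satisfies a differential inequality with superlinear absorption.\<close>

lemma h_absorption:
  assumes k: "0 < k"
  shows "l * a * l powr ((1 - a) / a) * h x powr (k + 1 + e)
     \<le> h x powr k * (l * a * u x powr (a - 1) * v x powr p - u x powr q)"
proof (cases "h x = 0")
  case True
  then show ?thesis using k e by simp
next
  case False
  define z where "z = l * u x powr a"
  have hz: "h x = v x - z" "z < v x"
    using False by (auto simp: h_def z_def max_def split: if_splits)
  have z: "0 < z" using l u(2)[of x] by (simp add: z_def)
  have uz: "u x = (z / l) powr (1 / a)"
    using l a by (simp add: z_def powr_powr)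
  \<comment> \<open>Since a <= 1 the exponent (a - 1)/a is nonpositive, so z < v turns into a lower
    bound for u^(a-1) by a power of v.\<close>
  have "(v x / l) powr ((a - 1) / a) \<le> (z / l) powr ((a - 1) / a)"
    using hz z l a by (intro powr_mono2') (auto simp: divide_nonpos_pos divide_right_mono)
  also have "\<dots> = u x powr (a - 1)"
    unfolding uz by (simp add: powr_powr)
  finally have ua: "v x powr ((a - 1) / a) * l powr ((1 - a) / a) \<le> u x powr (a - 1)"
  proof -
    assume "(v x / l) powr ((a - 1) / a) \<le> u x powr (a - 1)"
    moreover have "(1 - a) / a = - ((a - 1) / a)"
      by (metis minus_diff_eq minus_divide_left)
    then have "(v x / l) powr ((a - 1) / a) = v x powr ((a - 1) / a) * l powr ((1 - a) / a)"
      using l by (simp only: powr_minus_divide) (simp add: powr_divide)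
    ultimately show ?thesis by simp
  qed
  have "u x powr q = u x powr (a - 1) * (u x powr a) powr p"
  proof -
    have "a * (p + 1) = q + 1" using p by (simp add: a_def)
    then have "q = (a - 1) + a * p" by (simp add: algebra_simps)
    then have "u x powr q = u x powr ((a - 1) + a * p)" by (rule arg_cong)
    then show ?thesis by (simp add: powr_add powr_powr)
  qed
  \<comment> \<open>Here the normalization of \<open>l\<close> enters: u^q becomes the same
    expression as the first term with v replaced by z, and the difference is governed by v^p -
    z^p.\<close>
  also have "\<dots> = l * a * u x powr (a - 1) * z powr p"
  proof -
    have "l * a * l powr p = 1"
      using l by (simp add: powr_add mult_ac)
    moreover have "z powr p = l powr p * (u x powr a) powr p"
      using l by (simp add: z_def powr_mult)
    ultimately have "l * a * z powr p = (u x powr a) powr p"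
      by (simp only: mult.assoc[symmetric] mult_1)
    then have "u x powr (a - 1) * (l * a * z powr p) = u x powr (a - 1) * (u x powr a) powr p"
      by (rule arg_cong)
    then show ?thesis
      by (simp only: mult_ac)
  qed
  finally have "l * a * u x powr (a - 1) * v x powr p - u x powr q = l * a * u x powr (a - 1) * (v x powr p - z powr p)"
    by (simp add: algebra_simps)
  also have "\<dots> \<ge> l * a * u x powr (a - 1) * (v x powr (p - 1) * (v x - z))"
    using l a p z hz by (intro mult_left_mono powr_diff_le_tangent) auto
  finally have 1: "l * a * u x powr (a - 1) * (v x powr (p - 1) * h x) \<le> l * a * u x powr (a - 1) * v x powr p - u x powr q"
    by (simp add: hz)
  have "h x powr (1 + e) = h x powr e * h x"
    using False by (simp add: powr_add less_le)
  also have "\<dots> \<le> v x powr e * h x"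
    using e h_le by (intro mult_right_mono powr_mono2) auto
  also have "v x powr e = v x powr ((a - 1) / a) * v x powr (p - 1)"
  proof -
    have "(a - 1) / a = 1 - (p + 1) / (q + 1)"
    proof -
      have "(a - 1) / a = 1 - 1 / a" using a by (simp add: diff_divide_distrib)
      then show ?thesis by (simp add: a_def)
    qed
    moreover have "e = 1 - (p + 1) / (q + 1) + (p - 1)"
      using pq by (simp add: e_def field_simps)
    ultimately have "e = (a - 1) / a + (p - 1)" by simp
    then show ?thesis by (simp add: powr_add)
  qed
  finally have 2: "h x powr (1 + e) \<le> v x powr ((a - 1) / a) * v x powr (p - 1) * h x" .
  have "l * a * l powr ((1 - a) / a) * h x powr (1 + e)
      \<le> l * a * l powr ((1 - a) / a) * (v x powr ((a - 1) / a) * v x powr (p - 1) * h x)"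
    using 2 l a by (intro mult_left_mono) auto
  also have "\<dots> = l * a * (v x powr ((a - 1) / a) * l powr ((1 - a) / a)) * (v x powr (p - 1) * h x)"
    by (simp add: mult_ac)
  also have "\<dots> \<le> l * a * u x powr (a - 1) * (v x powr (p - 1) * h x)"
    using ua l a by (intro mult_right_mono mult_left_mono) auto
  also note 1
  finally have "h x powr k * (l * a * l powr ((1 - a) / a) * h x powr (1 + e))
     \<le> h x powr k * (l * a * u x powr (a - 1) * v x powr p - u x powr q)"
    by (intro mult_left_mono) auto
  moreover have "h x powr (k + 1 + e) = h x powr k * h x powr (1 + e)"
    by (simp add: powr_add[symmetric] add.assoc)
  ultimately show ?thesis
    by (simp add: mult_ac)
qed

text \<open>The power u^a is never treated as a solution. The first equation is tested with l a
  u^(a-1) h^k and the second with -h^k; the tangent inequality, applied once at x and once at y,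
  replaces the increments of u by those of u^a. What is left is the positive-part estimate for v - l
  u^a.\<close>

lemma h_weighted_bound:
  assumes k: "0 < k" and int: "integrable lborel (\<lambda>x. h x powr (k + 1) * weight s 1 x)"
  shows "weighted_bound s (\<lambda>x. h x powr (k + 1 + e)) (\<lambda>x. h x powr (k + 1))"
proof -
  define c where "c = l * a * l powr ((1 - a) / a)"
  have c: "0 < c" using l a by (simp add: c_def)
  define d where "d = 1 / min 1 k"
  have d: "0 < d" using k by (simp add: d_def)
  define L where "L = [(v, \<lambda>x. u x powr q, \<lambda>x. - (h x powr k)),
    (u, \<lambda>x. v x powr p, \<lambda>x. l * a * u x powr (a - 1) * h x powr k)]"
  have "continuous_on UNIV (\<lambda>x. h x powr k)"
    using k by (intro continuous_on_powr' continuous_intros) auto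
  note hk = this
  have "weighted_bound s (\<lambda>x. c * h x powr (k + 1 + e)) (\<lambda>x. d * h x powr (k + 1))"
  proof (rule frac_sol_weighted_bound[OF s, where L = L])
    fix u' g F assume "(u', g, F) \<in> set L"
    then show "frac_sol s u' g \<and> continuous_on UNIV F"
      using u v by (auto simp: L_def intro!: continuous_intros hk)
  next
    fix x
    show "c * h x powr (k + 1 + e) \<le> (\<Sum>(u, g, F)\<leftarrow>L. F x * g x)"
      using h_absorption[OF k, of x] by (simp add: L_def c_def algebra_simps)
  next
    fix x y :: 'a and A B :: real
    define w where "w = (\<lambda>x. v x - l * u x powr a)"
    have hw: "h x = max (w x) 0" for x by (simp add: h_def w_def)
    define f where "f = h x powr k * A\<^sup>2"
    define f' where "f' = h y powr k * B\<^sup>2"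
    have f: "0 \<le> f" "0 \<le> f'" by (auto simp: f_def f'_def)
    have t1: "a * u x powr (a - 1) * (u x - u y) * (l * f) \<le> (u x powr a - u y powr a) * (l * f)"
      using f l by (intro mult_right_mono concave_powr_tangent a u) auto
    have t2: "a * u y powr (a - 1) * (u y - u x) * (l * f') \<le> (u y powr a - u x powr a) * (l * f')"
      using f l by (intro mult_right_mono concave_powr_tangent a u) auto
    have "(\<Sum>(u, g, F)\<leftarrow>L. (u x - u y) * (F x * A\<^sup>2 - F y * B\<^sup>2))
      = - ((v x - v y) * (f - f')) + a * u x powr (a - 1) * (u x - u y) * (l * f)
        + a * u y powr (a - 1) * (u y - u x) * (l * f')"
      by (simp add: L_def f_def f'_def algebra_simps)
    also have "\<dots> \<le> - ((v x - v y) * (f - f')) + (u x powr a - u y powr a) * (l * f)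
        + (u y powr a - u x powr a) * (l * f')"
      using t1 t2 by linarith
    also have "\<dots> = - ((w x - w y) * (f - f'))"
      by (simp add: w_def algebra_simps)
    also have "\<dots> \<le> d * (h x powr (k + 1) + h y powr (k + 1)) * (A - B)\<^sup>2"
      unfolding f_def f'_def hw d_def by (rule pos_part_test_pointwise[OF k])
    finally show "(\<Sum>(u, g, F)\<leftarrow>L. (u x - u y) * (F x * A\<^sup>2 - F y * B\<^sup>2))
      \<le> (d * h x powr (k + 1) + d * h y powr (k + 1)) * (A - B)\<^sup>2"
      by (simp add: algebra_simps)
  qed (use c d int in \<open>auto simp: mult.assoc\<close>)
  then show ?thesis
    by (rule weighted_bound_mono[OF s(1), where c = "1 / c" and d = d]) (use c d int in auto)
qed

text \<open>Each application of \<open>h_weighted_bound\<close> raises the integrable exponent by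
  \<open>e\<close>. The number of steps is free, and the admissible dimension in
  \<open>weighted_bound_imp_zero\<close> grows with the exponent, so the comparison holds in every
  dimension.\<close>

lemma comparison: "v x \<le> l * u x powr a"
proof -
  obtain r where r: "1 < r" "integrable lborel (\<lambda>x. v x powr r * weight s 1 x)"
    using integrable_v_above_1 by blast
  have int: "integrable lborel (\<lambda>x. h x powr (r + real n * e) * weight s 1 x)" for n
  proof (induction n)
    case 0
    have "integrable lborel (\<lambda>x. h x powr r * weight s 1 x)"
      using r h_le by (intro integrable_weight_mono[OF r(2)]) (auto intro!: powr_mono2)
    then show ?case by simp
  next
    case (Suc n)
    have "0 \<le> real n * e" using e by simp
    then have "0 < r + real n * e - 1" using r(1) by linarith
    then have "weighted_bound s (\<lambda>x. h x powr (r + real n * e - 1 + 1 + e)) (\<lambda>x. h x powr (r + real n * e - 1 + 1))"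
      by (rule h_weighted_bound) (use Suc in simp)
    from weighted_bound_integrable[OF this] show ?case
      by (simp add: algebra_simps)
  qed
  obtain n where n: "real DIM('a) / (2 * s) < real n"
    using reals_Archimedean2 by blast
  define t where "t = r + real n * e"
  have "0 \<le> real n * e" using e by simp
  then have t: "1 < t" using r(1) unfolding t_def by linarith
  have "h x = 0"
  proof (rule weighted_bound_imp_zero[OF s(1) h_cont h_nonneg _ e])
    have "weighted_bound s (\<lambda>x. h x powr (t - 1 + 1 + e)) (\<lambda>x. h x powr (t - 1 + 1))"
      using t int[of n] by (intro h_weighted_bound) (auto simp: t_def)
    then show "weighted_bound s (\<lambda>x. h x powr (t + e)) (\<lambda>x. h x powr t)"
      by simp
    show "integrable lborel (\<lambda>x. h x powr t * weight s 1 x)"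
      using int[of n] by (simp add: t_def)
    have "real DIM('a) < 2 * s * real n"
      using n s by (simp add: field_simps)
    also have "\<dots> \<le> 2 * s * ((t + e) / e)"
      using s e r by (intro mult_left_mono) (auto simp: t_def field_simps)
    finally show "real DIM('a) < 2 * s * (t + e) / e" by simp
  qed (use t in simp)
  then show ?thesis by (simp add: h_def max_def split: if_splits)
qed

end

section \<open>Consequences of the comparison, stability and the bootstrap\<close>

context lane_emden
begin

text \<open>Testing the second equation with v^(-\<gamma>) controls u^q v^(-\<gamma>); the
  comparison bounds it below by a multiple of u^(q - a\<gamma>), and \<gamma> may be taken
  small.\<close>

lemma integrable_u_below_q:
  assumes r: "0 \<le> r" "r < q"
  shows "integrable lborel (\<lambda>x. u x powr r * weight s 1 x)"
proof -
  define \<gamma> where "\<gamma> = min (1 / 2) (q - r)"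
  have \<gamma>: "0 < \<gamma>" "\<gamma> < 1" "\<gamma> \<le> q - r"
    using r by (auto simp: \<gamma>_def)
  have "a * \<gamma> \<le> 1 * \<gamma>"
    using a \<gamma> by (intro mult_right_mono) auto
  with \<gamma> have r': "r \<le> q - a * \<gamma>" by linarith
  have int: "integrable lborel (\<lambda>x. u x powr q * v x powr - \<gamma> * weight s 1 x)"
    using weighted_bound_integrable[OF neg_power_weighted_bound[OF s v _ \<gamma>(1,2)]] by simp
  then have "integrable lborel (\<lambda>x. (l powr \<gamma> * (u x powr q * v x powr - \<gamma>)) * weight s 1 x)"
    by (simp add: mult.assoc)
  then have "integrable lborel (\<lambda>x. u x powr (q - a * \<gamma>) * weight s 1 x)"
  proof (rule integrable_weight_mono)
    fix x
    have "(l * u x powr a) powr - \<gamma> \<le> v x powr - \<gamma>"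
      using comparison[of x] v(2)[of x] \<gamma> by (intro powr_mono2') auto
    moreover have "(l * u x powr a) powr - \<gamma> = l powr - \<gamma> * u x powr (- a * \<gamma>)"
      using l by (simp add: powr_mult powr_powr)
    ultimately have "l powr \<gamma> * (u x powr q * (l powr - \<gamma> * u x powr (- a * \<gamma>))) \<le> l powr \<gamma> * (u x powr q * v x powr - \<gamma>)"
      by (intro mult_left_mono) auto
    moreover have "l powr \<gamma> * (u x powr q * (l powr - \<gamma> * u x powr (- a * \<gamma>))) = u x powr (q - a * \<gamma>)"
      using l by (simp add: powr_minus powr_diff field_simps)
    ultimately show "u x powr (q - a * \<gamma>) \<le> l powr \<gamma> * (u x powr q * v x powr - \<gamma>)"
      by simp
  qed auto
  then show ?thesis
    by (rule integrable_weight_powr_mono[OF s(1), rotated 2]) (use r r' in auto)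
qed

definition T where "T = sqrt (p * q * (q + 1) / (p + 1))"

lemma T_sq: "T\<^sup>2 = p * q * a"
proof -
  have "0 \<le> p * q * (q + 1) / (p + 1)" using p pq by simp
  then show ?thesis
    by (simp add: T_def a_def)
qed

lemma T_ge_q: "q \<le> T"
proof (rule power2_le_imp_le)
  have "q \<le> p * a"
    using p pq by (simp add: a_def field_simps)
  then have "q * q \<le> q * (p * a)"
    using pq by (intro mult_left_mono) auto
  then show "q\<^sup>2 \<le> T\<^sup>2"
    unfolding T_sq by (simp add: power2_eq_square mult_ac)
  show "0 \<le> T" using p pq by (simp add: T_def)
qed

lemma T_gt_1: "1 < T"
  using T_ge_q pq by simp

text \<open>AM--GM removes the two stability weights; the resulting term dominates the right-hand side
  \<open>v\<^sup>p\<close> of the first equation by the comparison.\<close>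

lemma stability_potential:
  fixes x :: 'a and z1 z2 :: real
  assumes z: "0 < z1" "0 < z2"
  shows "u x powr - 1 * v x powr p
    \<le> 1 / (2 * T) * (p * v x powr (p - 1) * z2 / z1 + q * u x powr (q - 1) * z1 / z2)"
proof -
  define P where "P = p * v x powr (p - 1) * z2 / z1"
  define Q where "Q = q * u x powr (q - 1) * z1 / z2"
  have PQ: "0 \<le> P" "0 \<le> Q" using z p pq by (auto simp: P_def Q_def)
  define Y where "Y = u x powr - 1 * v x powr p"
  have Y0: "0 \<le> Y" by (simp add: Y_def)
  \<comment> \<open>In the product \<open>P * Q\<close> the ratio of the stability weights cancels.
    The comparison is used once, for v^(p+1), and its constant is cancelled exactly by the factor
    \<open>a\<close> in T^2 = pqa.\<close>
  have "(T * Y)\<^sup>2 \<le> P * Q"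
  proof -
    have "v x powr (p + 1) \<le> (l * u x powr a) powr (p + 1)"
      using comparison[of x] p by (intro powr_mono2) auto
    also have "\<dots> = l powr (p + 1) * u x powr (q + 1)"
    proof -
      have "a * (p + 1) = q + 1" using p by (simp add: a_def)
      then show ?thesis using l by (simp add: powr_mult powr_powr)
    qed
    finally have 1: "v x powr (p + 1) \<le> l powr (p + 1) * u x powr (q + 1)" .
    define m where "m = u x powr - 2 * v x powr (p - 1)"
    have m: "0 \<le> m" by (simp add: m_def)
    have "Y\<^sup>2 = (u x powr - 1 * u x powr - 1) * (v x powr p * v x powr p)"
      by (simp only: Y_def power2_eq_square mult_ac)
    also have "u x powr - 1 * u x powr - 1 = u x powr - 2"
      unfolding powr_add[symmetric] by simp
    also have "v x powr p * v x powr p = v x powr (p - 1) * v x powr (p + 1)"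
      unfolding powr_add[symmetric] by simp
    finally have Y2: "Y\<^sup>2 = m * v x powr (p + 1)"
      unfolding m_def by (simp only: mult.assoc)
    have PQ_eq: "P * Q = p * q * (m * u x powr (q + 1))"
    proof -
      have "u x powr - 2 * u x powr (q + 1) = u x powr (q - 1)"
        by (simp flip: powr_add)
      then have "v x powr (p - 1) * (u x powr - 2 * u x powr (q + 1)) = v x powr (p - 1) * u x powr (q - 1)"
        by (rule arg_cong)
      then have "m * u x powr (q + 1) = v x powr (p - 1) * u x powr (q - 1)"
        unfolding m_def by (simp only: mult_ac)
      moreover have "P * Q = p * q * (v x powr (p - 1) * u x powr (q - 1))"
        using z by (simp add: P_def Q_def)
      ultimately show ?thesis by simp
    qed
    have "(T * Y)\<^sup>2 = p * q * a * (m * v x powr (p + 1))"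
      by (simp add: power_mult_distrib T_sq Y2)
    also have "\<dots> \<le> p * q * a * (m * (l powr (p + 1) * u x powr (q + 1)))"
      using 1 a m p pq by (intro mult_left_mono) auto
    also have "\<dots> = p * q * (m * u x powr (q + 1)) * (a * l powr (p + 1))"
      by (simp only: mult_ac)
    also have "\<dots> = P * Q"
      unfolding l(2) PQ_eq by simp
    finally show ?thesis .
  qed
  also have "P * Q \<le> ((P + Q) / 2)\<^sup>2"
  proof -
    have "((P + Q) / 2)\<^sup>2 - P * Q = ((P - Q) / 2)\<^sup>2"
      by (simp add: power2_eq_square field_simps)
    then show ?thesis
      using zero_le_power2[of "(P - Q) / 2"] by linarith
  qed
  finally have "T * Y \<le> (P + Q) / 2"
    by (rule power2_le_imp_le) (use PQ in simp)
  then have "Y \<le> 1 / (2 * T) * (P + Q)"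
    using T_gt_1 by (simp add: field_simps)
  then show ?thesis by (simp add: Y_def P_def Q_def)
qed

definition stable where
  "stable \<longleftrightarrow> (\<exists>z1 z2. frac_sol s z1 (\<lambda>x. p * v x powr (p - 1) * z2 x) \<and> frac_sol s z2 (\<lambda>x. q * u x powr (q - 1) * z1 x) \<and>
     (\<forall>x. 0 < z1 x) \<and> (\<forall>x. 0 < z2 x))"

text \<open>All four equations enter one test. The multiplier -u^(2t-1) is the source of coercivity,
  and each Picone multiplier costs its coefficient times the squared increment of u^t \<eta>; the
  sum of these costs has to stay below (2t-1)/t^2.\<close>

lemma stable_weighted_bound:
  assumes st: "stable" and t: "t\<^sup>2 < T * (2 * t - 1)"
    and int: "integrable lborel (\<lambda>x. u x powr (2 * t) * weight s 1 x)"
  shows "weighted_bound s (\<lambda>x. u x powr (2 * t + b)) (\<lambda>x. u x powr (2 * t))"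
proof -
  obtain z1 z2 where z: "frac_sol s z1 (\<lambda>x. p * v x powr (p - 1) * z2 x)" "frac_sol s z2 (\<lambda>x. q * u x powr (q - 1) * z1 x)"
    and zpos: "\<And>x. 0 < z1 x" "\<And>x. 0 < z2 x"
    using st by (auto simp: stable_def)
  have nz: "z1 x \<noteq> 0" "z2 x \<noteq> 0" for x using zpos[of x] by auto
  have zc: "continuous_on UNIV z1" "continuous_on UNIV z2"
    using z frac_sol_continuous by auto
  have "0 < T * (2 * t - 1)"
    using t zero_le_power2[of t] by linarith
  then have t12: "1 / 2 < t"
    using T_gt_1 by (simp add: zero_less_mult_iff)
  \<comment> \<open>The condition on \<open>t\<close> is precisely this gap. A \<kappa> strictly
    inside leaves room below for the term with \<open>v\<close> and above for the cut-off
    error.\<close>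
  have "1 / T < (2 * t - 1) / t\<^sup>2"
    using t t12 T_gt_1 by (simp add: field_simps)
  then obtain \<kappa> where \<kappa>: "1 / T < \<kappa>" "\<kappa> < (2 * t - 1) / t\<^sup>2"
    using dense by blast
  have "0 < 1 / T" using T_gt_1 by simp
  then have \<kappa>0: "0 < \<kappa>" using \<kappa>(1) by linarith
  obtain C where C: "0 < C" "\<And>a b A B :: real. 0 < a \<Longrightarrow> 0 < b \<Longrightarrow>
     \<kappa> * (a powr t * A - b powr t * B)\<^sup>2
       - (a - b) * (a powr (2 * t - 1) * A\<^sup>2 - b powr (2 * t - 1) * B\<^sup>2)
     \<le> C * (a powr (2 * t) + b powr (2 * t)) * (A - B)\<^sup>2"
    using power_test_pointwise[OF t12 \<kappa>0 \<kappa>(2)] by blast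
  \<comment> \<open>Each stability weight receives the coefficient from
    \<open>stability_potential\<close>. The rest of the budget, \<kappa> - 1/T, goes to the Picone
    term for \<open>v\<close>, whose equation supplies the gain.\<close>
  define c1 where "c1 = 1 / (2 * T)"
  define c3 where "c3 = \<kappa> - 1 / T"
  have c: "0 < c1" "0 < c3" "2 * c1 + c3 = \<kappa>"
    using T_gt_1 \<kappa> by (auto simp: c1_def c3_def)
  define L where "L = [(u, \<lambda>x. v x powr p, \<lambda>x. - (u x powr (2 * t - 1))),
    (z1, \<lambda>x. p * v x powr (p - 1) * z2 x, \<lambda>x. c1 * (u x powr (2 * t) / z1 x)),
    (z2, \<lambda>x. q * u x powr (q - 1) * z1 x, \<lambda>x. c1 * (u x powr (2 * t) / z2 x)),
    (v, \<lambda>x. u x powr q, \<lambda>x. c3 * (u x powr (2 * t) / v x))]"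
  have "weighted_bound s (\<lambda>x. c3 / l * u x powr (2 * t + b)) (\<lambda>x. C * u x powr (2 * t))"
  proof (rule frac_sol_weighted_bound[OF s, where L = L])
    fix u' g F assume "(u', g, F) \<in> set L"
    then show "frac_sol s u' g \<and> continuous_on UNIV F"
      using u v z by (auto simp: L_def nz intro!: continuous_intros zc)
  next
    fix x
    have "u x powr (2 * t) * (u x powr - 1 * v x powr p)
      \<le> u x powr (2 * t) * (c1 * (p * v x powr (p - 1) * z2 x / z1 x + q * u x powr (q - 1) * z1 x / z2 x))"
      unfolding c1_def by (intro mult_left_mono stability_potential zpos) auto
    moreover have "u x powr (2 * t) * (u x powr - 1 * v x powr p) = u x powr (2 * t - 1) * v x powr p"
    proof -
      have "u x powr (2 * t) * u x powr - 1 = u x powr (2 * t - 1)"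
        unfolding powr_add[symmetric] by simp
      then show ?thesis by (simp only: mult.assoc[symmetric])
    qed
    moreover have "c3 / l * u x powr (2 * t + b) \<le> c3 * (u x powr (2 * t) / v x) * u x powr q"
    proof -
      have "u x powr (2 * t + b) * u x powr a = u x powr (2 * t) * u x powr q"
        by (simp add: q_minus_a[symmetric] flip: powr_add)
      then have "c3 / l * u x powr (2 * t + b) * (l * u x powr a) = c3 * (u x powr (2 * t) * u x powr q)"
        using l by (simp add: mult.assoc)
      moreover have "c3 / l * u x powr (2 * t + b) * v x \<le> c3 / l * u x powr (2 * t + b) * (l * u x powr a)"
        using c l comparison by (intro mult_left_mono) auto
      ultimately have "c3 / l * u x powr (2 * t + b) * v x \<le> c3 * (u x powr (2 * t) * u x powr q)"
        by simp
      then show ?thesis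
        using v(2)[of x] by (simp add: pos_le_divide_eq)
    qed
    ultimately show "c3 / l * u x powr (2 * t + b) \<le> (\<Sum>(u, g, F)\<leftarrow>L. F x * g x)"
      by (simp add: L_def algebra_simps)
  next
    fix x y :: 'a and A B :: real
    define \<alpha> where "\<alpha> = u x powr t * A"
    define \<beta> where "\<beta> = u y powr t * B"
    have sq: "u x powr (2 * t) * A\<^sup>2 = \<alpha>\<^sup>2" "u y powr (2 * t) * B\<^sup>2 = \<beta>\<^sup>2"
      by (simp_all add: \<alpha>_def \<beta>_def power_mult_distrib power2_eq_square flip: powr_add)
    have pic: "(w x - w y) * (\<alpha>\<^sup>2 / w x - \<beta>\<^sup>2 / w y) \<le> (\<alpha> - \<beta>)\<^sup>2" if "\<And>x. 0 < w x" for w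
      by (intro picone_pointwise that)
    have "(\<Sum>(u, g, F)\<leftarrow>L. (u x - u y) * (F x * A\<^sup>2 - F y * B\<^sup>2))
      = - ((u x - u y) * (u x powr (2 * t - 1) * A\<^sup>2 - u y powr (2 * t - 1) * B\<^sup>2))
        + c1 * ((z1 x - z1 y) * (\<alpha>\<^sup>2 / z1 x - \<beta>\<^sup>2 / z1 y))
        + c1 * ((z2 x - z2 y) * (\<alpha>\<^sup>2 / z2 x - \<beta>\<^sup>2 / z2 y))
        + c3 * ((v x - v y) * (\<alpha>\<^sup>2 / v x - \<beta>\<^sup>2 / v y))"
    proof -
      have factor: "d * (c * (U / X) * A\<^sup>2 - c * (U' / X') * B\<^sup>2) = c * (d * (U * A\<^sup>2 / X - U' * B\<^sup>2 / X'))"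
        for c d U U' X X' :: real
        by (simp add: right_diff_distrib mult_ac)
      have neg: "d * (- U * A\<^sup>2 - - U' * B\<^sup>2) = - (d * (U * A\<^sup>2 - U' * B\<^sup>2))" for d U U' :: real
        by (simp add: algebra_simps)
      show ?thesis
        unfolding L_def list.map sum_list.Cons sum_list.Nil prod.case factor neg sq by simp
    qed
    also have "\<dots> \<le> - ((u x - u y) * (u x powr (2 * t - 1) * A\<^sup>2 - u y powr (2 * t - 1) * B\<^sup>2))
        + c1 * (\<alpha> - \<beta>)\<^sup>2 + c1 * (\<alpha> - \<beta>)\<^sup>2 + c3 * (\<alpha> - \<beta>)\<^sup>2"
      using c by (intro add_mono mult_left_mono pic zpos v(2) order_refl) auto
    also have "\<dots> = (2 * c1 + c3) * (\<alpha> - \<beta>)\<^sup>2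
        - (u x - u y) * (u x powr (2 * t - 1) * A\<^sup>2 - u y powr (2 * t - 1) * B\<^sup>2)"
      by (simp only: distrib_right mult_2 distrib_left diff_conv_add_uminus add_ac)
    also have "\<dots> \<le> C * (u x powr (2 * t) + u y powr (2 * t)) * (A - B)\<^sup>2"
      unfolding c(3) \<alpha>_def \<beta>_def by (intro C(2) u(2))
    finally show "(\<Sum>(u, g, F)\<leftarrow>L. (u x - u y) * (F x * A\<^sup>2 - F y * B\<^sup>2))
      \<le> (C * u x powr (2 * t) + C * u y powr (2 * t)) * (A - B)\<^sup>2"
      by (simp add: algebra_simps)
  qed (use C c l int in \<open>auto simp: mult.assoc\<close>)
  then show ?thesis
    by (rule weighted_bound_mono[OF s(1), where c = "l / c3" and d = C]) (use c l C int in auto)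
qed

text \<open>\<open>t1\<close> and \<open>t2\<close> are the roots of t^2 = T(2t - 1); they coincide
  with \<open>t_minus p q\<close> and \<open>t_plus p q\<close>.\<close>

definition t1 where "t1 = T - sqrt (T\<^sup>2 - T)"
definition t2 where "t2 = T + sqrt (T\<^sup>2 - T)"

lemma t1_less_t2: "t1 < t2"
  using T_gt_1 by (simp add: t1_def t2_def power2_eq_square)

lemma between_t1_t2:
  assumes "t1 < t" "t < t2"
  shows "t\<^sup>2 < T * (2 * t - 1)"
proof -
  have "\<bar>t - T\<bar> < sqrt (T\<^sup>2 - T)"
    using assms by (auto simp: t1_def t2_def abs_if)
  then have "\<bar>t - T\<bar>\<^sup>2 < (sqrt (T\<^sup>2 - T))\<^sup>2"
    by (intro power_strict_mono) auto
  also have "\<dots> = T\<^sup>2 - T"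
    using T_gt_1 by (simp add: power2_eq_square)
  finally show ?thesis
    by (simp add: power2_eq_square algebra_simps)
qed

text \<open>Induction on the number of gains \<open>b\<close> above q. Each step needs an exponent
  already reached that lies strictly between 2 t1 and 2 t2; the condition 2 t1 < q guarantees one
  from the start.\<close>

lemma integrable_u_below_t2:
  assumes st: "stable" and t1: "2 * t1 < q" and r: "0 \<le> r" "r < 2 * t2"
  shows "integrable lborel (\<lambda>x. u x powr r * weight s 1 x)"
proof -
  have "integrable lborel (\<lambda>x. u x powr r * weight s 1 x)"
    if "0 \<le> r" "r < 2 * t2" "r < q + real n * b" for n r
    using that
  proof (induction n arbitrary: r)
    case 0
    then show ?case by (simp add: integrable_u_below_q)
  next
    case (Suc n)
    show ?case
    proof (cases "r < q + real n * b")
      case True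
      then show ?thesis using Suc by simp
    next
      case False
      \<comment> \<open>The natural choice r - b may fall to 2 t1 or below. In that case the
        midpoint of 2 t1 and q is admissible and its gain still reaches r.\<close>
      define r' where "r' = max (r - b) ((q + 2 * t1) / 2)"
      have nb: "0 \<le> real n * b" using b by simp
      have mid: "2 * t1 < (q + 2 * t1) / 2" "(q + 2 * t1) / 2 < q"
        using t1 by simp_all
      have "2 * t1 < r' \<and> r' < 2 * t2 \<and> r' < q + real n * b \<and> r \<le> r' + b"
      proof -
        have "real (Suc n) * b = real n * b + b" by (simp add: algebra_simps)
        with Suc.prems have rb: "r - b < q + real n * b" by linarith
        show ?thesis
        proof (cases "(q + 2 * t1) / 2 \<le> r - b")
          case True
          then have "r' = r - b" by (simp add: r'_def)
          then show ?thesis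
            using True rb mid b Suc.prems by (intro conjI) linarith+
        next
          case gt: False
          then have "r' = (q + 2 * t1) / 2" by (simp add: r'_def)
          then show ?thesis
            using gt mid nb False Suc.prems by (intro conjI) linarith+
        qed
      qed
      then have r': "2 * t1 < r'" "r' < 2 * t2" "r' < q + real n * b" "r \<le> r' + b"
        by auto
      have "(r' / 2)\<^sup>2 < T * (2 * (r' / 2) - 1)"
        using r' by (intro between_t1_t2) auto
      moreover have "0 < T * (2 * (r' / 2) - 1)"
        using calculation zero_le_power2[of "r' / 2"] by linarith
      then have "0 \<le> r'"
        using T_gt_1 by (simp add: zero_less_mult_iff)
      then have "integrable lborel (\<lambda>x. u x powr (2 * (r' / 2)) * weight s 1 x)"
        using Suc.IH[of r'] r' by simp
      ultimately have "weighted_bound s (\<lambda>x. u x powr (2 * (r' / 2) + b)) (\<lambda>x. u x powr (2 * (r' / 2)))"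
        by (intro stable_weighted_bound st)
      then have "integrable lborel (\<lambda>x. u x powr (r' + b) * weight s 1 x)"
        using weighted_bound_integrable by fastforce
      then show ?thesis
        by (rule integrable_weight_powr_mono[OF s(1), rotated 2]) (use Suc.prems r' in auto)
    qed
  qed
  moreover obtain n where "(r - q) / b < real n"
    using reals_Archimedean2 by blast
  then have "r < q + real n * b"
    using b by (simp add: field_simps)
  ultimately show ?thesis
    using r by blast
qed

lemma not_stable:
  assumes t1: "2 * t1 < q" and dim: "real DIM('a) < 2 * s + 4 * s / b * t2"
  shows "\<not> stable"
proof
  assume st: "stable"
  \<comment> \<open>The value of t at which N = 2s(2t + b)/b. Larger t satisfy the dimension
    condition of \<open>weighted_bound_imp_zero\<close>, and the bound on the dimension says that t0
    < t2.\<close>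
  define t0 where "t0 = (real DIM('a) / (2 * s) - 1) * b / 2"
  have "real DIM('a) - 2 * s < t2 * (4 * s / b)"
    using dim by (simp add: algebra_simps)
  then have "(real DIM('a) - 2 * s) * (b / (4 * s)) < t2"
    using s b by (simp add: field_simps)
  moreover have "t0 = (real DIM('a) - 2 * s) * (b / (4 * s))"
    using s by (simp add: t0_def field_simps)
  ultimately have "max t0 t1 < t2"
    using t1_less_t2 by simp
  then obtain t where "max t0 t1 < t" and t: "t < t2"
    using dense by blast
  then have t01: "t0 < t" "t1 < t" by auto
  have tq: "t\<^sup>2 < T * (2 * t - 1)"
    using t01 t by (intro between_t1_t2)
  have "0 < T * (2 * t - 1)"
    using tq zero_le_power2[of t] by linarith
  then have tpos: "0 < 2 * t"
    using T_gt_1 by (simp add: zero_less_mult_iff)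
  have int: "integrable lborel (\<lambda>x. u x powr (2 * t) * weight s 1 x)"
    using tpos t by (intro integrable_u_below_t2 st t1) auto
  have "u 0 = 0"
  proof (rule weighted_bound_imp_zero[OF s(1) cont(1) _ tpos b _ int])
    show "weighted_bound s (\<lambda>x. u x powr (2 * t + b)) (\<lambda>x. u x powr (2 * t))"
      using st tq int by (rule stable_weighted_bound)
    have "(real DIM('a) / (2 * s) - 1) * b < 2 * t"
      using t01 by (simp add: t0_def)
    then have "real DIM('a) / (2 * s) * b < 2 * t + b"
      by (simp add: algebra_simps)
    then show "real DIM('a) < 2 * s * (2 * t + b) / b"
      using s b by (simp add: field_simps)
  qed simp
  then show False by simp
qed

end

section \<open>Transfer to the original notions and the two cases of the theorem\<close>

lemma lane_emden_no_stable_solution: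
  fixes u v :: "'a::euclidean_space \<Rightarrow> real"
  assumes s: "0 < s" "s < 1" and pq: "q \<le> p" "1 < q" and t: "t_minus p q < q / 2"
    and dim: "real DIM('a) < 2 * s + 4 * s * (p + 1) / (p * q - 1) * t_plus p q"
    and pos: "positive_solution s p q u v"
  shows "\<not> stable_solution s p q u v"
proof
  assume stab: "stable_solution s p q u v"
  have uv: "\<And>x. 0 < u x" "\<And>x. 0 < v x" "\<And>x. u x \<noteq> 0" "\<And>x. v x \<noteq> 0"
    using pos by (auto simp: positive_solution_def less_le)
  have C: "continuous_on UNIV u" "continuous_on UNIV v"
    using pos C_space_continuous by (auto simp: positive_solution_def)
  interpret lane_emden s p q u v
  proof
    have "continuous_on UNIV (\<lambda>x. v x powr p)" "continuous_on UNIV (\<lambda>x. u x powr q)"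
      using uv by (intro continuous_intros C; simp)+
    then show "frac_sol s u (\<lambda>x. v x powr p)" "frac_sol s v (\<lambda>x. u x powr q)"
      using pos by (auto simp: positive_solution_def frac_sol_def)
  qed (use s pq uv in auto)
  have "stable"
  proof -
    obtain z1 z2 \<sigma> where z: "s < \<sigma>" "z1 \<in> C_space (2 * \<sigma>) \<inter> L_space s" "z2 \<in> C_space (2 * \<sigma>) \<inter> L_space s"
      "\<And>x. 0 < z1 x" "\<And>x. 0 < z2 x"
      "\<And>x. has_frac_laplacian s z1 x (p * v x powr (p - 1) * z2 x)"
      "\<And>x. has_frac_laplacian s z2 x (q * u x powr (q - 1) * z1 x)"
      using stab unfolding stable_solution_def by blast
    have "continuous_on UNIV z1" "continuous_on UNIV z2"
      using z C_space_continuous by auto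
    then have "continuous_on UNIV (\<lambda>x. p * v x powr (p - 1) * z2 x)" "continuous_on UNIV (\<lambda>x. q * u x powr (q - 1) * z1 x)"
      by (auto intro!: continuous_intros)
    then have "frac_sol s z1 (\<lambda>x. p * v x powr (p - 1) * z2 x)" "frac_sol s z2 (\<lambda>x. q * u x powr (q - 1) * z1 x)"
      using z unfolding frac_sol_def by blast+
    then show ?thesis
      using z(4,5) by (auto simp: stable_def)
  qed
  moreover have T2: "T\<^sup>2 = p * q * (q + 1) / (p + 1)"
    by (simp add: T_sq a_def)
  have "t1 = t_minus p q" "t2 = t_plus p q"
    unfolding t1_def t2_def t_minus_def t_plus_def T2 by (simp_all add: T_def)
  moreover have "4 * s / b = 4 * s * (p + 1) / (p * q - 1)"
    by (simp add: b_def)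
  ultimately show False
    using not_stable t dim by simp
qed

text \<open>The claim follows from (T - q/2)^2 < T^2 - T, that is q^2/4 < T(q - 1). Since T >= q
  when q <= p, it suffices that q/4 < q - 1, which is where 4/3 comes from.\<close>

lemma t_minus_less:
  assumes pq: "q \<le> p" "4 / 3 < q"
  shows "t_minus p q < q / 2"
proof -
  define P where "P = p * q * (q + 1) / (p + 1)"
  define T where "T = sqrt P"
  have "q * q \<le> P"
  proof -
    have "q * (q * (p + 1)) \<le> q * (p * (q + 1))"
      using pq by (intro mult_left_mono) (auto simp: algebra_simps)
    then show ?thesis
      using pq by (simp add: P_def pos_le_divide_eq mult_ac)
  qed
  then have "q \<le> T" and P: "0 \<le> P"
    using pq by (auto simp: T_def power2_eq_square intro: real_le_rsqrt order_trans[OF zero_le_square])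
  then have TT: "T\<^sup>2 = P"
    by (simp add: T_def)
  have "q * (q / 4) < q * (q - 1)"
    using pq by (intro mult_strict_left_mono) auto
  also have "\<dots> \<le> T * (q - 1)"
    using pq \<open>q \<le> T\<close> by (intro mult_right_mono) auto
  finally have "(T - q / 2)\<^sup>2 < P - T"
    unfolding TT[symmetric] by (simp add: power2_eq_square algebra_simps)
  then have "T - q / 2 < sqrt (P - T)"
    by (rule real_less_rsqrt)
  then show ?thesis
    by (simp add: t_minus_def T_def P_def)
qed

theorem theorem1p2:
  fixes s p q :: real
  assumes "0 < s" "s < 1" "p > 1" "q > 1"
  shows "(p \<ge> q \<and> q > 4 / 3 \<and>
            real CARD('n::finite) < 2 * s + 4 * s * (p + 1) / (p * q - 1) * t_plus p q
          \<longrightarrow> \<not> (\<exists>(u :: real ^ 'n \<Rightarrow> real) v. positive_solution s p q u v \<and> stable_solution s p q u v))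
       \<and> (q \<le> min p (4 / 3) \<and> t_minus p q < q / 2 \<and>
            real CARD('n) < 2 * s + 4 * s * (p + 1) / (p * q - 1) * t_plus p q
          \<longrightarrow> \<not> (\<exists>(u :: real ^ 'n \<Rightarrow> real) v. positive_solution s p q u v \<and> stable_solution s p q u v))"
  using lane_emden_no_stable_solution[where 'a = "real ^ 'n", OF assms(1,2) _ assms(4)] t_minus_less
  by auto

end
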